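(* Let $m>n\geq1$ be integers and let $\tau>\frac{m}{n}-1$. Then \[ \dim\left(W_0(m,n;\tau)\right)=(m-1)n+\frac{m}{\tau+1}. \]
   Context: $\mathbb{I}^{mn}:=[-\tfrac12,\tfrac12]^{mn}$, and its points are regarded as $m\times n$ matrices $X$. For a vector, $|\cdot|$ denotes the supremum norm; for $\mathbf{q}\in\mathbb{Z}^m$ (a row vector), $\mathbf{q}X\in\mathbb{R}^n$ is the vector-matrix product. For $\tau>0$ define \[ W_0(m,n;\tau):=\{X\in\mathbb{I}^{mn}: |\mathbf{q}X|<|\mathbf{q}|^{-\tau}\text{ for infinitely many }\mathbf{q}\in\mathbb{Z}^m\setminus\{\mathbf{0}\}\}. \] $\dim$ denotes Hausdorff dimension. *)

theory Defs
  imports "HOL-Analysis.Analysis"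
begin

(* The s-th power of the diameter, with (diam U)^0 = 1 for nonempty U (so that the
   0-dimensional measure counts points, whereas 0 powr 0 = 0) and weight 0 for the empty set. *)
definition diam_power :: "real \<Rightarrow> 'a::metric_space set \<Rightarrow> ennreal" where
  "diam_power s U =
     (if U = {} then 0 else if s = 0 then 1 else ennreal (diameter U powr s))"

(* Boundedness is required because diameter is only meaningful for bounded sets.
   Finite covers are included, as sets of the sequence may be empty. *)
definition is_delta_cover :: "real \<Rightarrow> 'a::metric_space set \<Rightarrow> (nat \<Rightarrow> 'a set) \<Rightarrow> bool" where
  "is_delta_cover \<delta> A U \<longleftrightarrow>
     A \<subseteq> (\<Union>i. U i) \<and> (\<forall>i. bounded (U i) \<and> diameter (U i) \<le> \<delta>)"

definition hausdorff_premeasure :: "real \<Rightarrow> real \<Rightarrow> 'a::metric_space set \<Rightarrow> ennreal" where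
  "hausdorff_premeasure s \<delta> A =
     (INF U \<in> {U. is_delta_cover \<delta> A U}. (\<Sum>i. diam_power s (U i)))"

definition hausdorff_measure :: "real \<Rightarrow> 'a::metric_space set \<Rightarrow> ennreal" where
  "hausdorff_measure s A = (SUP \<delta> \<in> {0<..}. hausdorff_premeasure s \<delta> A)"

definition hausdorff_dim :: "'a::metric_space set \<Rightarrow> ereal" where
  "hausdorff_dim A = Inf {ereal s | s. 0 \<le> s \<and> hausdorff_measure s A = 0}"

definition real_vec :: "int ^ 'm \<Rightarrow> real ^ 'm" where
  "real_vec q = (\<chi> i. real_of_int (q $ i))"

(* real ^ 'n ^ 'm is the type of matrices with rows indexed by 'm and columns by 'n.
   Its metric is the Euclidean one on the space of all entries. *)
definition centered_cube :: "(real ^ 'n ^ 'm) set" where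
  "centered_cube = {X. \<forall>i j. - (1/2) \<le> X $ i $ j \<and> X $ i $ j \<le> 1/2}"

(* infnorm is the supremum norm. *)
definition W0 :: "real \<Rightarrow> (real ^ 'n ^ 'm) set" where
  "W0 \<tau> = {X \<in> centered_cube.
      infinite {q :: int ^ 'm. q \<noteq> 0 \<and>
        infnorm (real_vec q v* X) < infnorm (real_vec q) powr (- \<tau>)}}"

end

theory Submission imports Defs begin

text \<open>Upper bound. For an integer row \<open>q\<close> of size \<open>r\<close>, the matrices with \<open>|q X| < r^(-\<tau>)\<close> form a
neighbourhood of width about \<open>\<theta> = r^(-\<tau>-1)\<close> of a linear space of dimension \<open>(m - 1) n\<close>. It splits into
\<open>O(\<theta>^(-(m-1)n))\<close> pieces of diameter \<open>O(\<theta>)\<close>, and since about \<open>2^(km)\<close> rows have size about \<open>2^k\<close>, the sum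
of the \<open>s\<close>-th powers of the diameters is a convergent geometric series as soon as
\<open>(\<tau> + 1) (s - (m - 1) n) > m\<close> (\<open>null_measure_W0\<close>).

Lower bound. Write a matrix with invertible \<open>n \<times> n\<close> block \<open>A\<close> as the rows of \<open>A\<close> together with the rows of
\<open>Y A\<close>. Then \<open>q X = (q' + q'' Y) A\<close>, so \<open>q X\<close> is small once \<open>q'' Y\<close> is close to an integer vector. The chart
\<open>block_chart\<close> does not contract distances by more than a constant factor, so it is enough to find a set of
positive \<open>s\<close>-dimensional measure of points \<open>z\<close> of the unit cube for which, infinitely often, the columns of
\<open>z\<close> have forms \<open>q'' z\<close> very close to integers.

Such a set is built from masses on the dyadic grid. If the masses of the cubes of level \<open>l\<close> have a sum of
squares of at most \<open>C 2^(-l s')\<close> for every \<open>l\<close>, then by the inequality of the arithmetic and the geometric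
mean no family of cubes with a small sum of \<open>s\<close>-th powers, \<open>s < s'\<close>, can carry the whole mass
(\<open>hausdorff_measure_pos_of_energy\<close>). A compactness argument lets this be applied to finite stages, so no
limit measure is needed. The stages arise by writing the digits of \<open>z\<close> in independent blocks: if each block
is distributed according to a pattern of small energy, so is their concatenation
(\<open>pattern_concatenation\<close>), and a block that starts at digit \<open>L\<close> constrains the fractional part of
\<open>2^L z\<close>, which is again a condition on \<open>(2^L q'') z\<close> modulo 1.

A pattern comes from a large prime \<open>P\<close>. Give to a point \<open>x / P\<close>, \<open>x\<close> an integer matrix, the proportion of
forms \<open>q\<close> of a family of forms of size \<open>Q\<close> for which every \<open>q x_j\<close> lies in a short window modulo \<open>P\<close>.
Its energy is a second moment: an average over pairs \<open>(q, u)\<close> of forms of the \<open>n\<close>-th power of the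
correlation of \<open>q\<close> and \<open>u\<close> on one column. Nonparallel forms are independent modulo \<open>P\<close>, so that their
correlation is of the order of that of the uniform distribution; parallel forms are correlated only through
the greatest common divisor of their coefficients at a fixed index (\<open>joint_hits_le\<close>), and the sum of these divisors is small
enough (\<open>sum_parallel_gcd_le\<close>). At the finest scale \<open>1 / (Q E)\<close>, with \<open>E\<close> about \<open>Q^\<tau>\<close>, this gives
precisely the exponent \<open>(m - 1) n + m / (\<tau> + 1)\<close> (\<open>exists_pattern_near_form\<close>); the assumption on \<open>\<tau>\<close> says
that this is below \<open>m n\<close>, the exponent of the uniform distribution.\<close>

section \<open>Null sets for Hausdorff measure\<close>

lemma bounded_diameter_leI:
  fixes S :: "'a::metric_space set"
  assumes "0 \<le> d" "\<And>x y. x \<in> S \<Longrightarrow> y \<in> S \<Longrightarrow> dist x y \<le> d"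
  shows "bounded S" "diameter S \<le> d"
proof -
  show "bounded S" unfolding bounded_two_points using assms(2) by blast
  show "diameter S \<le> d"
    using assms by (auto simp: diameter_def intro!: cSUP_least)
qed

lemma null_measure_cover:
  assumes "hausdorff_measure s A = 0" "\<delta> > 0" "\<eta> > 0"
  obtains U where "is_delta_cover \<delta> A U" "(\<Sum>i. diam_power s (U i)) < \<eta>"
proof -
  have "hausdorff_premeasure s \<delta> A \<le> hausdorff_measure s A"
    unfolding hausdorff_measure_def using assms(2) by (intro SUP_upper) auto
  then have "hausdorff_premeasure s \<delta> A < \<eta>"
    using assms by simp
  then show ?thesis
    unfolding hausdorff_premeasure_def Inf_less_iff using that by auto
qed

lemma hausdorff_measure_eq_0I:
  assumes "\<And>\<delta> \<eta>. \<delta> > 0 \<Longrightarrow> \<eta> > 0 \<Longrightarrow>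
    \<exists>U. is_delta_cover \<delta> A U \<and> (\<Sum>i. diam_power s (U i)) \<le> ennreal \<eta>"
  shows "hausdorff_measure s A = 0"
proof -
  have "hausdorff_premeasure s \<delta> A \<le> 0" if "\<delta> > 0" for \<delta> :: real
  proof (rule ennreal_le_epsilon)
    fix \<eta> :: real assume "\<eta> > 0"
    with assms[OF that] obtain U where U: "is_delta_cover \<delta> A U"
      "(\<Sum>i. diam_power s (U i)) \<le> ennreal \<eta>" by blast
    have "hausdorff_premeasure s \<delta> A \<le> (\<Sum>i. diam_power s (U i))"
      unfolding hausdorff_premeasure_def using U(1) by (intro INF_lower) auto
    with U(2) show "hausdorff_premeasure s \<delta> A \<le> 0 + ennreal \<eta>" by simp
  qed
  then have "hausdorff_measure s A \<le> 0"
    unfolding hausdorff_measure_def by (intro SUP_least) auto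
  then show ?thesis by simp
qed

lemma null_measure_mono_exponent:
  assumes "hausdorff_measure s A = 0" "0 \<le> s" "s \<le> t"
  shows "hausdorff_measure t A = 0"
proof (rule hausdorff_measure_eq_0I)
  fix \<delta> \<eta> :: real assume *: "\<delta> > 0" "\<eta> > 0"
  then have "min \<delta> 1 > 0" by simp
  from null_measure_cover[OF assms(1) this, of "ennreal \<eta>"] *(2)
  obtain U where U: "is_delta_cover (min \<delta> 1) A U" "(\<Sum>i. diam_power s (U i)) < ennreal \<eta>"
    by auto
  have "diam_power t (U i) \<le> diam_power s (U i)" for i
  proof -
    have d: "bounded (U i)" "diameter (U i) \<le> 1"
      using U(1) by (auto simp: is_delta_cover_def)
    then have "0 \<le> diameter (U i)" by (simp add: diameter_ge_0)
    then have "diameter (U i) powr t \<le> diameter (U i) powr s" "diameter (U i) powr t \<le> 1"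
      using d assms(2,3) by (cases "diameter (U i) = 0"; simp add: powr_mono' powr_le1)+
    then show ?thesis
      using assms(2,3) by (auto simp: diam_power_def ennreal_leI)
  qed
  then have "(\<Sum>i. diam_power t (U i)) \<le> (\<Sum>i. diam_power s (U i))"
    by (intro suminf_le) auto
  with U(2) have "(\<Sum>i. diam_power t (U i)) \<le> ennreal \<eta>" by simp
  moreover have "is_delta_cover \<delta> A U"
    using U(1) by (auto simp: is_delta_cover_def)
  ultimately show "\<exists>U. is_delta_cover \<delta> A U \<and> (\<Sum>i. diam_power t (U i)) \<le> ennreal \<eta>"
    by blast
qed

lemma hausdorff_measure_subset:
  assumes "A \<subseteq> B" "hausdorff_measure s B = 0"
  shows "hausdorff_measure s A = 0"
proof (rule hausdorff_measure_eq_0I)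
  fix \<delta> \<eta> :: real assume *: "\<delta> > 0" "\<eta> > 0"
  from null_measure_cover[OF assms(2) *(1), of "ennreal \<eta>"] *(2)
  obtain U where U: "is_delta_cover \<delta> B U" "(\<Sum>i. diam_power s (U i)) < ennreal \<eta>"
    by auto
  then show "\<exists>U. is_delta_cover \<delta> A U \<and> (\<Sum>i. diam_power s (U i)) \<le> ennreal \<eta>"
    using assms(1) by (intro exI[of _ U]) (auto simp: is_delta_cover_def)
qed

text \<open>Pulling back a cover of \<open>f ` K\<close> gives a cover of \<open>K\<close> whose diameters grow by a factor of at most \<open>1 / c\<close>.\<close>

lemma null_measure_expanding:
  fixes f :: "'a::metric_space \<Rightarrow> 'b::metric_space"
  assumes c: "c > 0" and f: "\<And>x y. x \<in> K \<Longrightarrow> y \<in> K \<Longrightarrow> c * dist x y \<le> dist (f x) (f y)"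
    and s: "s \<ge> 0" and null: "hausdorff_measure s (f ` K) = 0"
  shows "hausdorff_measure s K = 0"
proof (rule hausdorff_measure_eq_0I)
  fix \<delta> \<eta> :: real assume *: "\<delta> > 0" "\<eta> > 0"
  have "c * \<delta> > 0" "ennreal (c powr s * \<eta>) > 0" using * c by auto
  from null_measure_cover[OF null this]
  obtain U where U: "is_delta_cover (c * \<delta>) (f ` K) U"
      "(\<Sum>i. diam_power s (U i)) < ennreal (c powr s * \<eta>)" .
  define V where "V i = {x \<in> K. f x \<in> U i}" for i
  have d: "bounded (V i) \<and> diameter (V i) \<le> diameter (U i) / c" for i
  proof -
    have bU: "bounded (U i)" using U(1) by (auto simp: is_delta_cover_def)
    have le: "dist x y \<le> diameter (U i) / c" if "x \<in> V i" "y \<in> V i" for x y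
    proof -
      have "c * dist x y \<le> dist (f x) (f y)" using f that by (auto simp: V_def)
      also have "\<dots> \<le> diameter (U i)"
        using that bU by (auto simp: V_def intro!: diameter_bounded_bound)
      finally show ?thesis using c by (simp add: field_simps)
    qed
    have "0 \<le> diameter (U i) / c" using c bU by (simp add: diameter_ge_0)
    from bounded_diameter_leI[OF this le] show ?thesis by blast
  qed
  have cover: "is_delta_cover \<delta> K V"
    unfolding is_delta_cover_def
  proof (intro conjI allI)
    show "K \<subseteq> (\<Union>i. V i)" using U(1) by (auto simp: V_def is_delta_cover_def)
    fix i
    have "diameter (U i) \<le> c * \<delta>" using U(1) by (auto simp: is_delta_cover_def)
    then have "diameter (U i) / c \<le> \<delta>" using c by (simp add: field_simps)
    then show "bounded (V i)" "diameter (V i) \<le> \<delta>" using d[of i] by auto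
  qed
  have "diam_power s (V i) \<le> ennreal (1 / c powr s) * diam_power s (U i)" for i
  proof (cases "V i = {} \<or> s = 0")
    case True
    then show ?thesis
    proof
      assume "s = 0"
      moreover have "U i \<noteq> {}" if "V i \<noteq> {}" using that by (auto simp: V_def)
      ultimately show ?thesis using c by (auto simp: diam_power_def)
    qed (simp add: diam_power_def)
  next
    case False
    then have "U i \<noteq> {}" by (auto simp: V_def)
    have bU: "bounded (U i)" using U(1) by (auto simp: is_delta_cover_def)
    have "diameter (V i) powr s \<le> (diameter (U i) / c) powr s"
      using d[of i] s by (intro powr_mono2) (auto simp: diameter_ge_0)
    also have "\<dots> = 1 / c powr s * diameter (U i) powr s"
      using c bU by (simp add: powr_divide diameter_ge_0)
    finally show ?thesis
      using False \<open>U i \<noteq> {}\<close> c by (simp add: diam_power_def flip: ennreal_mult)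
  qed
  then have "(\<Sum>i. diam_power s (V i)) \<le> (\<Sum>i. ennreal (1 / c powr s) * diam_power s (U i))"
    by (intro suminf_le) auto
  also have "\<dots> = ennreal (1 / c powr s) * (\<Sum>i. diam_power s (U i))" by simp
  also have "\<dots> \<le> ennreal (1 / c powr s) * ennreal (c powr s * \<eta>)"
    using U(2) by (intro mult_left_mono) auto
  also have "\<dots> = ennreal \<eta>" using c *(2) by (simp flip: ennreal_mult)
  finally show "\<exists>U. is_delta_cover \<delta> K U \<and> (\<Sum>i. diam_power s (U i)) \<le> ennreal \<eta>"
    using cover by blast
qed

lemma hausdorff_dim_eqI:
  assumes "s0 \<ge> 0" "\<And>s. s > s0 \<Longrightarrow> hausdorff_measure s A = 0"
    and "\<And>s. 0 \<le> s \<Longrightarrow> s < s0 \<Longrightarrow> hausdorff_measure s A \<noteq> 0"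
  shows "hausdorff_dim A = ereal s0"
proof (rule antisym)
  show "hausdorff_dim A \<le> ereal s0"
  proof (rule ereal_le_epsilon2)
    fix e :: real assume "e > 0"
    then show "hausdorff_dim A \<le> ereal s0 + ereal e"
      unfolding hausdorff_dim_def using assms(1,2) by (intro Inf_lower) auto
  qed
  show "ereal s0 \<le> hausdorff_dim A"
    unfolding hausdorff_dim_def
  proof (intro Inf_greatest, clarify)
    fix s :: real assume "0 \<le> s" "hausdorff_measure s A = 0"
    then show "ereal s0 \<le> ereal s" using assms(3)[of s] by force
  qed
qed

section \<open>The upper bound\<close>

lemma infnorm_attained:
  fixes x :: "real ^ 'm::finite"
  obtains i where "infnorm x = \<bar>x $ i\<bar>"
proof -
  have "{\<bar>x $ i\<bar> |i. i \<in> UNIV} = range (\<lambda>i. \<bar>x $ i\<bar>)" by auto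
  then have "infnorm x = Max (range (\<lambda>i. \<bar>x $ i\<bar>))" by (simp add: infnorm_cart cSup_eq_Max)
  also have "\<dots> \<in> range (\<lambda>i. \<bar>x $ i\<bar>)" by (intro Max_in) auto
  finally show thesis using that by auto
qed

text \<open>Covers are usually given by finitely many sets for each scale \<open>k\<close>; enumerating each finite family as a row of
a double sequence, padded by empty sets of weight 0, turns them into a single sequence.\<close>

lemma null_measure_finite_families:
  fixes A :: "'a::metric_space set" and V :: "'i \<Rightarrow> 'a set" and I :: "nat \<Rightarrow> 'i set"
  assumes "\<And>k. finite (I k)" "A \<subseteq> (\<Union>k. \<Union>i\<in>I k. V i)"
    and "\<And>k i. i \<in> I k \<Longrightarrow> bounded (V i) \<and> diameter (V i) \<le> \<delta>" "\<delta> \<ge> 0"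
    and "\<And>k. (\<Sum>i\<in>I k. diam_power s (V i)) \<le> g k"
  shows "\<exists>U. is_delta_cover \<delta> A U \<and> (\<Sum>i. diam_power s (U i)) \<le> suminf g"
proof -
  have "\<exists>xs. set xs = I k \<and> distinct xs" for k using finite_distinct_list[OF assms(1)] by blast
  then obtain xs where xs: "\<And>k. set (xs k) = I k" "\<And>k. distinct (xs k)" by metis
  define W where "W = (\<lambda>(k, j). if j < length (xs k) then V (xs k ! j) else {})"
  define U where "U i = W (prod_decode i)" for i
  have "is_delta_cover \<delta> A U"
    unfolding is_delta_cover_def
  proof (intro conjI allI)
    show "A \<subseteq> (\<Union>i. U i)"
    proof
      fix x assume "x \<in> A"
      then obtain k i where "i \<in> I k" "x \<in> V i" using assms(2) by blast
      moreover from this obtain j where "j < length (xs k)" "xs k ! j = i"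
        using xs(1)[of k] by (metis in_set_conv_nth)
      ultimately have "x \<in> U (prod_encode (k, j))" by (simp add: U_def W_def)
      then show "x \<in> (\<Union>i. U i)" by blast
    qed
    fix i
    obtain k j where kj: "prod_decode i = (k, j)" by (cases "prod_decode i")
    have "xs k ! j \<in> I k" if "j < length (xs k)" using xs(1)[of k] that by (metis nth_mem)
    then show "bounded (U i)" "diameter (U i) \<le> \<delta>"
      using assms(3)[of "xs k ! j" k] assms(4) by (auto simp: U_def W_def kj)
  qed
  moreover have "(\<Sum>i. diam_power s (U i)) \<le> suminf g"
  proof -
    have "(\<Sum>i. diam_power s (U i)) = (\<Sum>k. \<Sum>j. diam_power s (W (k, j)))"
      unfolding U_def by (rule suminf_ennreal_2dimen[where f = "\<lambda>p. diam_power s (W p)"]) simp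
    also have "\<dots> \<le> suminf g"
    proof (intro suminf_le)
      fix k
      have "(\<Sum>j. diam_power s (W (k, j))) = (\<Sum>j<length (xs k). diam_power s (W (k, j)))"
        by (rule suminf_finite) (auto simp: W_def diam_power_def)
      also have "\<dots> = (\<Sum>j<length (xs k). diam_power s (V (xs k ! j)))"
        by (intro sum.cong) (auto simp: W_def)
      also have "\<dots> = (\<Sum>i\<in>I k. diam_power s (V i))"
        using sum.reindex_bij_betw[OF bij_betw_nth[OF xs(2)[of k] refl xs(1)[symmetric]], of "\<lambda>i. diam_power s (V i)"]
        by (simp add: xs)
      finally show "(\<Sum>j. diam_power s (W (k, j))) \<le> g k" using assms(5)[of k] by simp
    qed auto
    finally show ?thesis .
  qed
  ultimately show ?thesis by blast
qed

definition slab :: "real \<Rightarrow> int ^ 'm \<Rightarrow> (real ^ 'n ^ 'm) set" where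
  "slab \<tau> q = {X \<in> centered_cube. infnorm (real_vec q v* X) < infnorm (real_vec q) powr (- \<tau>)}"

lemma abs_entry_le_norm: "\<bar>X $ i $ j\<bar> \<le> norm X" for X :: "real ^ 'n::finite ^ 'm::finite"
  using component_le_norm_cart[of "X $ i" j] Finite_Cartesian_Product.norm_nth_le[of X i] by linarith

lemma norm_le_sum_entries: "norm X \<le> (\<Sum>i\<in>UNIV. \<Sum>j\<in>UNIV. \<bar>X $ i $ j\<bar>)" for X :: "real ^ 'n::finite ^ 'm::finite"
proof -
  have "norm X \<le> (\<Sum>i\<in>UNIV. norm (X $ i))" by (simp add: norm_vec_def L2_set_le_sum)
  also have "\<dots> \<le> (\<Sum>i\<in>UNIV. \<Sum>j\<in>UNIV. \<bar>X $ i $ j\<bar>)" by (intro sum_mono norm_le_l1_cart)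
  finally show ?thesis .
qed

lemma vector_matrix_component: "(v v* X) $ j = (\<Sum>i\<in>UNIV. v $ i * X $ i $ j)" for X :: "real ^ 'n ^ 'm::finite"
  by (simp add: vector_matrix_mult_def mult.commute)

text \<open>Choose a coordinate \<open>i0\<close> where \<open>q\<close> has its largest entry, of size \<open>r\<close>. Round every other row of \<open>X\<close> to a grid
of mesh \<open>\<theta>\<close>. Two matrices of the slab that are rounded equally also have close rows \<open>i0\<close>, because
\<open>q_i0\<close> times the difference of these rows is, up to \<open>2 r \<theta>\<close>, a combination of the remaining row differences with
coefficients of at most \<open>r\<close>. Hence only the \<open>(m - 1) n\<close> rounded entries have to be counted.\<close>

lemma slab_partition:
  fixes q :: "int ^ 'm::finite" and \<tau> :: real
  assumes q: "infnorm (real_vec q) \<ge> 1" and \<tau>: "\<tau> > -1"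
  defines "\<theta> \<equiv> infnorm (real_vec q) powr (- (\<tau> + 1))"
  obtains I :: "('m \<times> 'n::finite \<Rightarrow> int) set" and V :: "('m \<times> 'n \<Rightarrow> int) \<Rightarrow> (real ^ 'n ^ 'm) set"
  where "finite I" "real (card I) \<le> (3 / \<theta>) ^ ((CARD('m) - 1) * CARD('n))"
    "slab \<tau> q \<subseteq> (\<Union>y\<in>I. V y)"
    "\<And>y. bounded (V y) \<and> diameter (V y) \<le> real (CARD('m) * CARD('n) * (CARD('m) + 2)) * \<theta>"
proof -
  define r where "r = infnorm (real_vec q)"
  have r: "r \<ge> 1" using q by (simp add: r_def)
  obtain i0 where i0: "r = \<bar>real_vec q $ i0\<bar>" unfolding r_def using infnorm_attained by metis
  have qi: "\<bar>real_vec q $ i\<bar> \<le> r" for i unfolding r_def by (rule component_le_infnorm_cart)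
  have \<theta>: "\<theta> > 0" "\<theta> \<le> 1" "r * \<theta> = r powr (- \<tau>)"
  proof -
    show "\<theta> > 0" using r unfolding \<theta>_def r_def[symmetric] by simp
    have "r powr (- (\<tau> + 1)) \<le> r powr 0" using r \<tau> by (intro powr_mono) auto
    then show "\<theta> \<le> 1" using r unfolding \<theta>_def r_def[symmetric] by simp
    have "r * r powr (- (\<tau> + 1)) = r powr 1 * r powr (- (\<tau> + 1))" using r by simp
    also have "\<dots> = r powr (1 + - (\<tau> + 1))" by (simp only: powr_add)
    finally show "r * \<theta> = r powr (- \<tau>)" unfolding \<theta>_def r_def[symmetric] by simp
  qed
  define f where "f X = (\<lambda>(i, j). if i = i0 then 0 else \<lfloor>X $ i $ j / \<theta>\<rfloor>)" for X :: "real ^ 'n ^ 'm"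
  define V :: "('m \<times> 'n \<Rightarrow> int) \<Rightarrow> (real ^ 'n ^ 'm) set" where "V y = {X \<in> slab \<tau> q. f X = y}" for y
  define lo hi where "lo = \<lfloor>- 1 / (2 * \<theta>)\<rfloor>" and "hi = \<lfloor>1 / (2 * \<theta>)\<rfloor>"
  define B where "B = {lo..hi}"
  define I :: "('m \<times> 'n \<Rightarrow> int) set" where "I = (\<Pi>\<^sub>E ij\<in>UNIV. if fst ij = i0 then {0} else B)"
  have "real (card B) \<le> 3 / \<theta>"
  proof -
    have "1 / (2 * \<theta>) \<ge> 0" "- 1 / (2 * \<theta>) \<le> 0" using \<theta> by simp_all
    then have "0 \<le> hi" "lo \<le> 0" unfolding lo_def hi_def by linarith+
    then have "real (card B) = real_of_int (hi + 1 - lo)" by (simp add: B_def)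
    also have "\<dots> \<le> 1 / (2 * \<theta>) + 1 - (- 1 / (2 * \<theta>) - 1)" unfolding lo_def hi_def by linarith
    also have "\<dots> = 1 / \<theta> + 2" using \<theta> by (simp add: field_simps)
    also have "\<dots> \<le> 3 / \<theta>" using \<theta> by (simp add: field_simps)
    finally show ?thesis .
  qed
  have "finite I" unfolding I_def B_def by (intro finite_PiE) auto
  moreover have "real (card I) \<le> (3 / \<theta>) ^ ((CARD('m) - 1) * CARD('n))"
  proof -
    have "card I = (\<Prod>ij\<in>(UNIV :: ('m \<times> 'n) set). card (if fst ij = i0 then {0} else B))"
      unfolding I_def by (simp add: card_PiE)
    also have "\<dots> = (\<Prod>ij\<in>(UNIV - {i0}) \<times> (UNIV :: 'n set). card B)"
      by (rule prod.mono_neutral_cong_right) auto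
    also have "\<dots> = card B ^ ((CARD('m) - 1) * CARD('n))" by (simp add: card_cartesian_product card_Diff_singleton)
    finally have "real (card I) = real (card B) ^ ((CARD('m) - 1) * CARD('n))" by simp
    also have "\<dots> \<le> (3 / \<theta>) ^ ((CARD('m) - 1) * CARD('n))"
      using \<open>real (card B) \<le> 3 / \<theta>\<close> by (intro power_mono) auto
    finally show ?thesis .
  qed
  moreover have "slab \<tau> q \<subseteq> (\<Union>y\<in>I. V y)"
  proof
    fix X :: "real ^ 'n ^ 'm" assume X: "X \<in> slab \<tau> q"
    have "f X \<in> I"
    proof -
      have "\<lfloor>X $ i $ j / \<theta>\<rfloor> \<in> B" for i j
      proof -
        have "- (1/2) \<le> X $ i $ j" "X $ i $ j \<le> 1/2" using X by (auto simp: slab_def centered_cube_def)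
        then have "- 1 / (2 * \<theta>) \<le> X $ i $ j / \<theta>" "X $ i $ j / \<theta> \<le> 1 / (2 * \<theta>)"
          using \<theta> by (simp_all add: field_simps)
        then show ?thesis by (auto simp: B_def lo_def hi_def intro: floor_mono)
      qed
      then show ?thesis by (auto simp: I_def f_def PiE_UNIV_domain Pi_def)
    qed
    then show "X \<in> (\<Union>y\<in>I. V y)" using X by (auto simp: V_def)
  qed
  moreover have "bounded (V y) \<and> diameter (V y) \<le> real (CARD('m) * CARD('n) * (CARD('m) + 2)) * \<theta>" for y
  proof -
    define D where "D = real (CARD('m) * CARD('n) * (CARD('m) + 2)) * \<theta>"
    have D0: "0 \<le> D" using \<theta> by (simp add: D_def)
    have "dist X Y \<le> D" if XY: "X \<in> V y" "Y \<in> V y" for X Y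
    proof -
      define Z where "Z = X - Y"
      have off: "\<bar>Z $ i $ j\<bar> \<le> \<theta>" if "i \<noteq> i0" for i j
      proof -
        have "f X (i, j) = f Y (i, j)" using XY by (simp add: V_def)
        then have "\<lfloor>X $ i $ j / \<theta>\<rfloor> = \<lfloor>Y $ i $ j / \<theta>\<rfloor>" using that by (simp add: f_def)
        then have "\<bar>X $ i $ j / \<theta> - Y $ i $ j / \<theta>\<bar> \<le> 1" by linarith
        then have "\<bar>Z $ i $ j\<bar> / \<theta> \<le> 1" using \<theta> by (simp add: Z_def abs_divide flip: diff_divide_distrib)
        then show ?thesis using \<theta> by simp
      qed
      have on: "\<bar>Z $ i0 $ j\<bar> \<le> real (CARD('m) + 1) * \<theta>" for j
      proof -
        have b: "\<bar>(real_vec q v* W) $ j\<bar> \<le> r * \<theta>" if "W \<in> slab \<tau> q" for W :: "real ^ 'n ^ 'm"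
          using that component_le_infnorm_cart[of "real_vec q v* W" j] unfolding slab_def \<theta>(3) unfolding r_def by simp
        have "X \<in> slab \<tau> q" "Y \<in> slab \<tau> q" using XY by (simp_all add: V_def)
        then have bXY: "\<bar>(real_vec q v* X) $ j\<bar> \<le> r * \<theta>" "\<bar>(real_vec q v* Y) $ j\<bar> \<le> r * \<theta>"
          using b by blast+
        have e: "real_vec q $ i0 * Z $ i0 $ j
            = (real_vec q v* X) $ j - (real_vec q v* Y) $ j - (\<Sum>i\<in>UNIV - {i0}. real_vec q $ i * Z $ i $ j)"
          unfolding vector_matrix_component Z_def
          by (subst (1 2) sum.remove[of UNIV i0]) (simp_all add: algebra_simps sum_subtractf)
        have "\<bar>\<Sum>i\<in>UNIV - {i0}. real_vec q $ i * Z $ i $ j\<bar> \<le> (\<Sum>i\<in>UNIV - {i0}. r * \<theta>)"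
          unfolding abs_mult
          by (intro order_trans[OF sum_abs] sum_mono, unfold abs_mult, intro mult_mono qi off) (use r in auto)
        also have "\<dots> = real (CARD('m) - 1) * (r * \<theta>)" by simp
        finally have "\<bar>real_vec q $ i0 * Z $ i0 $ j\<bar> \<le> r * \<theta> + r * \<theta> + real (CARD('m) - 1) * (r * \<theta>)"
          unfolding e using bXY by linarith
        also have "\<dots> = r * (real (CARD('m) + 1) * \<theta>)"
        proof -
          have "real (CARD('m) - 1) = real CARD('m) - 1" by (simp add: of_nat_diff Suc_le_eq)
          then show ?thesis by (simp add: algebra_simps)
        qed
        finally show ?thesis using r unfolding abs_mult i0[symmetric] by simp
      qed
      have "\<bar>Z $ i $ j\<bar> \<le> real (CARD('m) + 2) * \<theta>" for i j
      proof (cases "i = i0")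
        case True
        have "real (CARD('m) + 1) * \<theta> \<le> real (CARD('m) + 2) * \<theta>" using \<theta> by (intro mult_right_mono) auto
        then show ?thesis using on[of j] True by simp
      next
        case False
        have "1 * \<theta> \<le> real (CARD('m) + 2) * \<theta>" using \<theta> by (intro mult_right_mono) auto
        then show ?thesis using off[OF False, of j] by simp
      qed
      then have "(\<Sum>i\<in>UNIV. \<Sum>j\<in>UNIV. \<bar>Z $ i $ j\<bar>) \<le> (\<Sum>i\<in>(UNIV::'m set). \<Sum>j\<in>(UNIV::'n set). real (CARD('m) + 2) * \<theta>)"
        by (intro sum_mono)
      also have "\<dots> = D" by (simp add: D_def algebra_simps)
      finally show ?thesis using norm_le_sum_entries[of Z] by (simp add: dist_norm Z_def)
    qed
    from bounded_diameter_leI[OF D0 this] show ?thesis by (simp add: D_def)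
  qed
  ultimately show thesis using that by blast
qed

lemma card_int_vec_le:
  fixes M :: nat
  shows "finite {q :: int ^ 'm::finite. \<forall>i. \<bar>q $ i\<bar> \<le> int M}"
    "card {q :: int ^ 'm::finite. \<forall>i. \<bar>q $ i\<bar> \<le> int M} = (2 * M + 1) ^ CARD('m)"
proof -
  have "bij_betw (\<lambda>q i. q $ i) {q :: int ^ 'm. \<forall>i. \<bar>q $ i\<bar> \<le> int M} (\<Pi>\<^sub>E i\<in>UNIV. {- int M..int M})"
    by (rule bij_betwI[where g = "\<lambda>f. \<chi> i. f i"]) (auto simp: PiE_UNIV_domain Pi_def abs_le_iff vec_eq_iff minus_le_iff)
  moreover have "finite ((\<Pi>\<^sub>E i\<in>(UNIV :: 'm set). {- int M..int M}))" by (intro finite_PiE) auto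
  moreover have "card (\<Pi>\<^sub>E i\<in>(UNIV :: 'm set). {- int M..int M}) = (2 * M + 1) ^ CARD('m)"
    by (simp add: card_PiE nat_add_distrib nat_mult_distrib)
  ultimately show "finite {q :: int ^ 'm. \<forall>i. \<bar>q $ i\<bar> \<le> int M}"
    "card {q :: int ^ 'm::finite. \<forall>i. \<bar>q $ i\<bar> \<le> int M} = (2 * M + 1) ^ CARD('m)"
    by (auto simp: bij_betw_finite dest: bij_betw_same_card)
qed


lemma abs_int_vec_le_infnorm: "\<bar>real_of_int (q $ i)\<bar> \<le> infnorm (real_vec q)" for q :: "int ^ 'm::finite"
  using component_le_infnorm_cart[of "real_vec q" i] by (simp add: real_vec_def)

lemma infnorm_real_vec_ge_1:
  fixes q :: "int ^ 'm::finite"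
  assumes "q \<noteq> 0" shows "infnorm (real_vec q) \<ge> 1"
proof -
  obtain i where "q $ i \<noteq> 0" using assms by (auto simp: vec_eq_iff)
  then have "1 \<le> \<bar>real_of_int (q $ i)\<bar>" by linarith
  then show ?thesis using abs_int_vec_le_infnorm[of q i] by linarith
qed

definition shell :: "nat \<Rightarrow> (int ^ 'm::finite) set" where
  "shell k = {q. 2 ^ k \<le> infnorm (real_vec q) \<and> infnorm (real_vec q) < 2 ^ Suc k}"

lemma finite_infnorm_le: "finite {q :: int ^ 'm::finite. infnorm (real_vec q) \<le> real M}"
    and card_infnorm_le: "card {q :: int ^ 'm::finite. infnorm (real_vec q) \<le> real M} \<le> (2 * M + 1) ^ CARD('m)"
proof -
  have sub: "{q :: int ^ 'm. infnorm (real_vec q) \<le> real M} \<subseteq> {q. \<forall>i. \<bar>q $ i\<bar> \<le> int M}"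
  proof clarify
    fix q :: "int ^ 'm" and i assume "infnorm (real_vec q) \<le> real M"
    then have "\<bar>real_of_int (q $ i)\<bar> \<le> real M" using abs_int_vec_le_infnorm[of q i] by linarith
    then show "\<bar>q $ i\<bar> \<le> int M" by linarith
  qed
  then show "finite {q :: int ^ 'm. infnorm (real_vec q) \<le> real M}" using card_int_vec_le(1) finite_subset by blast
  show "card {q :: int ^ 'm. infnorm (real_vec q) \<le> real M} \<le> (2 * M + 1) ^ CARD('m)"
    unfolding card_int_vec_le(2)[symmetric] by (rule card_mono[OF card_int_vec_le(1) sub])
qed

lemma shell_subset: "shell k \<subseteq> {q. infnorm (real_vec q) \<le> real (2 ^ Suc k)}"
  by (auto simp: shell_def)

lemma finite_shell [simp]: "finite (shell k)"
  using finite_infnorm_le shell_subset by (rule finite_subset[rotated])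

lemma card_shell_le: "real (card (shell k :: (int ^ 'm::finite) set)) \<le> 8 ^ CARD('m) * (2 ^ k) ^ CARD('m)"
proof -
  have "card (shell k :: (int ^ 'm) set) \<le> (2 * 2 ^ Suc k + 1) ^ CARD('m)"
    using card_mono[OF finite_infnorm_le shell_subset[of k]] card_infnorm_le[of "2 ^ Suc k"] by (rule order_trans)
  also have "\<dots> \<le> (8 * 2 ^ k) ^ CARD('m)" by (intro power_mono) auto
  finally have "real (card (shell k :: (int ^ 'm) set)) \<le> real ((8 * 2 ^ k) ^ CARD('m))" by (rule of_nat_mono)
  then show ?thesis by (simp add: power_mult_distrib)
qed

text \<open>Only finitely many integer vectors have bounded size, so a matrix with infinitely many solutions \<open>q\<close> has
solutions in arbitrarily late shells.\<close>

lemma W0_subset_shells: "W0 \<tau> \<subseteq> (\<Union>k. \<Union>q\<in>shell (k + H). slab \<tau> q)"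
proof
  fix X :: "real ^ 'n ^ 'm" assume X: "X \<in> W0 \<tau>"
  define A where "A = {q :: int ^ 'm. q \<noteq> 0 \<and> infnorm (real_vec q v* X) < infnorm (real_vec q) powr (- \<tau>)}"
  have "infinite A" and cube: "X \<in> centered_cube" using X by (simp_all add: W0_def A_def)
  then have "\<not> A \<subseteq> {q. infnorm (real_vec q) \<le> real (2 ^ H)}"
    using finite_infnorm_le finite_subset by blast
  then obtain q where "q \<in> A" "\<not> infnorm (real_vec q) \<le> real (2 ^ H)" by blast
  then have q: "q \<in> A" "infnorm (real_vec q) > 2 ^ H" by simp_all
  define r where "r = infnorm (real_vec q)"
  define k where "k = nat \<lfloor>log 2 r\<rfloor>"
  have r: "r > 2 ^ H" "r > 0" using q(2) less_trans[of 0 "2 ^ H" r] by (simp_all add: r_def)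
  have "real H < log 2 r" using r by (simp add: less_log_iff powr_realpow)
  then have "H \<le> k" "real k \<le> log 2 r" "log 2 r < real (Suc k)" unfolding k_def by linarith+
  then have "2 powr real k \<le> r" "r < 2 powr real (Suc k)" using r by (simp_all only: le_log_iff log_less_iff one_less_numeral_iff semiring_norm)
  then have "q \<in> shell k" by (simp only: shell_def mem_Collect_eq r_def powr_realpow zero_less_numeral)
  then have "q \<in> shell ((k - H) + H)" using \<open>H \<le> k\<close> by simp
  moreover have "X \<in> slab \<tau> q" using q cube by (simp add: A_def slab_def)
  ultimately show "X \<in> (\<Union>k. \<Union>q\<in>shell (k + H). slab \<tau> q)" by blast
qed

text \<open>With \<open>w = (\<tau> + 1) (s - (m - 1) n) > m\<close>, the pieces of all slabs of the shell \<open>k\<close> contribute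
\<open>O(2^(k m) 2^(-k w))\<close>, the general term of a convergent geometric series; its tails are arbitrarily small.\<close>

lemma null_measure_W0:
  assumes \<tau>: "\<tau> > 0"
    and s: "s > (real CARD('m::finite) - 1) * real CARD('n::finite) + real CARD('m) / (\<tau> + 1)"
  shows "hausdorff_measure s (W0 \<tau> :: (real ^ 'n ^ 'm) set) = 0"
proof (rule hausdorff_measure_eq_0I)
  fix \<delta> \<eta> :: real assume \<delta>: "\<delta> > 0" and \<eta>: "\<eta> > 0"
  define m n where "m = CARD('m)" and "n = CARD('n)"
  define B where "B = (m - 1) * n"
  have B: "real B = (real m - 1) * real n" by (simp add: B_def m_def of_nat_diff Suc_le_eq)
  have m0: "m > 0" "n > 0" by (simp_all add: m_def n_def)
  have sB: "s > real B" "(\<tau> + 1) * (s - real B) > real m"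
  proof -
    have *: "s - real B > real m / (\<tau> + 1)" using s unfolding B m_def n_def by simp
    then show "(\<tau> + 1) * (s - real B) > real m" using \<tau> by (simp add: field_simps)
    have "real m / (\<tau> + 1) > 0" using \<tau> m0 by simp
    with * show "s > real B" by linarith
  qed
  then have s0: "s > 0" using of_nat_0_le_iff[of B] by linarith
  define w where "w = (\<tau> + 1) * (s - real B)"
  define C where "C = real (m * n * (m + 2))"
  have C: "C > 0" unfolding C_def of_nat_0_less_iff using m0 by simp
  define \<theta> where "\<theta> q = infnorm (real_vec q) powr (- (\<tau> + 1))" for q :: "int ^ 'm"
  have "\<exists>I V. finite (I :: ('m \<times> 'n \<Rightarrow> int) set) \<and> real (card I) \<le> (3 / \<theta> q) ^ B \<and>
      (slab \<tau> q :: (real ^ 'n ^ 'm) set) \<subseteq> (\<Union>y\<in>I. V y) \<and>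
      (\<forall>y. bounded (V y) \<and> diameter (V y) \<le> C * \<theta> q)" if "infnorm (real_vec q) \<ge> 1" for q :: "int ^ 'm"
  proof -
    have "\<tau> > -1" using \<tau> by simp
    from slab_partition[OF that this, where 'n = 'n]
    obtain I :: "('m \<times> 'n \<Rightarrow> int) set" and V :: "('m \<times> 'n \<Rightarrow> int) \<Rightarrow> (real ^ 'n ^ 'm) set" where
      "finite I" "real (card I) \<le> (3 / \<theta> q) ^ B" "slab \<tau> q \<subseteq> (\<Union>y\<in>I. V y)"
      "\<And>y. bounded (V y) \<and> diameter (V y) \<le> C * \<theta> q"
      unfolding \<theta>_def B_def C_def m_def n_def by metis
    then show ?thesis by (intro exI[of _ I] exI[of _ V]) simp
  qed
  then obtain I V where IV: "\<And>q :: int ^ 'm. infnorm (real_vec q) \<ge> 1 \<Longrightarrow> finite (I q :: ('m \<times> 'n \<Rightarrow> int) set)"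
    "\<And>q. infnorm (real_vec q) \<ge> 1 \<Longrightarrow> real (card (I q)) \<le> (3 / \<theta> q) ^ B"
    "\<And>q. infnorm (real_vec q) \<ge> 1 \<Longrightarrow> (slab \<tau> q :: (real ^ 'n ^ 'm) set) \<subseteq> (\<Union>y\<in>I q. V q y)"
    "\<And>q y. infnorm (real_vec q) \<ge> 1 \<Longrightarrow> bounded (V q y) \<and> diameter (V q y) \<le> C * \<theta> q"
    by metis
  define x where "x = 2 powr (real m - w)"
  have x: "0 < x" "norm x < 1"
    using powr_less_mono[of "real m - w" 0 2] sB by (simp_all add: x_def w_def)
  define y where "y = 2 powr (- (\<tau> + 1))"
  have y: "0 < y" "norm y < 1"
    using powr_less_mono[of "- (\<tau> + 1)" 0 2] \<tau> by (simp_all add: y_def)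
  define G where "G = 8 ^ m * 3 ^ B * C powr s"
  have G: "G > 0" using C by (simp add: G_def)
  have "1 - x \<noteq> 0" using x by simp
  then have "(\<lambda>H. G * x ^ H / (1 - x)) \<longlonglongrightarrow> G * 0 / (1 - x)"
    by (intro tendsto_divide tendsto_mult tendsto_const LIMSEQ_power_zero x)
  moreover have "(\<lambda>H. C * y ^ H) \<longlonglongrightarrow> C * 0"
    by (intro tendsto_mult tendsto_const LIMSEQ_power_zero y)
  ultimately have "eventually (\<lambda>H. G * x ^ H / (1 - x) < \<eta>) sequentially" "eventually (\<lambda>H. C * y ^ H < \<delta>) sequentially"
    using \<eta> \<delta> by (auto elim!: order_tendstoD(2))
  then have "eventually (\<lambda>H. G * x ^ H / (1 - x) < \<eta> \<and> C * y ^ H < \<delta>) sequentially" by eventually_elim auto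
  then obtain H where H: "G * x ^ H / (1 - x) < \<eta>" "C * y ^ H < \<delta>"
    using eventually_happens trivial_limit_sequentially by blast
  have sh: "infnorm (real_vec q) \<ge> 1" "\<theta> q \<le> y ^ k" "0 < \<theta> q" "\<theta> q powr (s - real B) \<le> 2 powr (- real k * w)" if "q \<in> shell k" for q k
  proof -
    have r: "2 ^ k \<le> infnorm (real_vec q)" using that by (simp add: shell_def)
    have "(1::real) \<le> 2 ^ k" by simp
    then show r1: "infnorm (real_vec q) \<ge> 1" using r by linarith
    then show "0 < \<theta> q" by (simp add: \<theta>_def)
    have "\<theta> q \<le> (2 ^ k) powr (- (\<tau> + 1))" unfolding \<theta>_def using r \<tau> by (intro powr_mono2') auto
    also have e: "(2 ^ k) powr (- (\<tau> + 1)) = 2 powr (- real k * (\<tau> + 1))"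
      by (simp add: powr_powr algebra_simps flip: powr_realpow)
    finally have le: "\<theta> q \<le> 2 powr (- real k * (\<tau> + 1))" .
    also have "\<dots> = y ^ k" using y by (simp add: y_def powr_powr algebra_simps flip: powr_realpow)
    finally show "\<theta> q \<le> y ^ k" .
    have "\<theta> q powr (s - real B) \<le> (2 powr (- real k * (\<tau> + 1))) powr (s - real B)"
      using le sB \<open>0 < \<theta> q\<close> by (intro powr_mono2) auto
    also have "\<dots> = 2 powr (- real k * w)" by (simp add: powr_powr w_def mult.assoc)
    finally show "\<theta> q powr (s - real B) \<le> 2 powr (- real k * w)" .
  qed
  define J where "J k = (SIGMA q:shell (k + H). I q)" for k
  have "\<exists>U. is_delta_cover \<delta> (W0 \<tau> :: (real ^ 'n ^ 'm) set) U \<and>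
     (\<Sum>i. diam_power s (U i)) \<le> (\<Sum>k. ennreal (G * x ^ (k + H)))"
  proof (rule null_measure_finite_families[where I = J and V = "\<lambda>(q, y). V q y"])
    show "finite (J k)" for k unfolding J_def using sh(1) IV(1) by (intro finite_SigmaI) auto
    show "W0 \<tau> \<subseteq> (\<Union>k. \<Union>i\<in>J k. case i of (q, y) \<Rightarrow> V q y)"
    proof
      fix X :: "real ^ 'n ^ 'm" assume "X \<in> W0 \<tau>"
      then obtain k q where q: "q \<in> shell (k + H)" "X \<in> slab \<tau> q" using W0_subset_shells[of \<tau> H] by blast
      then obtain y where "y \<in> I q" "X \<in> V q y" using IV(3) sh(1)[OF q(1)] by blast
      then show "X \<in> (\<Union>k. \<Union>i\<in>J k. case i of (q, y) \<Rightarrow> V q y)"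
        using q by (intro UN_I[of k] UN_I[of "(q, y)"]) (auto simp: J_def)
    qed
    show "bounded (case i of (q, y) \<Rightarrow> V q y) \<and> diameter (case i of (q, y) \<Rightarrow> V q y) \<le> \<delta>" if "i \<in> J k" for i k
    proof -
      obtain q z where i: "i = (q, z)" "q \<in> shell (k + H)" using \<open>i \<in> J k\<close> by (auto simp: J_def)
      have "C * \<theta> q \<le> C * y ^ H"
      proof (intro mult_left_mono)
        have "y ^ (k + H) \<le> y ^ H" using y by (intro power_decreasing) auto
        then show "\<theta> q \<le> y ^ H" using sh(2)[OF i(2)] by linarith
      qed (use C in simp)
      then show ?thesis using IV(4)[OF sh(1)[OF i(2)], of z] H(2) by (auto simp: i)
    qed
    show "(\<Sum>i\<in>J k. diam_power s (case i of (q, y) \<Rightarrow> V q y)) \<le> ennreal (G * x ^ (k + H))" for k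
    proof -
      define K where "K = k + H"
      have each: "diam_power s (V q z) \<le> ennreal ((C * \<theta> q) powr s)" if "q \<in> shell K" for q z
        using IV(4)[OF sh(1)[OF that], of z] s0
        by (auto simp: diam_power_def diameter_ge_0 intro!: ennreal_leI powr_mono2)
      have row: "(\<Sum>z\<in>I q. diam_power s (V q z)) \<le> ennreal (3 ^ B * C powr s * 2 powr (- real K * w))" if q: "q \<in> shell K" for q
      proof -
        have "(\<Sum>z\<in>I q. diam_power s (V q z)) \<le> (\<Sum>z\<in>I q. ennreal ((C * \<theta> q) powr s))"
          by (intro sum_mono each q)
        also have "\<dots> = ennreal (real (card (I q)) * (C * \<theta> q) powr s)"
          by (simp add: ennreal_of_nat_eq_real_of_nat ennreal_mult)
        also have "\<dots> \<le> ennreal (3 ^ B * C powr s * 2 powr (- real K * w))"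
        proof (intro ennreal_leI)
          have "real (card (I q)) * (C * \<theta> q) powr s \<le> (3 / \<theta> q) ^ B * (C * \<theta> q) powr s"
            using IV(2)[OF sh(1)[OF q]] by (intro mult_right_mono) auto
          also have "\<dots> = 3 ^ B * C powr s * (\<theta> q powr s / \<theta> q powr real B)"
            using sh(3)[OF q] C by (simp add: power_divide powr_mult powr_realpow)
          also have "\<theta> q powr s / \<theta> q powr real B = \<theta> q powr (s - real B)" by (simp add: powr_diff)
          also have "3 ^ B * C powr s * \<theta> q powr (s - real B) \<le> 3 ^ B * C powr s * 2 powr (- real K * w)"
            using sh(4)[OF q] by (intro mult_left_mono) auto
          finally show "real (card (I q)) * (C * \<theta> q) powr s \<le> 3 ^ B * C powr s * 2 powr (- real K * w)" .
        qed
        finally show ?thesis .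
      qed
      have "(\<Sum>i\<in>J k. diam_power s (case i of (q, y) \<Rightarrow> V q y)) = (\<Sum>q\<in>shell K. \<Sum>z\<in>I q. diam_power s (V q z))"
        unfolding J_def K_def using sh(1) IV(1) by (subst sum.Sigma) (auto simp: split_def)
      also have "\<dots> \<le> (\<Sum>q\<in>(shell K :: (int ^ 'm) set). ennreal (3 ^ B * C powr s * 2 powr (- real K * w)))"
        by (intro sum_mono row)
      also have "\<dots> = ennreal (real (card (shell K :: (int ^ 'm) set)) * (3 ^ B * C powr s * 2 powr (- real K * w)))"
        by (simp add: ennreal_of_nat_eq_real_of_nat ennreal_mult)
      also have "\<dots> \<le> ennreal (G * x ^ K)"
      proof (intro ennreal_leI)
        have "real (card (shell K :: (int ^ 'm) set)) * (3 ^ B * C powr s * 2 powr (- real K * w))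
            \<le> (8 ^ m * (2 ^ K) ^ m) * (3 ^ B * C powr s * 2 powr (- real K * w))"
          unfolding m_def by (intro mult_right_mono card_shell_le) auto
        also have "\<dots> = G * ((2 ^ K) ^ m * 2 powr (- real K * w))" by (simp add: G_def)
        also have "(2 ^ K) ^ m * 2 powr (- real K * w) = x ^ K"
        proof -
          have "(2 ^ K) ^ m = 2 powr (real K * real m)" by (simp add: powr_realpow flip: power_mult of_nat_mult)
          moreover have "x ^ K = 2 powr (real K * (real m - w))"
            using x by (simp add: x_def powr_powr mult.commute flip: powr_realpow)
          ultimately show ?thesis by (simp add: algebra_simps flip: powr_add)
        qed
        finally show "real (card (shell K :: (int ^ 'm) set)) * (3 ^ B * C powr s * 2 powr (- real K * w)) \<le> G * x ^ K" .
      qed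
      finally show ?thesis by (simp add: K_def)
    qed
  qed (use \<delta> in simp)
  moreover have "(\<Sum>k. ennreal (G * x ^ (k + H))) \<le> ennreal \<eta>"
  proof -
    have sm: "(\<lambda>k. (G * x ^ H) * x ^ k) sums ((G * x ^ H) * (1 / (1 - x)))"
      using x by (intro sums_mult geometric_sums) auto
    have e: "G * x ^ (k + H) = (G * x ^ H) * x ^ k" for k by (simp add: power_add)
    have "(\<Sum>k. ennreal (G * x ^ (k + H))) = ennreal (\<Sum>k. G * x ^ (k + H))"
      using sm G x unfolding e by (intro suminf_ennreal2) (auto simp: sums_iff)
    also have "(\<Sum>k. G * x ^ (k + H)) = G * x ^ H / (1 - x)" using sm unfolding e by (simp add: sums_iff)
    finally show ?thesis using H(1) by (simp add: ennreal_leI)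
  qed
  ultimately show "\<exists>U. is_delta_cover \<delta> (W0 \<tau> :: (real ^ 'n ^ 'm) set) U \<and> (\<Sum>i. diam_power s (U i)) \<le> ennreal \<eta>"
    using order_trans by blast
qed

section \<open>Energies of masses on the dyadic grid\<close>

definition grid :: "nat \<Rightarrow> ('i \<Rightarrow> nat) set" where
  "grid N = {y. \<forall>i. y i < N}"

text \<open>The dyadic cubes of level \<open>l\<close> are indexed by their lower corners in units of \<open>2^-l\<close>; then
\<open>coarse (2 ^ k)\<close> maps a cube to the cube that contains it \<open>k\<close> levels above.\<close>

definition coarse :: "nat \<Rightarrow> ('i \<Rightarrow> nat) \<Rightarrow> 'i \<Rightarrow> nat" where
  "coarse k y = (\<lambda>i. y i div k)"

definition dyadic_cube :: "nat \<Rightarrow> ('i \<Rightarrow> nat) \<Rightarrow> (real ^ 'i) set" where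
  "dyadic_cube l y = {z. \<forall>i. real (y i) / 2 ^ l \<le> z $ i \<and> z $ i \<le> (real (y i) + 1) / 2 ^ l}"

text \<open>The sum over all values \<open>Y\<close> of the squared mass of the fibre of \<open>f\<close> over \<open>Y\<close> (see \<open>energy_fibres\<close>). The form
with pairs is the one that behaves well under products and under averaging over families of masses.\<close>

definition energy :: "'a set \<Rightarrow> ('a \<Rightarrow> 'b) \<Rightarrow> ('a \<Rightarrow> real) \<Rightarrow> real" where
  "energy A f w = (\<Sum>x\<in>A. \<Sum>x'\<in>A. if f x = f x' then w x * w x' else 0)"

lemma grid_PiE: "grid N = (\<Pi>\<^sub>E i\<in>UNIV. {..<N})"
  by (auto simp: grid_def PiE_def)

lemma finite_grid [simp]: "finite (grid N :: ('i::finite \<Rightarrow> nat) set)"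
  by (simp add: grid_PiE finite_PiE)

lemma card_grid: "card (grid N :: ('i::finite \<Rightarrow> nat) set) = N ^ CARD('i)"
  by (simp add: grid_PiE card_PiE)

lemma energy_fibres:
  assumes "finite A" "finite B" "f ` A \<subseteq> B"
  shows "energy A f w = (\<Sum>Y\<in>B. (\<Sum>x\<in>{x\<in>A. f x = Y}. w x)\<^sup>2)"
proof -
  have "(\<Sum>Y\<in>B. (\<Sum>x\<in>{x\<in>A. f x = Y}. w x)\<^sup>2)
      = (\<Sum>Y\<in>B. \<Sum>x\<in>A. \<Sum>x'\<in>A. if f x = Y \<and> f x' = Y then w x * w x' else 0)"
  proof (rule sum.cong[OF refl])
    fix Y
    have "(\<Sum>x\<in>{x\<in>A. f x = Y}. w x) = (\<Sum>x\<in>A. if f x = Y then w x else 0)"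
      by (rule sum.inter_filter[OF assms(1)])
    then show "(\<Sum>x\<in>{x\<in>A. f x = Y}. w x)\<^sup>2
        = (\<Sum>x\<in>A. \<Sum>x'\<in>A. if f x = Y \<and> f x' = Y then w x * w x' else 0)"
      by (simp add: power2_eq_square sum_product) (intro sum.cong refl, auto)
  qed
  also have "\<dots> = (\<Sum>x\<in>A. \<Sum>x'\<in>A. \<Sum>Y\<in>B. if f x = Y \<and> f x' = Y then w x * w x' else 0)"
    by (subst sum.swap, rule sum.cong[OF refl], rule sum.swap)
  also have "\<dots> = energy A f w"
    unfolding energy_def
  proof (intro sum.cong refl)
    fix x x' assume "x \<in> A" "x' \<in> A"
    then have "f x \<in> B" using assms(3) by auto
    have "(\<Sum>Y\<in>B. if f x = Y \<and> f x' = Y then w x * w x' else 0)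
        = (\<Sum>Y\<in>B. if Y = f x then (if f x = f x' then w x * w x' else 0) else 0)"
      by (intro sum.cong) auto
    also have "\<dots> = (if f x = f x' then w x * w x' else 0)"
      using \<open>f x \<in> B\<close> assms(2) by simp
    finally show "(\<Sum>Y\<in>B. if f x = Y \<and> f x' = Y then w x * w x' else 0)
        = (if f x = f x' then w x * w x' else 0)" .
  qed
  finally show ?thesis by simp
qed

lemma compact_dyadic_cube: "compact (dyadic_cube l y :: (real ^ 'i::finite) set)"
proof -
  have "dyadic_cube l y = cbox (\<chi> i. real (y i) / 2 ^ l) (\<chi> i. (real (y i) + 1) / 2 ^ l)"
    by (auto simp: dyadic_cube_def mem_box_cart)
  then show ?thesis by simp
qed

lemma coarse_in_grid:
  assumes "y \<in> grid (2 ^ M)" "l \<le> M"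
  shows "coarse (2 ^ (M - l)) y \<in> grid (2 ^ l)"
proof -
  have "(2::nat) ^ M = 2 ^ l * 2 ^ (M - l)" using assms(2) by (simp flip: power_add)
  then show ?thesis
    using assms(1) by (auto simp: grid_def coarse_def less_mult_imp_div_less)
qed

lemma dyadic_cube_coarse:
  assumes "l \<le> M"
  shows "dyadic_cube M y \<subseteq> dyadic_cube l (coarse (2 ^ (M - l)) y)"
proof
  fix z assume z: "z \<in> dyadic_cube M y"
  define k :: nat where "k = 2 ^ (M - l)"
  have k: "k > 0" "(2::real) ^ M = 2 ^ l * real k"
    using assms by (simp_all add: k_def flip: power_add)
  show "z \<in> dyadic_cube l (coarse (2 ^ (M - l)) y)"
    unfolding dyadic_cube_def mem_Collect_eq k_def[symmetric] coarse_def
  proof (intro allI conjI)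
    fix i
    have "real (y i div k) * real k \<le> real (y i)"
      by (metis div_times_less_eq_dividend of_nat_le_iff of_nat_mult)
    then have "real (y i div k) / 2 ^ l \<le> real (y i) / 2 ^ M"
      using k by (simp add: field_simps)
    then show "real (y i div k) / 2 ^ l \<le> z $ i"
      using z by (auto simp: dyadic_cube_def intro: order_trans)
    have "y i < (y i div k + 1) * k" using k(1) by (metis dividend_less_div_times add.commute add_mult_distrib mult_1)
    then have "real (y i) + 1 \<le> (real (y i div k) + 1) * real k"
      by (metis Suc_leI of_nat_1 of_nat_Suc of_nat_add of_nat_le_iff of_nat_mult add.commute)
    then have "(real (y i) + 1) / 2 ^ M \<le> ((real (y i div k) + 1) * real k) / 2 ^ M"
      by (intro divide_right_mono) auto
    also have "\<dots> = (real (y i div k) + 1) / 2 ^ l"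
      using k by simp
    finally have "(real (y i) + 1) / 2 ^ M \<le> (real (y i div k) + 1) / 2 ^ l" .
    then show "z $ i \<le> (real (y i div k) + 1) / 2 ^ l"
      using z by (auto simp: dyadic_cube_def intro: order_trans)
  qed
qed

lemma card_nat_window:
  "card {k::nat. x - 2 \<le> real k \<and> real k \<le> x + 1} \<le> 4"
proof -
  let ?A = "{k::nat. x - 2 \<le> real k \<and> real k \<le> x + 1}"
  have "int ` ?A \<subseteq> {\<lceil>x - 2\<rceil>..\<lceil>x - 2\<rceil> + 3}"
  proof
    fix z assume "z \<in> int ` ?A"
    then obtain k where k: "z = int k" "x - 2 \<le> real k" "real k \<le> x + 1" by auto
    then have "\<lceil>x - 2\<rceil> \<le> z" by linarith
    moreover have "real_of_int z \<le> real_of_int \<lceil>x - 2\<rceil> + 3" using k by linarith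
    then have "z \<le> \<lceil>x - 2\<rceil> + 3" by linarith
    ultimately show "z \<in> {\<lceil>x - 2\<rceil>..\<lceil>x - 2\<rceil> + 3}" by simp
  qed
  then have "card (int ` ?A) \<le> card {\<lceil>x - 2\<rceil>..\<lceil>x - 2\<rceil> + 3}"
    by (intro card_mono) auto
  then show ?thesis by (simp add: card_image)
qed

text \<open>In every coordinate a ball of radius at most the side length of the cubes reaches at most four of them
(cubes are closed, so that cubes that only touch the ball are counted as well).\<close>

lemma card_cubes_meeting_ball:
  fixes u :: "real ^ 'i::finite"
  assumes "r \<le> 1 / 2 ^ l"
  shows "card {Y \<in> grid (2 ^ l). dyadic_cube l Y \<inter> ball u r \<noteq> {}} \<le> 4 ^ CARD('i)"
proof -
  define W where "W i = {k::nat. 2 ^ l * u $ i - 2 \<le> real k \<and> real k \<le> 2 ^ l * u $ i + 1}" for i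
  have fin: "finite (W i)" for i
  proof (rule finite_subset)
    show "W i \<subseteq> {..nat \<lceil>2 ^ l * u $ i + 1\<rceil>}" by (auto simp: W_def) linarith
  qed simp
  have "{Y \<in> grid (2 ^ l). dyadic_cube l Y \<inter> ball u r \<noteq> {}} \<subseteq> (\<Pi>\<^sub>E i\<in>UNIV. W i)"
  proof
    fix Y assume "Y \<in> {Y \<in> grid (2 ^ l). dyadic_cube l Y \<inter> ball u r \<noteq> {}}"
    then obtain z where z: "z \<in> dyadic_cube l Y" "dist u z < r" by auto
    have "Y i \<in> W i" for i
    proof -
      have "\<bar>u $ i - z $ i\<bar> < r"
        using z(2) component_le_norm_cart[of "u - z" i] by (simp add: dist_norm)
      then have "2 ^ l * \<bar>u $ i - z $ i\<bar> \<le> 2 ^ l * (1 / 2 ^ l)"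
        using assms by (intro mult_left_mono) auto
      then have "\<bar>2 ^ l * u $ i - 2 ^ l * z $ i\<bar> \<le> 1"
        by (simp add: abs_mult flip: right_diff_distrib)
      moreover have "real (Y i) \<le> 2 ^ l * z $ i" "2 ^ l * z $ i \<le> real (Y i) + 1"
        using z(1) by (auto simp: dyadic_cube_def field_simps)
      ultimately show ?thesis by (auto simp: W_def)
    qed
    then show "Y \<in> (\<Pi>\<^sub>E i\<in>UNIV. W i)" by auto
  qed
  then have "card {Y \<in> grid (2 ^ l). dyadic_cube l Y \<inter> ball u r \<noteq> {}} \<le> card (\<Pi>\<^sub>E i\<in>UNIV. W i)"
    using fin by (intro card_mono finite_PiE) auto
  also have "\<dots> = (\<Prod>i\<in>UNIV. card (W i))" by (simp add: card_PiE)
  also have "\<dots> \<le> (\<Prod>i\<in>(UNIV::'i set). 4)"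
    unfolding W_def by (intro prod_mono) (auto simp: card_nat_window)
  finally show ?thesis by simp
qed

text \<open>The complements of the sets \<open>S j\<close> together with the given open sets cover \<open>S 0\<close>.\<close>

lemma nested_compact_subcover:
  fixes S :: "nat \<Rightarrow> 'a::t2_space set"
  assumes "\<And>j. compact (S j)" "\<And>j. S (Suc j) \<subseteq> S j" "\<And>i. open (G' i)"
    "(\<Inter>j. S j) \<subseteq> (\<Union>i. G' i)"
  obtains F j where "finite F" "\<And>k. k \<ge> j \<Longrightarrow> S k \<subseteq> (\<Union>i\<in>F. G' i)"
proof -
  have anti: "S k \<subseteq> S j" if "j \<le> k" for j k
    using lift_Suc_antimono_le[of S] assms(2) that by blast
  define R where "R = (\<lambda>j. - S j)"
  define G where "G = range G' \<union> range R"
  have "S 0 \<subseteq> \<Union>G" using assms(4) by (auto simp: G_def R_def)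
  moreover have "\<And>g. g \<in> G \<Longrightarrow> open g"
    using assms(1,3) by (auto simp: G_def R_def intro: compact_imp_closed)
  ultimately obtain H where H: "H \<subseteq> G" "finite H" "S 0 \<subseteq> \<Union>H"
    using compactE[OF assms(1)[of 0], of G] by metis
  have "finite (H \<inter> range G')" "H \<inter> range G' \<subseteq> range G'" using H by auto
  from finite_subset_image[OF this] obtain F where
    F: "finite F" "H \<inter> range G' = G' ` F" by blast
  have "finite (H \<inter> range R)" "H \<inter> range R \<subseteq> range R"
    using H by auto
  from finite_subset_image[OF this] obtain J where 
    J: "finite J" "H \<inter> range R = R ` J" by blast
  obtain j where j: "\<And>i. i \<in> J \<Longrightarrow> i \<le> j"
    using J(1) unfolding finite_nat_set_iff_bounded_le by auto
  have "S k \<subseteq> (\<Union>i\<in>F. G' i)" if "k \<ge> j" for k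
  proof
    fix x assume x: "x \<in> S k"
    then have "x \<in> S 0" using anti[of 0 k] by auto
    then obtain h where h: "h \<in> H" "x \<in> h" using H(3) by auto
    then have "h \<in> H \<inter> range G' \<or> h \<in> H \<inter> range R" using H(1) by (auto simp: G_def)
    then consider (O) "h \<in> G' ` F" | (S) "h \<in> R ` J" unfolding F(2) J(2) by blast
    then show "x \<in> (\<Union>i\<in>F. G' i)"
    proof cases
      case S
      then obtain i where "i \<in> J" "x \<notin> S i" using h by (auto simp: R_def)
      then show ?thesis using anti[of i k] j[of i] that x by auto
    qed (use h in auto)
  qed
  with F(1) that show thesis by blast
qed

lemma exists_dyadic_scale:
  fixes r :: real
  assumes "0 < r" "r \<le> 1"
  obtains l :: nat where "r \<le> 1 / 2 ^ l" "1 / 2 ^ l \<le> 2 * r"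
proof -
  define l where "l = nat \<lfloor>log 2 (1 / r)\<rfloor>"
  have pos: "log 2 (1 / r) \<ge> 0" using assms by simp
  have "real l \<le> log 2 (1 / r)" using pos by (simp add: l_def)
  then have "2 powr real l \<le> 1 / r" using assms by (simp add: le_log_iff)
  moreover have "log 2 (1 / r) < real l + 1" using pos unfolding l_def by linarith
  then have "1 / r < 2 powr (real l + 1)" using assms by (simp add: log_less_iff)
  ultimately have "2 ^ l \<le> 1 / r" "1 / r < 2 * 2 ^ l"
    by (simp_all add: powr_realpow powr_add)
  then have "r \<le> 1 / 2 ^ l" "1 / 2 ^ l \<le> 2 * r" using assms by (auto simp: field_simps)
  then show thesis by (rule that)
qed

lemma exists_slightly_larger_radius:
  fixes d s \<epsilon> :: real
  assumes "s > 0" "\<epsilon> > 0" "0 \<le> d" "d < 1"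
  obtains r where "d < r" "r \<le> 1" "r powr s \<le> d powr s + \<epsilon>"
proof -
  have "((\<lambda>r. r powr s) \<longlongrightarrow> d powr s) (at_right d)"
  proof (rule tendsto_powr2)
    show "eventually (\<lambda>r. 0 \<le> r) (at_right d)"
      using eventually_at_right_less[of d] by eventually_elim (use assms in simp)
  qed (use assms in \<open>auto intro: tendsto_ident_at\<close>)
  then have "eventually (\<lambda>r. r powr s < d powr s + \<epsilon>) (at_right d)"
    using assms(2) by (intro order_tendstoD(2)) auto
  moreover have "eventually (\<lambda>r. r < 1) (at_right d)"
    using assms(4) by (intro eventually_at_rightI[of d 1]) auto
  moreover have "eventually (\<lambda>r. d < r) (at_right d)" by (rule eventually_at_right_less)
  ultimately have "eventually (\<lambda>r. d < r \<and> r < 1 \<and> r powr s < d powr s + \<epsilon>) (at_right d)"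
    by eventually_elim auto
  then obtain r where "d < r \<and> r < 1 \<and> r powr s < d powr s + \<epsilon>"
    using eventually_happens trivial_limit_at_right_real by blast
  with that[of r] show thesis by auto
qed


lemma sum_UN_le:
  fixes g :: "'a \<Rightarrow> real"
  assumes "finite I" "\<And>i. i \<in> I \<Longrightarrow> finite (A i)" "\<And>x. g x \<ge> 0"
  shows "(\<Sum>x\<in>(\<Union>i\<in>I. A i). g x) \<le> (\<Sum>i\<in>I. \<Sum>x\<in>A i. g x)"
  using assms(1,2)
proof (induction I rule: finite_induct)
  case (insert i I)
  have "(\<Sum>x\<in>A i \<union> (\<Union>i\<in>I. A i). g x) \<le> (\<Sum>x\<in>A i. g x) + (\<Sum>x\<in>(\<Union>i\<in>I. A i). g x)"
    using insert assms(3) by (subst sum.union_inter[symmetric]) (auto simp: sum_nonneg)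
  with insert show ?case by simp
qed simp

lemma sum_powr_difference_bounded:
  fixes s s' C :: real
  assumes "s < s'"
  obtains B where "B > 0" "\<And>n. (\<Sum>l<n. 2 powr (real l * s) * 2 powr (- real l * s')) \<le> B"
proof -
  define x where "x = 2 powr (s - s')"
  have "2 powr (s - s') < 2 powr (0::real)" using assms by (intro powr_less_mono) auto
  then have x: "0 < x" "x < 1" by (simp_all add: x_def)
  have e: "2 powr (real l * s) * 2 powr (- real l * s') = x ^ l" for l
  proof -
    have "x ^ l = x powr real l" using x by (simp add: powr_realpow)
    also have "\<dots> = 2 powr (real l * s + - real l * s')"
      by (simp add: x_def powr_powr algebra_simps)
    finally show ?thesis by (simp only: powr_add)
  qed
  have "(\<Sum>l<n. x ^ l) \<le> 1 / (1 - x)" for n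
  proof -
    have "(\<Sum>l<n. x ^ l) \<le> (\<Sum>l. x ^ l)"
      using x by (intro sum_le_suminf summable_geometric) auto
    then show ?thesis using x by (simp add: suminf_geometric)
  qed
  then show thesis using that[of "1 / (1 - x)"] x unfolding e by simp
qed

text \<open>If the measure were zero, there would be a cover by balls with a very small sum of the \<open>s\<close>-th powers of the
radii, and a finite part of it would cover some \<open>S j\<close> whose level exceeds those of all these balls. The
dyadic cubes of comparable size that meet these balls would form a set \<open>T\<close> of cubes that carries the whole
mass 1. But for every \<open>\<theta> > 0\<close> a mass \<open>\<mu>\<close> of level \<open>k\<close> satisfies
\<open>2 \<mu> \<le> \<theta> 2^(k s) \<mu>^2 + 2^(-k s) / \<theta>\<close>. Summed over \<open>T\<close>, the first terms are bounded by means of the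
energies and the second ones by means of the sum over the cover.\<close>

lemma hausdorff_measure_pos_of_energy:
  fixes L :: "nat \<Rightarrow> nat" and \<nu> :: "nat \<Rightarrow> ('i::finite \<Rightarrow> nat) \<Rightarrow> real" and s s' C :: real
  defines "S \<equiv> \<lambda>j. \<Union>y\<in>{y\<in>grid (2 ^ L j). \<nu> j y \<noteq> 0}. dyadic_cube (L j) y"
  assumes s: "0 < s" "s < s'"
    and L: "\<And>j. L j < L (Suc j)"
    and nonneg: "\<And>j y. \<nu> j y \<ge> 0"
    and total: "\<And>j. (\<Sum>y\<in>grid (2 ^ L j). \<nu> j y) = 1"
    and energy: "\<And>j l. l \<le> L j \<Longrightarrow>
       energy (grid (2 ^ L j)) (coarse (2 ^ (L j - l))) (\<nu> j) \<le> C * 2 powr (- real l * s')"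
    and nested: "\<And>j. S (Suc j) \<subseteq> S j"
  shows "hausdorff_measure s (\<Inter>j. S j) \<noteq> 0"
proof
  assume null: "hausdorff_measure s (\<Inter>j. S j) = 0"
  obtain B where B: "B > 0"
    "\<And>n. (\<Sum>l<n. 2 powr (real l * s) * 2 powr (- real l * s')) \<le> B"
    using sum_powr_difference_bounded[OF s(2)] by blast
  have "C \<ge> 0"
  proof -
    have "0 \<le> energy (grid (2 ^ L 0)) (coarse (2 ^ (L 0 - 0))) (\<nu> 0)"
      using nonneg by (auto simp: energy_def intro!: sum_nonneg)
    also have "\<dots> \<le> C" using energy[of 0 0] by simp
    finally show ?thesis .
  qed
  (* \<theta> makes the energy part less than 1/2, and \<eta> makes the covering part at most 1/4. *)
  define \<theta> where "\<theta> = 1 / (C * B + 1)"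
  have "C * B \<ge> 0" using B(1) \<open>C \<ge> 0\<close> by simp
  then have \<theta>: "\<theta> > 0" "\<theta> * (C * B) < 1" by (simp_all add: \<theta>_def)
  define N where "N = (4::real) ^ CARD('i)"
  define \<eta> where "\<eta> = \<theta> / (4 * N * 2 powr s)"
  have N: "N > 0" by (simp add: N_def)
  have \<eta>: "\<eta> > 0" using \<theta> N by (simp add: \<eta>_def)
  obtain U where U: "is_delta_cover (1/2) (\<Inter>j. S j) U" "(\<Sum>i. diam_power s (U i)) < ennreal \<eta>"
    using null_measure_cover[OF null, of "1/2" "ennreal \<eta>"] \<eta> by auto
  have dU: "bounded (U i)" "diameter (U i) < 1" "0 \<le> diameter (U i)" for i
    using U(1) by (auto simp: is_delta_cover_def diameter_ge_0 intro: le_less_trans[of _ "1/2"])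
  (* A set of diameter 0 contributes nothing to the sum, but still needs a ball of positive radius. *)
  have "\<exists>r l. diameter (U i) < r \<and> r powr s \<le> diameter (U i) powr s + \<eta> * (1/2) ^ Suc i
      \<and> r \<le> 1 / 2 ^ l \<and> 1 / 2 ^ l \<le> 2 * r" for i
  proof -
    have "\<eta> * (1/2) ^ Suc i > 0" using \<eta> by simp
    from exists_slightly_larger_radius[OF s(1) this dU(3) dU(2)]
    obtain r where r: "diameter (U i) < r" "r \<le> 1"
      "r powr s \<le> diameter (U i) powr s + \<eta> * (1/2) ^ Suc i" by metis
    moreover obtain l where "r \<le> 1 / 2 ^ l" "1 / 2 ^ l \<le> 2 * r"
      using exists_dyadic_scale[of r] r dU(3)[of i] by force
    ultimately show ?thesis by blast
  qed
  then obtain r l where r: "\<And>i. diameter (U i) < r i"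
      "\<And>i. r i powr s \<le> diameter (U i) powr s + \<eta> * (1/2) ^ Suc i"
    and l: "\<And>i. r i \<le> 1 / 2 ^ l i" "\<And>i. 1 / 2 ^ l i \<le> 2 * r i"
    by metis
  define u where "u i = (SOME x. x \<in> U i)" for i
  define D where "D i = (if U i = {} then {} else ball (u i) (r i))" for i
  have UD: "U i \<subseteq> D i" for i
  proof
    fix x assume x: "x \<in> U i"
    then have "u i \<in> U i" by (auto simp: u_def intro: someI)
    then have "dist (u i) x \<le> diameter (U i)" using x dU by (intro diameter_bounded_bound) auto
    with r(1)[of i] x show "x \<in> D i" by (auto simp: D_def)
  qed
  have "compact (S j)" for j
    unfolding S_def by (intro compact_UN) (auto intro: compact_dyadic_cube finite_subset[OF _ finite_grid])
  moreover have "open (D i)" for i by (simp add: D_def)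
  moreover have "(\<Inter>j. S j) \<subseteq> (\<Union>i. D i)"
    using U(1) UD unfolding is_delta_cover_def by blast
  ultimately obtain F j0 where F: "finite F" "\<And>k. k \<ge> j0 \<Longrightarrow> S k \<subseteq> (\<Union>i\<in>F. D i)"
    using nested_compact_subcover[of S D] nested by metis
  obtain k0 where k0: "\<And>i. i \<in> F \<Longrightarrow> l i \<le> k0"
    using F(1) finite_nat_set_iff_bounded_le[of "l ` F"] by blast
  define j where "j = max j0 k0"
  have "j \<le> L j" using L strict_mono_imp_increasing[of L j] by (simp add: strict_mono_Suc_iff)
  then have lL: "l i \<le> L j" if "i \<in> F" for i using k0[OF that] by (simp add: j_def)
  define M where "M = L j"
  define w where "w = \<nu> j"
  define mass where "mass k Y = (\<Sum>y\<in>{y\<in>grid (2 ^ M). coarse (2 ^ (M - k)) y = Y}. w y)" for k Y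
  have mass0: "mass k Y \<ge> 0" for k Y by (simp add: mass_def w_def nonneg sum_nonneg)
  define H where "H i = {Y \<in> grid (2 ^ l i). dyadic_cube (l i) Y \<inter> D i \<noteq> {}}" for i
  have cardH: "real (card (H i)) * 2 powr (- real (l i) * s)
      \<le> N * 2 powr s * (if U i = {} then 0 else diameter (U i) powr s + \<eta> * (1/2) ^ Suc i)" for i
  proof (cases "U i = {}")
    case False
    have "card (H i) \<le> 4 ^ CARD('i)"
      unfolding H_def using card_cubes_meeting_ball[OF l(1)] False by (simp add: D_def)
    then have "real (card (H i)) \<le> N" unfolding N_def by (metis of_nat_le_iff of_nat_numeral of_nat_power)
    moreover have "2 powr (- real (l i) * s) = (1 / 2 ^ l i) powr s"
    proof -
      have "1 / 2 ^ l i = 2 powr (- real (l i))" by (simp add: powr_minus_divide powr_realpow)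
      then show ?thesis by (simp only: powr_powr)
    qed
    moreover have "(1 / 2 ^ l i) powr s \<le> (2 * r i) powr s"
      using l(2) s by (intro powr_mono2) auto
    moreover have "(2 * r i) powr s = 2 powr s * r i powr s"
      by (rule powr_mult)
    moreover have "2 powr s * r i powr s \<le> 2 powr s * (diameter (U i) powr s + \<eta> * (1/2) ^ Suc i)"
      using r(2) by (intro mult_left_mono) auto
    ultimately have "real (card (H i)) * 2 powr (- real (l i) * s)
      \<le> N * (2 powr s * (diameter (U i) powr s + \<eta> * (1/2) ^ Suc i))"
      using N by (intro mult_mono) (linarith | simp)+
    then show ?thesis using False by (simp add: mult.assoc)
  qed (simp add: H_def D_def)
  define T where "T = (\<Union>i\<in>F. {l i} \<times> H i)"
  have finH: "finite (H i)" for i unfolding H_def by (rule finite_subset[OF _ finite_grid]) auto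
  then have finT: "finite T" using F(1) by (auto simp: T_def)
  have TS: "T \<subseteq> (SIGMA k:{..<Suc M}. grid (2 ^ k))"
    using lL by (auto simp: T_def H_def M_def less_Suc_eq_le)
  have "1 = (\<Sum>y\<in>grid (2 ^ M). w y)" using total[of j] by (simp add: M_def w_def)
  also have "\<dots> \<le> (\<Sum>y\<in>grid (2 ^ M). \<Sum>t\<in>T. if coarse (2 ^ (M - fst t)) y = snd t then w y else 0)"
  proof (rule sum_mono)
    fix y :: "'i \<Rightarrow> nat" assume y: "y \<in> grid (2 ^ M)"
    let ?g = "\<lambda>t. if coarse (2 ^ (M - fst t)) y = snd t then w y else 0"
    have g0: "?g t \<ge> 0" for t by (simp add: w_def nonneg)
    show "w y \<le> (\<Sum>t\<in>T. ?g t)"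
    proof (cases "w y = 0")
      case False
      define z :: "real ^ 'i" where "z = (\<chi> i. real (y i) / 2 ^ M)"
      have zM: "z \<in> dyadic_cube M y" by (simp add: z_def dyadic_cube_def divide_right_mono)
      then have "z \<in> S j" using y False by (auto simp: S_def M_def w_def)
      then obtain i where i: "i \<in> F" "z \<in> D i" using F(2)[of j] by (auto simp: j_def)
      have "z \<in> dyadic_cube (l i) (coarse (2 ^ (M - l i)) y)"
        using dyadic_cube_coarse[of "l i" M y] lL[OF i(1)] zM by (auto simp: M_def)
      then have "(l i, coarse (2 ^ (M - l i)) y) \<in> T"
        using i coarse_in_grid[OF y, of "l i"] lL[OF i(1)] by (auto simp: T_def H_def M_def)
      from member_le_sum[OF this, of ?g] g0 finT show ?thesis by simp
    qed (simp add: g0 sum_nonneg)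
  qed
  also have "\<dots> = (\<Sum>t\<in>T. mass (fst t) (snd t))"
    unfolding mass_def by (subst sum.swap) (simp add: sum.inter_filter)
  also have "\<dots> \<le> (\<Sum>t\<in>T. (\<theta> * (2 powr (real (fst t) * s) * (mass (fst t) (snd t))\<^sup>2)
      + 2 powr (- real (fst t) * s) / \<theta>) / 2)"
  proof (rule sum_mono)
    fix t
    define m where "m = mass (fst t) (snd t)"
    define a where "a = \<theta> * 2 powr (real (fst t) * s)"
    have a: "a > 0" using \<theta> by (simp add: a_def)
    have "0 \<le> (a * m - 1)\<^sup>2 / a" using a by simp
    also have "\<dots> = a * m\<^sup>2 + 1 / a - 2 * m" using a by (simp add: field_simps power2_eq_square)
    finally have "m \<le> (a * m\<^sup>2 + 1 / a) / 2" by simp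
    moreover have "1 / a = 2 powr (- real (fst t) * s) / \<theta>"
      by (simp add: a_def powr_minus field_simps)
    ultimately show "mass (fst t) (snd t) \<le> (\<theta> * (2 powr (real (fst t) * s) * (mass (fst t) (snd t))\<^sup>2)
      + 2 powr (- real (fst t) * s) / \<theta>) / 2"
      by (simp add: a_def m_def mult.assoc)
  qed
  also have "\<dots> = (\<theta> * (\<Sum>t\<in>T. 2 powr (real (fst t) * s) * (mass (fst t) (snd t))\<^sup>2)
      + (\<Sum>t\<in>T. 2 powr (- real (fst t) * s)) / \<theta>) / 2"
    by (simp add: sum.distrib sum_distrib_left flip: sum_divide_distrib)
  also have "\<dots> \<le> (\<theta> * (C * B) + (\<theta> / 2) / \<theta>) / 2"
  proof -
    have "(\<Sum>t\<in>T. 2 powr (real (fst t) * s) * (mass (fst t) (snd t))\<^sup>2)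
        \<le> (\<Sum>t\<in>(SIGMA k:{..<Suc M}. grid (2 ^ k)). 2 powr (real (fst t) * s) * (mass (fst t) (snd t))\<^sup>2)"
      by (rule sum_mono2[OF _ TS]) auto
    also have "\<dots> = (\<Sum>k<Suc M. 2 powr (real k * s) * (\<Sum>Y\<in>grid (2 ^ k). (mass k Y)\<^sup>2))"
      unfolding sum_distrib_left by (subst sum.Sigma) (auto simp: split_def)
    also have "\<dots> \<le> (\<Sum>k<Suc M. C * (2 powr (real k * s) * 2 powr (- real k * s')))"
    proof (rule sum_mono)
      fix k assume k: "k \<in> {..<Suc M}"
      have "(\<Sum>Y\<in>grid (2 ^ k). (mass k Y)\<^sup>2) = energy (grid (2 ^ M)) (coarse (2 ^ (M - k))) w"
        unfolding mass_def using k coarse_in_grid[of _ M k]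
        by (intro energy_fibres[symmetric]) auto
      also have "\<dots> \<le> C * 2 powr (- real k * s')"
        using energy[of k j] k by (simp add: M_def w_def)
      finally have "2 powr (real k * s) * (\<Sum>Y\<in>grid (2 ^ k). (mass k Y)\<^sup>2)
          \<le> 2 powr (real k * s) * (C * 2 powr (- real k * s'))"
        by (intro mult_left_mono) auto
      then show "2 powr (real k * s) * (\<Sum>Y\<in>grid (2 ^ k). (mass k Y)\<^sup>2)
          \<le> C * (2 powr (real k * s) * 2 powr (- real k * s'))" by (simp only: mult_ac)
    qed
    also have "\<dots> \<le> C * B"
      unfolding sum_distrib_left[symmetric] by (rule mult_left_mono[OF B(2) \<open>C \<ge> 0\<close>])
    finally have 1: "(\<Sum>t\<in>T. 2 powr (real (fst t) * s) * (mass (fst t) (snd t))\<^sup>2) \<le> C * B" .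
    have "(\<Sum>t\<in>T. 2 powr (- real (fst t) * s)) \<le> (\<Sum>i\<in>F. \<Sum>t\<in>{l i} \<times> H i. 2 powr (- real (fst t) * s))"
      unfolding T_def using F(1) finH by (intro sum_UN_le) auto
    also have "\<dots> = (\<Sum>i\<in>F. real (card (H i)) * 2 powr (- real (l i) * s))"
    proof (rule sum.cong[OF refl])
      fix i
      have "(\<Sum>t\<in>{l i} \<times> H i. 2 powr (- real (fst t) * s)) = (\<Sum>t\<in>{l i} \<times> H i. 2 powr (- real (l i) * s))"
        by (rule sum.cong) auto
      then show "(\<Sum>t\<in>{l i} \<times> H i. 2 powr (- real (fst t) * s)) = real (card (H i)) * 2 powr (- real (l i) * s)"
        by (simp add: card_cartesian_product)
    qed
    also have "\<dots> \<le> (\<Sum>i\<in>F. N * 2 powr s * (if U i = {} then 0 else diameter (U i) powr s + \<eta> * (1/2) ^ Suc i))"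
      by (intro sum_mono cardH)
    also have "\<dots> = N * 2 powr s * (\<Sum>i\<in>F. if U i = {} then 0 else diameter (U i) powr s + \<eta> * (1/2) ^ Suc i)"
      by (simp add: sum_distrib_left)
    also have "\<dots> \<le> N * 2 powr s * (\<eta> + \<eta>)"
    proof (intro mult_left_mono)
      have "(\<Sum>i\<in>F. if U i = {} then 0 else diameter (U i) powr s + \<eta> * (1/2) ^ Suc i)
          \<le> (\<Sum>i\<in>F. (if U i = {} then 0 else diameter (U i) powr s) + \<eta> * (1/2) ^ Suc i)"
        using \<eta> by (intro sum_mono) auto
      also have "\<dots> = (\<Sum>i\<in>F. if U i = {} then 0 else diameter (U i) powr s) + \<eta> * (\<Sum>i\<in>F. (1/2) ^ Suc i)"
        by (simp add: sum.distrib sum_distrib_left)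
      also have "\<dots> \<le> \<eta> + \<eta> * 1"
      proof (intro add_mono mult_left_mono)
        have "ennreal (\<Sum>i\<in>F. if U i = {} then 0 else diameter (U i) powr s) = (\<Sum>i\<in>F. diam_power s (U i))"
          using s by (simp add: diam_power_def if_distrib flip: sum_ennreal cong: if_cong sum.cong)
        also have "\<dots> \<le> (\<Sum>i. diam_power s (U i))" by (rule sum_le_suminf) (auto simp: F)
        also have "\<dots> \<le> ennreal \<eta>" using U(2) by simp
        finally show "(\<Sum>i\<in>F. if U i = {} then 0 else diameter (U i) powr s) \<le> \<eta>"
          using \<eta> by (simp add: ennreal_le_iff)
        have "(\<Sum>i\<in>F. (1/2::real) ^ Suc i) \<le> (\<Sum>i. (1/2) ^ Suc i)"
          using power_half_series by (intro sum_le_suminf F) (auto simp: sums_iff)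
        then show "(\<Sum>i\<in>F. (1/2::real) ^ Suc i) \<le> 1"
          using power_half_series by (simp add: sums_iff)
      qed (use \<eta> in auto)
      finally show "(\<Sum>i\<in>F. if U i = {} then 0 else diameter (U i) powr s + \<eta> * (1/2) ^ Suc i) \<le> \<eta> + \<eta>"
        by simp
    qed (use N in auto)
    also have "\<dots> = \<theta> / 2" using N by (simp add: \<eta>_def)
    finally have 2: "(\<Sum>t\<in>T. 2 powr (- real (fst t) * s)) \<le> \<theta> / 2" .
    from 1 2 \<theta> show ?thesis
      by (intro divide_right_mono add_mono mult_left_mono) auto
  qed
  also have "\<dots> < 1" using \<theta> by simp
  finally show False by simp
qed

section \<open>Concatenation of patterns\<close>

text \<open>The energy bound at intermediate levels allows a constant \<open>C\<close>, but the one at the last level does not.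
This is what keeps the constant from growing when many patterns are concatenated.\<close>

definition pattern :: "real \<Rightarrow> real \<Rightarrow> nat \<Rightarrow> (('i::finite \<Rightarrow> nat) \<Rightarrow> real) \<Rightarrow> bool" where
  "pattern s C \<Delta> h \<longleftrightarrow> (\<forall>y. h y \<ge> 0) \<and> (\<Sum>y\<in>grid (2 ^ \<Delta>). h y) = 1 \<and>
     (\<forall>t\<le>\<Delta>. energy (grid (2 ^ \<Delta>)) (coarse (2 ^ (\<Delta> - t))) h \<le> C * 2 powr (- real t * s)) \<and>
     energy (grid (2 ^ \<Delta>)) id h \<le> 2 powr (- real \<Delta> * s)"

definition offset :: "nat \<Rightarrow> ('i \<Rightarrow> nat) \<Rightarrow> 'i \<Rightarrow> nat" where
  "offset k y = (\<lambda>i. y i mod k)"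

text \<open>The product mass: the leading digits are distributed according to \<open>\<nu>\<close> and the following \<open>\<Delta>\<close> digits,
independently, according to \<open>h\<close>.\<close>

definition refine :: "nat \<Rightarrow> (('i \<Rightarrow> nat) \<Rightarrow> real) \<Rightarrow> (('i \<Rightarrow> nat) \<Rightarrow> real) \<Rightarrow> ('i \<Rightarrow> nat) \<Rightarrow> real" where
  "refine \<Delta> \<nu> h y = \<nu> (coarse (2 ^ \<Delta>) y) * h (offset (2 ^ \<Delta>) y)"

lemma offset_in_grid: "k > 0 \<Longrightarrow> offset k y \<in> grid k"
  by (simp add: offset_def grid_def)

lemma sum_grid_split:
  fixes F :: "('i::finite \<Rightarrow> nat) \<Rightarrow> ('i \<Rightarrow> nat) \<Rightarrow> real"
  shows "(\<Sum>y\<in>grid (2 ^ (L + \<Delta>)). F (coarse (2 ^ \<Delta>) y) (offset (2 ^ \<Delta>) y))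
    = (\<Sum>a\<in>grid (2 ^ L). \<Sum>w\<in>grid (2 ^ \<Delta>). F a w)"
proof -
  have "(\<Sum>y\<in>grid (2 ^ (L + \<Delta>)). F (coarse (2 ^ \<Delta>) y) (offset (2 ^ \<Delta>) y))
     = (\<Sum>(a, w)\<in>grid (2 ^ L) \<times> grid (2 ^ \<Delta>). F a w)"
  proof (rule sum.reindex_bij_witness[where
        i = "\<lambda>(a, w) i. a i * 2 ^ \<Delta> + w i" and j = "\<lambda>y. (coarse (2 ^ \<Delta>) y, offset (2 ^ \<Delta>) y)"])
    fix b assume b: "b \<in> (grid (2 ^ L) :: ('i \<Rightarrow> nat) set) \<times> (grid (2 ^ \<Delta>) :: ('i \<Rightarrow> nat) set)"
    have "a * 2 ^ \<Delta> + w < 2 ^ (L + \<Delta>)" if "a < 2 ^ L" "w < 2 ^ \<Delta>" for a w :: nat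
    proof -
      have "a * 2 ^ \<Delta> + w < (a + 1) * 2 ^ \<Delta>" using that by simp
      also have "\<dots> \<le> 2 ^ L * 2 ^ \<Delta>" using that by (intro mult_right_mono) auto
      finally show ?thesis by (simp add: power_add)
    qed
    then show "(case b of (a, w) \<Rightarrow> \<lambda>i. a i * 2 ^ \<Delta> + w i) \<in> grid (2 ^ (L + \<Delta>))"
      using b by (auto simp: grid_def)
    show "(coarse (2 ^ \<Delta>) (case b of (a, w) \<Rightarrow> \<lambda>i. a i * 2 ^ \<Delta> + w i),
          offset (2 ^ \<Delta>) (case b of (a, w) \<Rightarrow> \<lambda>i. a i * 2 ^ \<Delta> + w i)) = b"
      using b by (auto simp: coarse_def offset_def grid_def)
  next
    fix y :: "'i \<Rightarrow> nat" assume y: "y \<in> grid (2 ^ (L + \<Delta>))"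
    show "(case (coarse (2 ^ \<Delta>) y, offset (2 ^ \<Delta>) y) of (a, w) \<Rightarrow> \<lambda>i. a i * 2 ^ \<Delta> + w i) = y"
      unfolding prod.case by (rule ext) (simp only: coarse_def offset_def div_mult_mod_eq)
    show "(coarse (2 ^ \<Delta>) y, offset (2 ^ \<Delta>) y) \<in> grid (2 ^ L) \<times> grid (2 ^ \<Delta>)"
      using coarse_in_grid[OF y, of L] by (simp add: offset_in_grid)
  qed auto
  then show ?thesis by (simp add: sum.cartesian_product)
qed

lemma coarse_coarse: "coarse j (coarse k y) = coarse (k * j) y"
  by (simp add: coarse_def div_mult2_eq)

lemma coarse_1 [simp]: "coarse (Suc 0) = id"
  by (auto simp: coarse_def)

text \<open>Two points agree in their leading digits, including some of the last \<open>\<Delta>\<close>, iff they agree before the last block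
and in the leading digits of the last block.\<close>

lemma coarse_eq_iff:
  assumes "t \<le> \<Delta>"
  shows "coarse (2 ^ (\<Delta> - t)) y = coarse (2 ^ (\<Delta> - t)) y' \<longleftrightarrow>
    coarse (2 ^ \<Delta>) y = coarse (2 ^ \<Delta>) y' \<and>
    coarse (2 ^ (\<Delta> - t)) (offset (2 ^ \<Delta>) y) = coarse (2 ^ (\<Delta> - t)) (offset (2 ^ \<Delta>) y')"
proof -
  define k :: nat where "k = 2 ^ (\<Delta> - t)"
  define m :: nat where "m = 2 ^ t"
  have km: "2 ^ \<Delta> = k * m" and pos: "k > 0" "m > 0"
    using assms by (simp_all add: k_def m_def flip: power_add)
  have iff: "a div k = b div k \<longleftrightarrow> a div (k * m) = b div (k * m) \<and> a mod (k * m) div k = b mod (k * m) div k"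
    for a b :: nat
  proof -
    have r: "c mod (k * m) div k = c div k mod m" for c
      using pos by (simp add: mod_mult2_eq)
    show ?thesis
      unfolding r div_mult2_eq by (metis mult_div_mod_eq)
  qed
  show ?thesis
    unfolding k_def[symmetric] km coarse_def offset_def fun_eq_iff using iff by blast
qed

lemma energy_refine_coarse:
  fixes \<nu> h :: "('i::finite \<Rightarrow> nat) \<Rightarrow> real"
  assumes "l \<le> L" "(\<Sum>w\<in>grid (2 ^ \<Delta>). h w) = 1"
  shows "energy (grid (2 ^ (L + \<Delta>))) (coarse (2 ^ (L + \<Delta> - l))) (refine \<Delta> \<nu> h)
    = energy (grid (2 ^ L)) (coarse (2 ^ (L - l))) \<nu>"
proof -
  define c where "c = (coarse (2 ^ (L - l)) :: ('i \<Rightarrow> nat) \<Rightarrow> _)"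
  have cc: "coarse (2 ^ (L + \<Delta> - l)) y = c (coarse (2 ^ \<Delta>) y)" for y
  proof -
    have "2 ^ \<Delta> * 2 ^ (L - l) = (2 :: nat) ^ (L + \<Delta> - l)" using assms(1) by (simp add: add.commute flip: power_add)
    then show ?thesis by (simp only: c_def coarse_coarse)
  qed
  have "energy (grid (2 ^ (L + \<Delta>))) (coarse (2 ^ (L + \<Delta> - l))) (refine \<Delta> \<nu> h)
    = (\<Sum>a\<in>grid (2 ^ L). \<Sum>w\<in>grid (2 ^ \<Delta>). \<Sum>a'\<in>grid (2 ^ L). \<Sum>w'\<in>grid (2 ^ \<Delta>).
        if c a = c a' then (\<nu> a * h w) * (\<nu> a' * h w') else 0)"
    unfolding energy_def refine_def cc
    by (subst sum_grid_split[symmetric], rule sum.cong[OF refl], subst sum_grid_split[symmetric], rule refl)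
  also have "\<dots> = (\<Sum>a\<in>grid (2 ^ L). \<Sum>w\<in>grid (2 ^ \<Delta>). \<Sum>a'\<in>grid (2 ^ L).
      (if c a = c a' then \<nu> a * \<nu> a' else 0) * h w * (\<Sum>w'\<in>grid (2 ^ \<Delta>). h w'))"
    unfolding sum_distrib_left by (intro sum.cong refl) auto
  also have "\<dots> = (\<Sum>a\<in>grid (2 ^ L). (\<Sum>w\<in>grid (2 ^ \<Delta>). h w) * (\<Sum>a'\<in>grid (2 ^ L).
      (if c a = c a' then \<nu> a * \<nu> a' else 0)))"
    unfolding sum_product by (intro sum.cong refl) (simp only: assms(2) mult_1_right mult.commute)
  finally show ?thesis unfolding assms(2) by (simp add: energy_def c_def)
qed

lemma energy_refine_offset:
  fixes \<nu> h :: "('i::finite \<Rightarrow> nat) \<Rightarrow> real"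
  assumes "t \<le> \<Delta>"
  shows "energy (grid (2 ^ (L + \<Delta>))) (coarse (2 ^ (\<Delta> - t))) (refine \<Delta> \<nu> h)
    = energy (grid (2 ^ L)) id \<nu> * energy (grid (2 ^ \<Delta>)) (coarse (2 ^ (\<Delta> - t))) h"
proof -
  define c where "c = (coarse (2 ^ (\<Delta> - t)) :: ('i \<Rightarrow> nat) \<Rightarrow> _)"
  have "energy (grid (2 ^ (L + \<Delta>))) (coarse (2 ^ (\<Delta> - t))) (refine \<Delta> \<nu> h)
    = (\<Sum>a\<in>grid (2 ^ L). \<Sum>w\<in>grid (2 ^ \<Delta>). \<Sum>a'\<in>grid (2 ^ L). \<Sum>w'\<in>grid (2 ^ \<Delta>).
        if a = a' \<and> c w = c w' then (\<nu> a * h w) * (\<nu> a' * h w') else 0)"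
  proof -
    have "energy (grid (2 ^ (L + \<Delta>))) (coarse (2 ^ (\<Delta> - t))) (refine \<Delta> \<nu> h)
      = energy (grid (2 ^ (L + \<Delta>))) (\<lambda>y. (coarse (2 ^ \<Delta>) y, c (offset (2 ^ \<Delta>) y))) (refine \<Delta> \<nu> h)"
      unfolding energy_def prod.inject c_def
      by (intro sum.cong refl if_cong) (rule coarse_eq_iff[OF assms])
    also have "\<dots> = (\<Sum>a\<in>grid (2 ^ L). \<Sum>w\<in>grid (2 ^ \<Delta>). \<Sum>a'\<in>grid (2 ^ L). \<Sum>w'\<in>grid (2 ^ \<Delta>).
        if a = a' \<and> c w = c w' then (\<nu> a * h w) * (\<nu> a' * h w') else 0)"
      unfolding energy_def refine_def prod.inject
      by (subst sum_grid_split[symmetric], rule sum.cong[OF refl], subst sum_grid_split[symmetric], rule refl)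
    finally show ?thesis .
  qed
  also have "\<dots> = (\<Sum>a\<in>grid (2 ^ L). \<Sum>a'\<in>grid (2 ^ L). \<Sum>w\<in>grid (2 ^ \<Delta>). \<Sum>w'\<in>grid (2 ^ \<Delta>).
        (if a = a' then \<nu> a * \<nu> a' else 0) * (if c w = c w' then h w * h w' else 0))"
    by (rule sum.cong[OF refl], subst sum.swap) (intro sum.cong refl, auto)
  also have "\<dots> = (\<Sum>a\<in>grid (2 ^ L). \<Sum>a'\<in>grid (2 ^ L). (if a = a' then \<nu> a * \<nu> a' else 0) *
        (\<Sum>w\<in>grid (2 ^ \<Delta>). \<Sum>w'\<in>grid (2 ^ \<Delta>). (if c w = c w' then h w * h w' else 0)))"
    by (simp only: sum_distrib_left)
  also have "\<dots> = energy (grid (2 ^ L)) id \<nu> * energy (grid (2 ^ \<Delta>)) c h"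
    by (simp only: energy_def sum_distrib_right id_apply)
  finally show ?thesis by (simp add: c_def)
qed

text \<open>By independence the energy at a level inside the second block is the final energy of the first pattern times
the energy of the second pattern, so the exponents add up and the constant is only used once.\<close>

lemma pattern_refine:
  fixes \<nu> h :: "('i::finite \<Rightarrow> nat) \<Rightarrow> real"
  assumes "C \<ge> 0" "pattern s C L \<nu>" "pattern s C \<Delta> h"
  shows "pattern s C (L + \<Delta>) (refine \<Delta> \<nu> h)"
  unfolding pattern_def
proof (intro conjI allI impI)
  have h1: "(\<Sum>w\<in>grid (2 ^ \<Delta>). h w) = 1" and n1: "(\<Sum>w\<in>grid (2 ^ L). \<nu> w) = 1"
    using assms(2,3) by (auto simp: pattern_def)
  have e0: "energy (grid (2 ^ L)) id \<nu> \<ge> 0"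
    using assms(2) by (auto simp: energy_def pattern_def intro!: sum_nonneg)
  have eL: "energy (grid (2 ^ L)) id \<nu> \<le> 2 powr (- real L * s)"
    using assms(2) by (simp add: pattern_def)
  have eh: "energy (grid (2 ^ \<Delta>)) (coarse k) h \<ge> 0" for k
    using assms(3) by (auto simp: energy_def pattern_def intro!: sum_nonneg)
  show "refine \<Delta> \<nu> h y \<ge> 0" for y
    using assms(2,3) by (auto simp: refine_def pattern_def)
  show "(\<Sum>y\<in>grid (2 ^ (L + \<Delta>)). refine \<Delta> \<nu> h y) = 1"
    unfolding refine_def
    by (subst sum_grid_split[where F = "\<lambda>a w. \<nu> a * h w"]) (simp add: h1 n1 flip: sum_distrib_left)
  have powr_split: "2 powr (- real L * s) * 2 powr (- real t * s) = 2 powr (- real (L + t) * s)" for t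
    by (simp add: powr_add[symmetric] algebra_simps)
  show "energy (grid (2 ^ (L + \<Delta>))) (coarse (2 ^ (L + \<Delta> - l))) (refine \<Delta> \<nu> h)
      \<le> C * 2 powr (- real l * s)" if "l \<le> L + \<Delta>" for l
  proof (cases "l \<le> L")
    case True
    then show ?thesis
      unfolding energy_refine_coarse[OF True h1] using assms(2) by (simp add: pattern_def)
  next
    case False
    define t where "t = l - L"
    have t: "t \<le> \<Delta>" "l = L + t" using False that by (auto simp: t_def)
    have "energy (grid (2 ^ (L + \<Delta>))) (coarse (2 ^ (\<Delta> - t))) (refine \<Delta> \<nu> h)
        \<le> 2 powr (- real L * s) * (C * 2 powr (- real t * s))"
      unfolding energy_refine_offset[OF t(1)]
      using assms(3) t(1) e0 eL eh by (intro mult_mono) (auto simp: pattern_def)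
    also have "\<dots> = C * 2 powr (- real l * s)" unfolding t(2) powr_split[symmetric] by (simp only: mult_ac)
    finally show ?thesis using t by simp
  qed
  have "energy (grid (2 ^ (L + \<Delta>))) (coarse (2 ^ (\<Delta> - \<Delta>))) (refine \<Delta> \<nu> h)
      \<le> 2 powr (- real L * s) * 2 powr (- real \<Delta> * s)"
    unfolding energy_refine_offset[OF order_refl]
    using assms(3) e0 eL eh[of 1] by (intro mult_mono) (auto simp: pattern_def)
  then show "energy (grid (2 ^ (L + \<Delta>))) id (refine \<Delta> \<nu> h) \<le> 2 powr (- real (L + \<Delta>) * s)"
    unfolding powr_split by simp
qed

lemma dyadic_cube_offset:
  fixes z :: "real ^ 'i::finite"
  assumes "z \<in> dyadic_cube (L + \<Delta>) y"
  shows "(\<chi> i. 2 ^ L * z $ i - real (y i div 2 ^ \<Delta>)) \<in> dyadic_cube \<Delta> (offset (2 ^ \<Delta>) y)"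
  unfolding dyadic_cube_def mem_Collect_eq
proof (intro allI)
  fix i
  have "real (y i) = real (y i div 2 ^ \<Delta> * 2 ^ \<Delta> + y i mod 2 ^ \<Delta>)"
    by (simp only: div_mult_mod_eq)
  then have "real (y i) = real (y i div 2 ^ \<Delta>) * 2 ^ \<Delta> + real (offset (2 ^ \<Delta>) y i)"
    by (simp only: offset_def of_nat_add of_nat_mult of_nat_power of_nat_numeral)
  moreover have "real (y i) / (2 ^ L * 2 ^ \<Delta>) \<le> z $ i" "z $ i \<le> (real (y i) + 1) / (2 ^ L * 2 ^ \<Delta>)"
    using assms by (auto simp: dyadic_cube_def power_add)
  then have "real (y i) \<le> (2 ^ L * z $ i) * 2 ^ \<Delta>" "(2 ^ L * z $ i) * 2 ^ \<Delta> \<le> real (y i) + 1"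
    by (simp_all add: field_simps)
  ultimately show "real (offset (2 ^ \<Delta>) y i) / 2 ^ \<Delta> \<le> (\<chi> i. 2 ^ L * z $ i - real (y i div 2 ^ \<Delta>)) $ i \<and>
      (\<chi> i. 2 ^ L * z $ i - real (y i div 2 ^ \<Delta>)) $ i \<le> (real (offset (2 ^ \<Delta>) y i) + 1) / 2 ^ \<Delta>"
    by (simp add: pos_divide_le_eq pos_le_divide_eq left_diff_distrib)
qed

text \<open>Concatenate patterns for \<open>G (L 0)\<close>, \<open>G (L 1)\<close>, ..., where \<open>L j\<close> is the number of digits already fixed before
the \<open>j\<close>-th block; the choice of a pattern may depend on this number. Dropping the first \<open>L j\<close> digits of \<open>z\<close> means
passing from \<open>z\<close> to \<open>2 ^ L j * z\<close> minus an integer vector.\<close>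

lemma pattern_concatenation:
  fixes G :: "nat \<Rightarrow> (real ^ 'i::finite) set"
  assumes C: "C \<ge> 1" and s: "0 < s'" "s' < s"
    and ex: "\<And>L. \<exists>\<Delta> h. \<Delta> > 0 \<and> pattern s C \<Delta> h \<and>
        (\<forall>y\<in>grid (2 ^ \<Delta>). h y \<noteq> 0 \<longrightarrow> dyadic_cube \<Delta> y \<subseteq> G L)"
  obtains K L where "hausdorff_measure s' K \<noteq> 0" "strict_mono (L :: nat \<Rightarrow> nat)"
    "\<And>z i. z \<in> K \<Longrightarrow> 0 \<le> z $ i \<and> z $ i \<le> 1"
    "\<And>z j. z \<in> K \<Longrightarrow> \<exists>a :: 'i \<Rightarrow> nat. (\<chi> i. 2 ^ L j * z $ i - real (a i)) \<in> G (L j)"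
proof -
  define step where "step = (\<lambda>(L, \<nu>) (L', \<nu>'). \<exists>\<Delta> h. \<Delta> > 0 \<and> pattern s C \<Delta> h \<and>
      (\<forall>y\<in>grid (2 ^ \<Delta>). h y \<noteq> 0 \<longrightarrow> dyadic_cube \<Delta> y \<subseteq> G L) \<and> L' = L + \<Delta> \<and> \<nu>' = refine \<Delta> \<nu> h)"
  have "\<exists>f. \<forall>n::nat. (case f n of (L, \<nu>) \<Rightarrow> pattern s C L \<nu>) \<and> step (f n) (f (Suc n))"
  proof (rule dependent_nat_choice)
    have "grid (2 ^ 0) = {(\<lambda>_. 0) :: 'i \<Rightarrow> nat}" by (auto simp: grid_def)
    then have "pattern s C 0 (\<lambda>_ :: 'i \<Rightarrow> nat. 1)"
      unfolding pattern_def using C by (simp add: energy_def)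
    then show "\<exists>x :: nat \<times> (('i \<Rightarrow> nat) \<Rightarrow> real). case x of (L, \<nu>) \<Rightarrow> pattern s C L \<nu>"
      by (intro exI[of _ "(0, \<lambda>_. 1)"]) simp
  next
    fix x :: "nat \<times> (('i \<Rightarrow> nat) \<Rightarrow> real)" and n :: nat
    assume x: "case x of (L, \<nu>) \<Rightarrow> pattern s C L \<nu>"
    obtain L \<nu> where x_eq: "x = (L, \<nu>)" by (cases x)
    obtain \<Delta> h where "\<Delta> > 0" "pattern s C \<Delta> h"
      "\<forall>y\<in>grid (2 ^ \<Delta>). h y \<noteq> 0 \<longrightarrow> dyadic_cube \<Delta> y \<subseteq> G L" using ex[of L] by blast
    moreover from this have "pattern s C (L + \<Delta>) (refine \<Delta> \<nu> h)"
      using x C by (intro pattern_refine) (auto simp: x_eq)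
    ultimately show "\<exists>y. (case y of (L, \<nu>) \<Rightarrow> pattern s C L \<nu>) \<and> step x y"
      by (intro exI[of _ "(L + \<Delta>, refine \<Delta> \<nu> h)"]) (auto simp: step_def x_eq)
  qed
  then obtain f where
    "\<forall>n::nat. (case f n of (L, \<nu>) \<Rightarrow> pattern s C L \<nu>) \<and> step (f n) (f (Suc n))" by (rule exE)
  then have f: "case f n of (L, \<nu>) \<Rightarrow> pattern s C L \<nu>" "step (f n) (f (Suc n))" for n
    by - (drule spec[of _ n], erule conjE, assumption)+
  define L where "L n = fst (f n)" for n
  define \<nu> where "\<nu> n = snd (f n)" for n
  have pat: "pattern s C (L n) (\<nu> n)" for n
    using f(1)[of n] by (simp add: L_def \<nu>_def split_def)
  have "\<exists>\<Delta> h. \<Delta> > 0 \<and> (\<forall>y\<in>grid (2 ^ \<Delta>). h y \<noteq> 0 \<longrightarrow> dyadic_cube \<Delta> y \<subseteq> G (L n)) \<and>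
      L (Suc n) = L n + \<Delta> \<and> \<nu> (Suc n) = refine \<Delta> (\<nu> n) h" for n
    using f(2)[of n] unfolding step_def L_def \<nu>_def split_def by blast
  then obtain \<Delta> h where step: "\<And>n. \<Delta> n > 0"
    "\<And>n y. y \<in> grid (2 ^ \<Delta> n) \<Longrightarrow> h n y \<noteq> 0 \<Longrightarrow> dyadic_cube (\<Delta> n) y \<subseteq> G (L n)"
    "\<And>n. L (Suc n) = L n + \<Delta> n" "\<And>n. \<nu> (Suc n) = refine (\<Delta> n) (\<nu> n) (h n)"
    by metis
  define S where "S j = (\<Union>y\<in>{y\<in>grid (2 ^ L j). \<nu> j y \<noteq> 0}. dyadic_cube (L j) y)" for j
  have nested: "S (Suc j) \<subseteq> S j" for j
  proof
    fix z assume "z \<in> S (Suc j)"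
    then obtain y where y: "y \<in> grid (2 ^ (L j + \<Delta> j))" "refine (\<Delta> j) (\<nu> j) (h j) y \<noteq> 0"
      "z \<in> dyadic_cube (L j + \<Delta> j) y" by (auto simp: S_def step)
    moreover have "coarse (2 ^ \<Delta> j) y \<in> grid (2 ^ L j)" using coarse_in_grid[OF y(1), of "L j"] by simp
    moreover have "z \<in> dyadic_cube (L j) (coarse (2 ^ \<Delta> j) y)"
      using dyadic_cube_coarse[of "L j" "L j + \<Delta> j" y] y(3) by auto
    ultimately show "z \<in> S j" by (auto simp: S_def refine_def)
  qed
  have "hausdorff_measure s' (\<Inter>j. S j) \<noteq> 0"
    unfolding S_def
  proof (rule hausdorff_measure_pos_of_energy[OF s, where C = C])
    show "L j < L (Suc j)" for j using step(1) by (simp add: step(3))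
    show "(\<Union>y\<in>{y\<in>grid (2 ^ L (Suc j)). \<nu> (Suc j) y \<noteq> 0}. dyadic_cube (L (Suc j)) y)
      \<subseteq> (\<Union>y\<in>{y\<in>grid (2 ^ L j). \<nu> j y \<noteq> 0}. dyadic_cube (L j) y)" for j
      using nested[of j] unfolding S_def .
  qed (use pat in \<open>auto simp: pattern_def\<close>)
  moreover have "strict_mono L" using step by (simp add: strict_mono_Suc_iff)
  moreover have "0 \<le> z $ i \<and> z $ i \<le> 1" if "z \<in> (\<Inter>j. S j)" for z i
  proof -
    have "z \<in> S 0" using that by blast
    then obtain y where y: "y \<in> grid (2 ^ L 0)" "z \<in> dyadic_cube (L 0) y" by (auto simp: S_def)
    then have *: "real (y i) / 2 ^ L 0 \<le> z $ i" "z $ i \<le> (real (y i) + 1) / 2 ^ L 0"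
      by (auto simp: dyadic_cube_def)
    have "y i + 1 \<le> 2 ^ L 0" using y(1) by (simp add: grid_def Suc_le_eq)
    then have "real (y i + 1) \<le> real (2 ^ L 0)" by (simp only: of_nat_le_iff)
    then have "real (y i) + 1 \<le> 2 ^ L 0" by simp
    then have "(real (y i) + 1) / 2 ^ L 0 \<le> 1" by simp
    moreover have "0 \<le> real (y i) / 2 ^ L 0" by simp
    ultimately show ?thesis using * by linarith
  qed
  moreover have "\<exists>a :: 'i \<Rightarrow> nat. (\<chi> i. 2 ^ L j * z $ i - real (a i)) \<in> G (L j)" if "z \<in> (\<Inter>j. S j)" for z j
  proof -
    have "z \<in> S (Suc j)" using that by blast
    then obtain y where y: "y \<in> grid (2 ^ (L j + \<Delta> j))" "refine (\<Delta> j) (\<nu> j) (h j) y \<noteq> 0"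
      "z \<in> dyadic_cube (L j + \<Delta> j) y" by (auto simp: S_def step)
    then have "h j (offset (2 ^ \<Delta> j) y) \<noteq> 0" by (auto simp: refine_def)
    then have "dyadic_cube (\<Delta> j) (offset (2 ^ \<Delta> j) y) \<subseteq> G (L j)"
      by (intro step(2) offset_in_grid) auto
    then show ?thesis using dyadic_cube_offset[OF y(3)]
      by (intro exI[of _ "\<lambda>i. y i div 2 ^ \<Delta> j"]) (rule subsetD)
  qed
  ultimately show thesis using that by blast
qed

section \<open>Counting residues and cells\<close>

definition dot :: "('m::finite \<Rightarrow> nat) \<Rightarrow> ('m \<Rightarrow> nat) \<Rightarrow> nat" where
  "dot q x = (\<Sum>i\<in>UNIV. q i * x i)"

text \<open>For \<open>N = 2 ^ t\<close> this is the index of the dyadic cube of level \<open>t\<close> that contains the point \<open>x / P\<close>.\<close>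

definition cell :: "nat \<Rightarrow> nat \<Rightarrow> ('m \<Rightarrow> nat) \<Rightarrow> 'm \<Rightarrow> nat" where
  "cell P N x = (\<lambda>i. N * x i div P)"

text \<open>Used throughout to count integers in an interval whose differences are multiples of \<open>a\<close>.\<close>

lemma card_spaced_le:
  fixes S :: "int set"
  assumes "a > 0" "S \<subseteq> {lo..<lo + int R}" "\<And>c c'. c \<in> S \<Longrightarrow> c' \<in> S \<Longrightarrow> int a dvd c - c'"
  shows "card S \<le> R div a + 1"
proof -
  define f where "f c = (c - lo) div int a" for c
  have "inj_on f S"
  proof
    fix c c' assume cc: "c \<in> S" "c' \<in> S" "f c = f c'"
    then have "(c - lo) mod int a = (c' - lo) mod int a"
      using assms(3)[OF cc(1,2)] by (simp add: mod_eq_dvd_iff)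
    with cc(3) have "c - lo = c' - lo" unfolding f_def by (metis div_mult_mod_eq)
    then show "c = c'" by simp
  qed
  moreover have "f ` S \<subseteq> {0..int (R div a)}"
  proof
    fix k assume "k \<in> f ` S"
    then obtain c where c: "c \<in> S" "k = (c - lo) div int a" by (auto simp: f_def)
    then have "0 \<le> c - lo" "c - lo \<le> int R" using assms(2) by auto
    then have "0 \<le> k" "k \<le> int R div int a"
      using c(2) assms(1) by (auto simp: pos_imp_zdiv_nonneg_iff intro: zdiv_mono1)
    then show "k \<in> {0..int (R div a)}" by (simp add: zdiv_int)
  qed
  then have "card (f ` S) \<le> card {0..int (R div a)}" by (intro card_mono) auto
  ultimately show ?thesis by (simp add: card_image)
qed

lemma card_multiples_le:
  fixes T :: "nat set"
  assumes "a > 0" "\<And>k. k \<in> T \<Longrightarrow> lo \<le> int a * int k \<and> int a * int k < lo + int R"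
  shows "card T \<le> R div a + 1" "finite T"
proof -
  define S where "S = (\<lambda>k. int a * int k) ` T"
  have inj: "inj_on (\<lambda>k. int a * int k) T" using assms(1) by (auto simp: inj_on_def)
  have sub: "S \<subseteq> {lo..<lo + int R}" using assms(2) by (auto simp: S_def)
  then have "card S \<le> R div a + 1"
    using assms(1) by (intro card_spaced_le[of a S lo R]) (auto simp: S_def simp flip: right_diff_distrib)
  then show "card T \<le> R div a + 1" using inj by (simp add: S_def card_image)
  have "finite S" using sub finite_subset by blast
  then show "finite T" using inj by (simp add: S_def finite_image_iff)
qed

lemma card_grid_zero:
  fixes A :: "'m::finite set"
  assumes that: "P > 0"
  shows "card {x \<in> grid P. \<forall>i\<in>A. x i = 0} = P ^ (CARD('m) - card A)"
proof -
  have "{x \<in> grid P. \<forall>i\<in>A. x i = 0} = (\<Pi>\<^sub>E i\<in>UNIV. if i \<in> A then {0} else {..<P})"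
  proof -
    have "n \<in> (if i \<in> A then {0} else {..<P}) \<longleftrightarrow> n < P \<and> (i \<in> A \<longrightarrow> n = 0)" for n i
      using that by auto
    then show ?thesis by (simp add: grid_def PiE_UNIV_domain Pi_def) blast
  qed
  then have "card {x \<in> grid P. \<forall>i\<in>A. x i = 0} = (\<Prod>i\<in>UNIV. card (if i \<in> A then {0} else {..<P}))"
    by (simp add: card_PiE)
  also have "\<dots> = (\<Prod>i\<in>UNIV. if i \<in> A then 1 else P)" by (intro prod.cong) auto
  also have "\<dots> = P ^ card (UNIV - A)"
    by (subst prod.If_cases) (auto simp: Compl_eq_Diff_UNIV)
  finally show ?thesis by (simp add: card_Diff_subset)
qed

lemma dot_diff_eq:
  fixes x x' :: "'m::finite \<Rightarrow> nat"
  assumes "\<And>i. i \<notin> A \<Longrightarrow> x i = x' i"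
  shows "int (dot q x) - int (dot q x') = (\<Sum>i\<in>A. int (q i) * (int (x i) - int (x' i)))"
proof -
  have "int (dot q x) - int (dot q x') = (\<Sum>i\<in>UNIV. int (q i) * (int (x i) - int (x' i)))"
    by (simp add: dot_def sum_subtractf right_diff_distrib)
  also have "\<dots> = (\<Sum>i\<in>A. int (q i) * (int (x i) - int (x' i)))"
    using assms by (intro sum.mono_neutral_right) auto
  finally show ?thesis .
qed

lemma prime_dvd_digit_diff:
  fixes x x' P :: nat
  assumes "prime P" "\<not> int P dvd D" "int P dvd D * (int x - int x')" "x < P" "x' < P"
  shows "x = x'"
proof -
  have "prime (int P)" using assms(1) by simp
  then have "int P dvd int x - int x'" using assms(2,3) prime_dvd_mult_iff by blast
  moreover have "\<bar>int x - int x'\<bar> < int P" using assms(4,5) by auto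
  ultimately have "int x - int x' = 0" using dvd_imp_le_int[of "int x - int x'" "int P"] by linarith
  then show ?thesis by simp
qed

lemma mod_eq_int_dvd: "a mod P = b mod P \<longleftrightarrow> int P dvd int a - int b" for a b P :: nat
  by (metis mod_eq_dvd_iff of_nat_eq_iff zmod_int)

text \<open>The coefficient of \<open>x i0\<close> is invertible modulo \<open>P\<close>, so \<open>x i0\<close> can be recovered from the other entries and the
value of the form.\<close>

lemma inj_on_one_residue:
  fixes q :: "'m::finite \<Rightarrow> nat"
  assumes "prime P" "0 < q i0" "q i0 < P"
  shows "inj_on (\<lambda>x. (x(i0 := 0), dot q x mod P)) (grid P)"
proof
  fix x x' assume xx: "x \<in> grid P" "x' \<in> grid P"
    "(x(i0 := 0), dot q x mod P) = (x'(i0 := 0), dot q x' mod P)"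
  have off: "x i = x' i" if "i \<noteq> i0" for i
    using xx(3) that by (metis fst_conv fun_upd_other)
  have "int P dvd int (dot q x) - int (dot q x')" using xx(3) by (simp flip: mod_eq_int_dvd)
  also have "int (dot q x) - int (dot q x') = int (q i0) * (int (x i0) - int (x' i0))"
    using dot_diff_eq[of "{i0}" x x' q] off by simp
  finally have "int P dvd int (q i0) * (int (x i0) - int (x' i0))" .
  moreover have "\<not> int P dvd int (q i0)" using assms(2,3) by (simp add: nat_dvd_not_less)
  ultimately have "x i0 = x' i0"
    using xx(1,2) by (intro prime_dvd_digit_diff[OF assms(1)]) (auto simp only: grid_def mem_Collect_eq)
  with off show "x = x'" by (metis ext)
qed

text \<open>By Cramer's rule the two values determine \<open>x i0\<close> and \<open>x i1\<close> modulo \<open>P\<close>: the determinant is nonzero and smaller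
than \<open>P\<close>, hence invertible.\<close>

lemma inj_on_two_residues:
  fixes q u :: "'m::finite \<Rightarrow> nat"
  assumes "prime P" "i0 \<noteq> i1"
    and det: "int (q i0) * int (u i1) - int (q i1) * int (u i0) \<noteq> 0"
      "\<bar>int (q i0) * int (u i1) - int (q i1) * int (u i0)\<bar> < int P"
  shows "inj_on (\<lambda>x. (x(i0 := 0, i1 := 0), dot q x mod P, dot u x mod P)) (grid P)"
proof
  fix x x' assume xx: "x \<in> grid P" "x' \<in> grid P"
    "(x(i0 := 0, i1 := 0), dot q x mod P, dot u x mod P) = (x'(i0 := 0, i1 := 0), dot q x' mod P, dot u x' mod P)"
  define D where "D = int (q i0) * int (u i1) - int (q i1) * int (u i0)"
  have D: "\<not> int P dvd D"
    using det dvd_imp_le_int[of D "int P"] unfolding D_def[symmetric] by linarith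
  define d0 where "d0 = int (x i0) - int (x' i0)"
  define d1 where "d1 = int (x i1) - int (x' i1)"
  have off: "x i = x' i" if "i \<notin> {i0, i1}" for i
    using xx(3) that by (metis fst_conv fun_upd_other insertCI)
  have "int (dot r x) - int (dot r x') = int (r i0) * d0 + int (r i1) * d1" for r
    using dot_diff_eq[of "{i0, i1}" x x' r] off assms(2) by (simp add: d0_def d1_def)
  moreover have "int P dvd int (dot q x) - int (dot q x')" "int P dvd int (dot u x) - int (dot u x')"
    using xx(3) by (simp_all flip: mod_eq_int_dvd)
  ultimately have q: "int P dvd int (q i0) * d0 + int (q i1) * d1"
    and u: "int P dvd int (u i0) * d0 + int (u i1) * d1" by simp_all
  have "int P dvd int (u i1) * (int (q i0) * d0 + int (q i1) * d1)
      - int (q i1) * (int (u i0) * d0 + int (u i1) * d1)" using q u by (intro dvd_diff dvd_mult)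
  also have "\<dots> = D * d0" by (simp add: D_def algebra_simps)
  finally have "x i0 = x' i0"
    unfolding d0_def using xx(1,2)
    by (intro prime_dvd_digit_diff[OF assms(1) D]) (auto simp only: grid_def mem_Collect_eq)
  have "int P dvd int (q i0) * (int (u i0) * d0 + int (u i1) * d1)
      - int (u i0) * (int (q i0) * d0 + int (q i1) * d1)" using q u by (intro dvd_diff dvd_mult)
  also have "\<dots> = D * d1" by (simp add: D_def algebra_simps)
  finally have "x i1 = x' i1"
    unfolding d1_def using xx(1,2)
    by (intro prime_dvd_digit_diff[OF assms(1) D]) (auto simp only: grid_def mem_Collect_eq)
  with \<open>x i0 = x' i0\<close> off show "x = x'" by (metis ext insert_iff singletonD)
qed

text \<open>The injection of \<open>inj_on_one_residue\<close> goes between sets of equal size, hence every residue is taken equally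
often. This exact equidistribution is the reason to work modulo a prime.\<close>

lemma card_residue_window:
  fixes q :: "'m::finite \<Rightarrow> nat"
  assumes "prime P" "0 < q i0" "q i0 < P" "R \<le> P"
  shows "card {x \<in> grid P. dot q x mod P < R} = P ^ (CARD('m) - 1) * R"
proof -
  define f where "f = (\<lambda>x. (x(i0 := 0), dot q x mod P))"
  define Z where "Z = {x \<in> grid P. \<forall>i\<in>{i0}. x i = (0::nat)}"
  have P: "P > 0" using assms(1) prime_gt_0_nat by blast
  have inj: "inj_on f (grid P)" unfolding f_def by (intro inj_on_one_residue assms(1-3))
  have sub: "f ` grid P \<subseteq> Z \<times> {..<P}" using P by (auto simp: f_def Z_def grid_def)
  have finZ: "finite Z" unfolding Z_def by (rule finite_subset[OF _ finite_grid]) auto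
  have cZ: "card Z = P ^ (CARD('m) - 1)" unfolding Z_def using card_grid_zero[OF P, of "{i0}"] by simp
  have "card (f ` grid P) = P ^ CARD('m)" using inj by (simp add: card_image card_grid)
  also have "\<dots> = card (Z \<times> {..<P})" by (simp add: cZ card_cartesian_product flip: power_Suc2)
  finally have surj: "f ` grid P = Z \<times> {..<P}" using sub finZ by (intro card_subset_eq) auto
  have "f ` {x \<in> grid P. dot q x mod P < R} = Z \<times> {..<R}"
  proof
    show "f ` {x \<in> grid P. dot q x mod P < R} \<subseteq> Z \<times> {..<R}" using sub by (auto simp: f_def)
    show "Z \<times> {..<R} \<subseteq> f ` {x \<in> grid P. dot q x mod P < R}"
    proof
      fix p assume p: "p \<in> Z \<times> {..<R}"
      then have "p \<in> f ` grid P" using assms(4) unfolding surj by auto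
      then show "p \<in> f ` {x \<in> grid P. dot q x mod P < R}" using p by (auto simp: f_def)
    qed
  qed
  moreover have "inj_on f {x \<in> grid P. dot q x mod P < R}" using inj by (rule inj_on_subset) auto
  ultimately have "card {x \<in> grid P. dot q x mod P < R} = card (Z \<times> {..<R})"
    using card_image[of f "{x \<in> grid P. dot q x mod P < R}"] by simp
  then show ?thesis by (simp add: cZ card_cartesian_product)
qed

lemma nat_div_bounds:
  fixes n d :: nat
  assumes "d > 0"
  shows "n div d * d \<le> n" "n < n div d * d + d"
  using dividend_less_div_times[OF assms, of n] by (simp_all add: add.commute)

lemma card_cell_coordinate_le:
  assumes "N > 0" "P > 0"
  shows "card {k. N * k div P = y} \<le> P div N + 1" "finite {k. N * k div P = y}"
proof -
  have "int (y * P) \<le> int N * int k \<and> int N * int k < int (y * P) + int P" if "N * k div P = y" for k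
  proof -
    have "y * P \<le> N * k" "N * k < y * P + P" using that assms(2)
      using nat_div_bounds[of P "N * k"] by auto
    then show ?thesis by (simp flip: of_nat_mult of_nat_add)
  qed
  then show "card {k. N * k div P = y} \<le> P div N + 1" "finite {k. N * k div P = y}"
    using card_multiples_le[OF assms(1), of "{k. N * k div P = y}" "int (y * P)" P] by auto
qed

lemma card_cell_coordinate_ge:
  assumes "N > 0" "P > 0"
  shows "P div N \<le> card {k. N * k div P = y}"
proof -
  (* k0 is y * P / N rounded up. *)
  define k0 where "k0 = (y * P + N - 1) div N"
  have k0: "y * P \<le> N * k0" "N * k0 < y * P + N"
  proof -
    have "N * k0 \<le> y * P + N - 1" by (simp add: k0_def)
    then show "N * k0 < y * P + N" using assms(1) by linarith
    have "y * P + N - 1 < N * k0 + N" unfolding k0_def using assms(1)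
      by (metis dividend_less_times_div add.commute)
    then show "y * P \<le> N * k0" by linarith
  qed
  have "(\<lambda>j. k0 + j) ` {..<P div N} \<subseteq> {k. N * k div P = y}"
  proof clarify
    fix j assume "j < P div N"
    then have "N * (j + 1) \<le> N * (P div N)" by (intro mult_left_mono) auto
    also have "\<dots> \<le> P" by simp
    finally have "N * j + N \<le> P" by simp
    then have "y * P \<le> N * (k0 + j)" "N * (k0 + j) < y * P + P"
      using k0 by (auto simp: add_mult_distrib2 intro: trans_le_add1)
    then show "N * (k0 + j) div P = y"
      using assms(2) by (intro div_nat_eqI) (auto simp: mult.commute)
  qed
  then have "card ((\<lambda>j. k0 + j) ` {..<P div N}) \<le> card {k. N * k div P = y}"
    by (intro card_mono card_cell_coordinate_le assms)
  then show ?thesis by (simp add: card_image inj_on_def)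
qed

lemma PiE_cell: "{x. cell P N x = Y} = (\<Pi>\<^sub>E i\<in>UNIV. {k. N * k div P = Y i})"
  by (auto simp: cell_def fun_eq_iff PiE_UNIV_domain Pi_def)

lemma cell_in_grid:
  assumes "x \<in> grid P" "N > 0"
  shows "cell P N x \<in> grid N"
  unfolding grid_def mem_Collect_eq cell_def
proof
  fix i
  have "x i < P" using assms by (simp add: grid_def)
  then have "N * x i < N * P" using assms(2) by simp
  then show "N * x i div P < N" by (simp add: less_mult_imp_div_less mult.commute)
qed

lemma grid_of_cell:
  assumes "cell P N x \<in> grid N" "P > 0"
  shows "x \<in> grid P"
  unfolding grid_def mem_Collect_eq
proof
  fix i
  have "N * x i div P < N" using assms(1) by (auto simp: grid_def cell_def)
  then have "N * x i < N * P" using assms(2) by (simp add: div_less_iff_less_mult)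
  then show "x i < P" by simp
qed

lemma card_cell_ge:
  fixes Y :: "'m::finite \<Rightarrow> nat"
  assumes "N > 0" "P > 0" "Y \<in> grid N"
  shows "(P div N) ^ CARD('m) \<le> card {x \<in> grid P. cell P N x = Y}"
proof -
  have "(P div N) ^ CARD('m) = (\<Prod>i\<in>(UNIV::'m set). P div N)" by simp
  also have "\<dots> \<le> (\<Prod>i\<in>UNIV. card {k. N * k div P = Y i})"
    using card_cell_coordinate_ge[OF assms(1,2)] by (intro prod_mono) auto
  also have "\<dots> = card {x. cell P N x = Y}" by (simp add: PiE_cell card_PiE)
  also have "{x. cell P N x = Y} = {x \<in> grid P. cell P N x = Y}"
    using grid_of_cell[of P N] assms by auto
  finally show ?thesis .
qed

lemma cell_eq_dot_close:
  fixes q :: "'m::finite \<Rightarrow> nat"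
  assumes "cell P N x = cell P N x'" "P > 0" "\<And>i. q i \<le> B"
  shows "int N * \<bar>int (dot q x) - int (dot q x')\<bar> \<le> int (B * CARD('m) * P)"
proof -
  have coord: "int N * \<bar>int (x i) - int (x' i)\<bar> \<le> int P" for i
  proof -
    have e: "N * x i div P = N * x' i div P" using assms(1) by (simp add: cell_def fun_eq_iff)
    have 1: "N * x i div P * P \<le> N * x i" "N * x i < N * x i div P * P + P"
      using nat_div_bounds[OF assms(2)] by auto
    have 2: "N * x i div P * P \<le> N * x' i" "N * x' i < N * x i div P * P + P"
      unfolding e using nat_div_bounds[OF assms(2)] by auto
    define v where "v = N * x i div P * P"
    have "int (N * x i) - int (N * x' i) \<le> int P" "int (N * x' i) - int (N * x i) \<le> int P"
      using 1 2 unfolding v_def[symmetric] by linarith+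
    then have "\<bar>int N * int (x i) - int N * int (x' i)\<bar> \<le> int P" by (simp add: abs_le_iff)
    then show ?thesis by (simp add: abs_mult flip: right_diff_distrib)
  qed
  have "int N * \<bar>int (dot q x) - int (dot q x')\<bar>
      = int N * \<bar>\<Sum>i\<in>UNIV. int (q i) * (int (x i) - int (x' i))\<bar>"
    using dot_diff_eq[of UNIV x x' q] by simp
  also have "\<dots> \<le> int N * (\<Sum>i\<in>UNIV. \<bar>int (q i) * (int (x i) - int (x' i))\<bar>)"
    by (intro mult_left_mono sum_abs) auto
  also have "\<dots> = (\<Sum>i\<in>UNIV. int (q i) * (int N * \<bar>int (x i) - int (x' i)\<bar>))"
    by (simp add: sum_distrib_left abs_mult mult_ac)
  also have "\<dots> \<le> (\<Sum>i\<in>(UNIV::'m set). int B * int P)"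
    using assms(3) coord by (intro sum_mono mult_mono) auto
  finally show ?thesis by (simp add: mult_ac)
qed

text \<open>While \<open>k\<close> runs through a cell, \<open>a * k + \<alpha>\<close> passes at most \<open>a div N + 2\<close> multiples of \<open>P\<close>, and after each of
them it hits the window at most \<open>R div a + 1\<close> times.\<close>

lemma card_fibre_le:
  fixes a \<alpha> :: nat
  assumes "N > 0" "P > 0" "a > 0"
  shows "card {k. N * k div P = y \<and> (a * k + \<alpha>) mod P < R} \<le> (a div N + 2) * (R div a + 1)"
proof -
  define S where "S = {k. N * k div P = y \<and> (a * k + \<alpha>) mod P < R}"
  define K where "K = (\<lambda>k. (a * k + \<alpha>) div P) ` S"
  (* K collects the multiples of P that precede the hits. *)
  have finS: "finite S"
    unfolding S_def by (rule finite_subset[OF _ card_cell_coordinate_le(2)[OF assms(1,2), of y]]) auto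
  have cardK: "card K \<le> a div N + 2"
  proof -
    have "card K \<le> (a * P + N * P) div (N * P) + 1"
    proof (rule card_multiples_le(1)[where lo = "int (a * y * P + N * \<alpha>) - int (N * P)"])
      fix \<kappa> assume "\<kappa> \<in> K"
      then obtain k where k: "\<kappa> = (a * k + \<alpha>) div P" "N * k div P = y" by (auto simp: K_def S_def)
      have 1: "\<kappa> * P \<le> a * k + \<alpha>" "a * k + \<alpha> < \<kappa> * P + P"
        unfolding k(1) using nat_div_bounds[OF assms(2)] by auto
      have 2: "y * P \<le> N * k" "N * k < y * P + P"
        unfolding k(2)[symmetric] using nat_div_bounds[OF assms(2)] by auto
      have "N * P * \<kappa> \<le> N * (a * k) + N * \<alpha>" "N * (a * k) + N * \<alpha> < N * P * \<kappa> + N * P"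
        using mult_left_mono[OF 1(1), of N] mult_strict_left_mono[OF 1(2) assms(1)]
        by (simp_all only: algebra_simps)
      moreover have "a * y * P \<le> N * (a * k)" "N * (a * k) < a * y * P + a * P"
        using mult_left_mono[OF 2(1), of a] mult_strict_left_mono[OF 2(2) assms(3)]
        by (simp_all only: algebra_simps)
      ultimately have "a * y * P + N * \<alpha> < N * P * \<kappa> + N * P"
        "N * P * \<kappa> < a * y * P + N * \<alpha> + a * P" by linarith+
      then have "int (a * y * P + N * \<alpha>) < int (N * P) * int \<kappa> + int (N * P)"
        "int (N * P) * int \<kappa> < int (a * y * P + N * \<alpha>) + int (a * P)"
        by (simp_all flip: of_nat_mult of_nat_add)
      then show "int (a * y * P + N * \<alpha>) - int (N * P) \<le> int (N * P) * int \<kappa> \<and>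
        int (N * P) * int \<kappa> < int (a * y * P + N * \<alpha>) - int (N * P) + int (a * P + N * P)" by simp
    qed (use assms in simp)
    also have "(a * P + N * P) div (N * P) = a div N + 1"
    proof -
      have "(a * P + N * P) div (N * P) = ((a + N) * P) div (N * P)" by (simp add: algebra_simps)
      also have "\<dots> = (a + N) div N" using assms(2) by simp
      finally show ?thesis using assms(1) by simp
    qed
    finally show ?thesis by simp
  qed
  have cardF: "card {k \<in> S. (a * k + \<alpha>) div P = \<kappa>} \<le> R div a + 1" for \<kappa>
  proof (rule card_multiples_le(1)[OF assms(3), where lo = "int (\<kappa> * P) - int \<alpha>"])
    fix k assume "k \<in> {k \<in> S. (a * k + \<alpha>) div P = \<kappa>}"
    then have "(a * k + \<alpha>) div P = \<kappa>" "(a * k + \<alpha>) mod P < R" by (auto simp: S_def)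
    then have "a * k + \<alpha> \<ge> \<kappa> * P" "a * k + \<alpha> < \<kappa> * P + R"
      using div_mult_mod_eq[of "a * k + \<alpha>" P] by auto
    then have "int (\<kappa> * P) \<le> int (a * k + \<alpha>)" "int (a * k + \<alpha>) < int (\<kappa> * P) + int R"
      by (simp_all only: of_nat_le_iff of_nat_less_iff flip: of_nat_add)
    then show "int (\<kappa> * P) - int \<alpha> \<le> int a * int k \<and> int a * int k < int (\<kappa> * P) - int \<alpha> + int R"
      by simp
  qed
  have "card S = card (\<Union>\<kappa>\<in>K. {k \<in> S. (a * k + \<alpha>) div P = \<kappa>})"
    by (rule arg_cong[where f = card]) (auto simp: K_def)
  also have "\<dots> \<le> (\<Sum>\<kappa>\<in>K. card {k \<in> S. (a * k + \<alpha>) div P = \<kappa>})"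
    using finS by (intro card_UN_le) (simp add: K_def)
  also have "\<dots> \<le> card K * (R div a + 1)"
    using sum_bounded_above[of K, OF cardF] by simp
  also have "\<dots> \<le> (a div N + 2) * (R div a + 1)" using cardK by (intro mult_right_mono) auto
  finally show ?thesis by (simp add: S_def)
qed

text \<open>The entries other than \<open>x i0\<close> are free, with \<open>P div N + 1\<close> choices each; the entry \<open>x i0\<close> is treated by
\<open>card_fibre_le\<close>.\<close>

lemma card_hits_in_cell_le:
  fixes q :: "'m::finite \<Rightarrow> nat"
  assumes "N > 0" "P > 0" "q i0 > 0"
  shows "card {x \<in> grid P. cell P N x = Y \<and> dot q x mod P < R}
    \<le> (P div N + 1) ^ (CARD('m) - 1) * ((q i0 div N + 2) * (R div q i0 + 1))"
proof -
  define S where "S = {x \<in> grid P. cell P N x = Y \<and> dot q x mod P < R}"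
  define W where "W = (\<Pi>\<^sub>E i\<in>UNIV. if i = i0 then {0} else {k. N * k div P = Y i})"
  have finS: "finite S" unfolding S_def by (rule finite_subset[OF _ finite_grid]) auto
  have finW: "finite W" unfolding W_def
    using card_cell_coordinate_le(2)[OF assms(1,2)] by (intro finite_PiE) auto
  have cardW: "card W \<le> (P div N + 1) ^ (CARD('m) - 1)"
  proof -
    have "card W = (\<Prod>i\<in>UNIV. card (if i = i0 then {0} else {k. N * k div P = Y i}))"
      by (simp add: W_def card_PiE)
    also have "\<dots> = (\<Prod>i\<in>UNIV - {i0}. card {k. N * k div P = Y i})"
      by (subst prod.remove[of _ i0]) (auto intro!: prod.cong)
    also have "\<dots> \<le> (\<Prod>i\<in>UNIV - {i0}. P div N + 1)"
      using card_cell_coordinate_le(1)[OF assms(1,2)] by (intro prod_mono) auto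
    finally show ?thesis by simp
  qed
  have img: "x(i0 := 0) \<in> W" if "x \<in> S" for x
    using that by (auto simp: W_def S_def cell_def PiE_UNIV_domain Pi_def)
  have fib: "card {x \<in> S. x(i0 := 0) = w} \<le> (q i0 div N + 2) * (R div q i0 + 1)" for w
  proof -
    define \<alpha> where "\<alpha> = (\<Sum>i\<in>UNIV - {i0}. q i * w i)"
    have "card {x \<in> S. x(i0 := 0) = w} = card ((\<lambda>x. x i0) ` {x \<in> S. x(i0 := 0) = w})"
    proof (rule card_image[symmetric], rule inj_onI)
      fix x x' assume "x \<in> {x \<in> S. x(i0 := 0) = w}" "x' \<in> {x \<in> S. x(i0 := 0) = w}" "x i0 = x' i0"
      then show "x = x'" by (metis (mono_tags, lifting) fun_upd_triv fun_upd_upd mem_Collect_eq)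
    qed
    also have "\<dots> \<le> card {k. N * k div P = Y i0 \<and> (q i0 * k + \<alpha>) mod P < R}"
    proof (intro card_mono)
      show "finite {k. N * k div P = Y i0 \<and> (q i0 * k + \<alpha>) mod P < R}"
        by (rule finite_subset[OF _ card_cell_coordinate_le(2)[OF assms(1,2), of "Y i0"]]) auto
      show "(\<lambda>x. x i0) ` {x \<in> S. x(i0 := 0) = w} \<subseteq> {k. N * k div P = Y i0 \<and> (q i0 * k + \<alpha>) mod P < R}"
      proof clarify
        fix x assume x: "x \<in> S" "w = x(i0 := 0)"
        have "dot q x = q i0 * x i0 + \<alpha>"
          unfolding dot_def \<alpha>_def x(2) by (subst sum.remove[of _ i0]) (auto intro!: sum.cong)
        then show "N * x i0 div P = Y i0 \<and> (q i0 * x i0 + \<alpha>) mod P < R"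
          using x by (auto simp: S_def cell_def)
      qed
    qed
    also have "\<dots> \<le> (q i0 div N + 2) * (R div q i0 + 1)" by (rule card_fibre_le[OF assms])
    finally show ?thesis .
  qed
  have "card S = card (\<Union>w\<in>W. {x \<in> S. x(i0 := 0) = w})"
    using img by (intro arg_cong[where f = card]) auto
  also have "\<dots> \<le> (\<Sum>w\<in>W. card {x \<in> S. x(i0 := 0) = w})" by (rule card_UN_le[OF finW])
  also have "\<dots> \<le> card W * ((q i0 div N + 2) * (R div q i0 + 1))"
    using sum_bounded_above[of W, OF fib] by simp
  also have "\<dots> \<le> (P div N + 1) ^ (CARD('m) - 1) * ((q i0 div N + 2) * (R div q i0 + 1))"
    using cardW by (intro mult_right_mono) auto
  finally show ?thesis by (simp add: S_def)
qed

text \<open>The residue of \<open>v\<close> modulo \<open>P\<close> lies in the window \<open>J\<close>, which may contain negative integers.\<close>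

definition near :: "nat \<Rightarrow> int set \<Rightarrow> nat \<Rightarrow> bool" where
  "near P J v \<longleftrightarrow> (\<exists>c\<in>J. int P dvd int v - c)"

lemma near_mod: "near P J v \<Longrightarrow> P > 0 \<Longrightarrow> v mod P \<in> (\<lambda>c. nat (c mod int P)) ` J"
proof -
  assume "near P J v" "P > 0"
  then obtain c where c: "c \<in> J" "int v mod int P = c mod int P"
    by (auto simp: near_def mod_eq_dvd_iff)
  then have "v mod P = nat (c mod int P)" by (metis nat_int zmod_int)
  then show ?thesis using c(1) by blast
qed

lemma card_two_windows_independent:
  fixes q u :: "'m::finite \<Rightarrow> nat"
  assumes "prime P" "i0 \<noteq> i1"
    and det: "int (q i0) * int (u i1) - int (q i1) * int (u i0) \<noteq> 0"
      "\<bar>int (q i0) * int (u i1) - int (q i1) * int (u i0)\<bar> < int P"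
    and J: "finite J"
  shows "card {x \<in> grid P. near P J (dot q x) \<and> near P J (dot u x)}
    \<le> P ^ (CARD('m) - 2) * (card J)\<^sup>2"
proof -
  have P: "P > 0" using assms(1) prime_gt_0_nat by blast
  define f where "f = (\<lambda>x. (x(i0 := 0, i1 := 0), dot q x mod P, dot u x mod P))"
  define S where "S = {x \<in> grid P. near P J (dot q x) \<and> near P J (dot u x)}"
  define Z where "Z = {x \<in> grid P. \<forall>i\<in>{i0, i1}. x i = (0::nat)}"
  define J' where "J' = (\<lambda>c. nat (c mod int P)) ` J"
  have finZ: "finite Z" unfolding Z_def by (rule finite_subset[OF _ finite_grid]) auto
  have "inj_on f S"
    unfolding f_def S_def by (rule inj_on_subset[OF inj_on_two_residues[of P i0 i1 q u]]) (use assms in auto)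
  then have "card S = card (f ` S)" by (simp add: card_image)
  also have "\<dots> \<le> card (Z \<times> J' \<times> J')"
  proof (intro card_mono)
    show "finite (Z \<times> J' \<times> J')" using finZ J by (simp add: J'_def)
    show "f ` S \<subseteq> Z \<times> J' \<times> J'"
      using P near_mod[of P J] by (auto simp: f_def S_def Z_def J'_def grid_def)
  qed
  also have "\<dots> = card Z * (card J')\<^sup>2" by (simp add: card_cartesian_product power2_eq_square)
  also have "\<dots> \<le> P ^ (CARD('m) - 2) * (card J)\<^sup>2"
    unfolding Z_def card_grid_zero[OF P] J'_def using assms(2) J
    by (intro mult_mono power_mono card_image_le) (auto simp: numeral_2_eq_2)
  finally show ?thesis by (simp add: S_def)
qed

text \<open>If \<open>a u = b q\<close>, where \<open>a\<close> and \<open>b\<close> are the entries at \<open>i0\<close>, then residues \<open>c\<close> of \<open>q x\<close> and \<open>c'\<close> of \<open>u x\<close> satisfy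
\<open>a c' = b c\<close> modulo \<open>P\<close>; so only the residues \<open>c\<close> with such a partner have to be counted.\<close>

lemma card_two_windows_parallel:
  fixes q u :: "'m::finite \<Rightarrow> nat"
  assumes "prime P" "0 < q i0" "q i0 < P" and J: "finite J"
    and par: "\<And>i. q i0 * u i = u i0 * q i"
  shows "card {x \<in> grid P. near P J (dot q x) \<and> near P J (dot u x)}
    \<le> P ^ (CARD('m) - 1) * card {c \<in> J. \<exists>c'\<in>J. int P dvd int (q i0) * c' - int (u i0) * c}"
proof -
  have P: "P > 0" using assms(1) prime_gt_0_nat by blast
  define f where "f = (\<lambda>x. (x(i0 := 0), dot q x mod P))"
  define S where "S = {x \<in> grid P. near P J (dot q x) \<and> near P J (dot u x)}"
  define Z where "Z = {x \<in> grid P. \<forall>i\<in>{i0}. x i = (0::nat)}"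
  define C where "C = {c \<in> J. \<exists>c'\<in>J. int P dvd int (q i0) * c' - int (u i0) * c}"
  define C' where "C' = (\<lambda>c. nat (c mod int P)) ` C"
  have finZ: "finite Z" unfolding Z_def by (rule finite_subset[OF _ finite_grid]) auto
  have finC: "finite C" using J by (simp add: C_def)
  have "inj_on f S"
    unfolding f_def S_def by (rule inj_on_subset[OF inj_on_one_residue[of P q i0]]) (use assms in auto)
  then have "card S = card (f ` S)" by (simp add: card_image)
  also have "\<dots> \<le> card (Z \<times> C')"
  proof (intro card_mono)
    show "finite (Z \<times> C')" using finZ finC by (simp add: C'_def)
    have "dot q x mod P \<in> C'" if x: "x \<in> S" for x
    proof -
      obtain c c' where c: "c \<in> J" "int P dvd int (dot q x) - c" and c': "c' \<in> J" "int P dvd int (dot u x) - c'"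
        using x unfolding S_def near_def by blast
      have e: "q i0 * dot u x = u i0 * dot q x"
        unfolding dot_def sum_distrib_left mult.assoc[symmetric] par ..
      have "int P dvd int (u i0) * (int (dot q x) - c) - int (q i0) * (int (dot u x) - c')"
        using c(2) c'(2) by (intro dvd_diff[OF dvd_mult dvd_mult])
      also have "\<dots> = int (u i0 * dot q x) - int (q i0 * dot u x) + (int (q i0) * c' - int (u i0) * c)"
        by (simp add: algebra_simps)
      finally have "int P dvd int (q i0) * c' - int (u i0) * c" unfolding e by simp
      then have "c \<in> C" using c c' by (auto simp: C_def)
      then have "near P C (dot q x)" using c by (auto simp: near_def)
      then show ?thesis using near_mod[OF _ P] by (simp add: C'_def)
    qed
    then show "f ` S \<subseteq> Z \<times> C'"
      using P by (auto simp: f_def S_def Z_def grid_def)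
  qed
  also have "\<dots> = card Z * card C'" by (simp add: card_cartesian_product)
  also have "\<dots> \<le> P ^ (CARD('m) - 1) * card C"
    unfolding Z_def card_grid_zero[OF P] C'_def using finC
    by (intro mult_mono card_image_le) auto
  finally show ?thesis by (simp add: S_def C_def)
qed

text \<open>After dividing by the greatest common divisor, \<open>a1 c' - b1 c = P k\<close>. The size of the left-hand side leaves few
values of \<open>k\<close>, and for fixed \<open>k\<close> the solutions \<open>c\<close> agree modulo \<open>a1\<close>.\<close>

lemma card_proportional_residues:
  fixes a b :: nat
  assumes P: "prime P" and ab: "0 < a" "a < P" "0 < b"
  defines "g \<equiv> gcd a b"
  shows "card {c \<in> {lo..<lo + int R}. \<exists>c'\<in>{lo..<lo + int R}. int P dvd int a * c' - int b * c}
    \<le> ((a div g + b div g) * R div P + 1) * (R div (a div g) + 1)"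
proof -
  define a1 b1 where "a1 = a div g" and "b1 = b div g"
  have g: "g > 0" using ab by (simp add: g_def)
  have a: "a = g * a1" and b: "b = g * b1" by (simp_all add: a1_def b1_def g_def)
  have pos: "a1 > 0" "b1 > 0" using ab unfolding a b by auto
  have cop: "coprime a1 b1"
    using ab unfolding a1_def b1_def g_def by (intro div_gcd_coprime) auto
  have "\<not> P dvd g" using ab g by (metis a dvd_mult2 nat_dvd_not_less)
  define J where "J = {lo..<lo + int R}"
  define S where "S = {c \<in> J. \<exists>c'\<in>J. int P dvd int a * c' - int b * c}"
  define K where "K = {k. \<exists>c\<in>J. \<exists>c'\<in>J. int P * k = int a1 * c' - int b1 * c}"
  define F where "F k = {c \<in> J. \<exists>c'. int P * k = int a1 * c' - int b1 * c}" for k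
  have P0: "P > 0" using P prime_gt_0_nat by blast
  have rng: "int P * k \<in> {int a1 * lo - int b1 * (lo + int R) ..<
     (int a1 * lo - int b1 * (lo + int R)) + int ((a1 + b1) * R)}" if "k \<in> K" for k
  proof -
    from that obtain c c' where c: "c \<in> J" "c' \<in> J" "int P * k = int a1 * c' - int b1 * c"
      by (auto simp: K_def)
    have "int a1 * lo \<le> int a1 * c'" "int a1 * c' < int a1 * (lo + int R)"
      "int b1 * lo \<le> int b1 * c" "int b1 * c < int b1 * (lo + int R)"
      using c(1,2) pos by (auto simp: J_def)
    then show ?thesis unfolding c(3) by (simp add: algebra_simps)
  qed
  define K' where "K' = (\<lambda>k. int P * k) ` K"
  have inj: "inj_on (\<lambda>k. int P * k) K" using P0 by (auto simp: inj_on_def)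
  have K'sub: "K' \<subseteq> {int a1 * lo - int b1 * (lo + int R) ..<
     (int a1 * lo - int b1 * (lo + int R)) + int ((a1 + b1) * R)}" using rng by (auto simp: K'_def)
  then have "card K' \<le> (a1 + b1) * R div P + 1"
    by (rule card_spaced_le[OF P0]) (auto simp: K'_def simp flip: right_diff_distrib)
  then have cardK: "card K \<le> (a1 + b1) * R div P + 1" using inj by (simp add: K'_def card_image)
  have "finite K'" using K'sub finite_subset by blast
  then have finK: "finite K" using inj by (simp add: K'_def finite_image_iff)
  have cardF: "card (F k) \<le> R div a1 + 1" for k
  proof (rule card_spaced_le[OF pos(1), of _ lo])
    show "F k \<subseteq> {lo..<lo + int R}" by (auto simp: F_def J_def)
    fix c d assume "c \<in> F k" "d \<in> F k"
    then obtain c' d' where "int P * k = int a1 * c' - int b1 * c" "int P * k = int a1 * d' - int b1 * d"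
      by (auto simp: F_def)
    then have "int b1 * (c - d) = int a1 * (c' - d')" by (simp add: algebra_simps)
    then have "int a1 dvd int b1 * (c - d)" by simp
    moreover have "coprime (int a1) (int b1)" using cop by simp
    ultimately show "int a1 dvd c - d" by (simp add: coprime_dvd_mult_right_iff)
  qed
  have "S \<subseteq> (\<Union>k\<in>K. F k)"
  proof
    fix c assume "c \<in> S"
    then obtain c' where c: "c \<in> J" "c' \<in> J" "int P dvd int a * c' - int b * c" by (auto simp: S_def)
    have "int a * c' - int b * c = int g * (int a1 * c' - int b1 * c)"
      unfolding a b by (simp add: algebra_simps)
    moreover have "prime (int P)" using P by simp
    ultimately have "int P dvd int a1 * c' - int b1 * c"
      using c(3) \<open>\<not> P dvd g\<close> by (simp add: prime_dvd_mult_iff)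
    then obtain k where "int a1 * c' - int b1 * c = int P * k" by (auto elim: dvdE)
    then have "k \<in> K" "c \<in> F k"
      using c unfolding K_def F_def mem_Collect_eq
      by - (intro bexI[of _ c] bexI[of _ c'], simp_all, intro exI[of _ c'], simp)
    then show "c \<in> (\<Union>k\<in>K. F k)" by blast
  qed
  moreover have "finite (F k)" for k by (rule finite_subset[of _ J]) (auto simp: F_def J_def)
  ultimately have "card S \<le> card (\<Union>k\<in>K. F k)" using finK by (intro card_mono finite_UN_I) auto
  also have "\<dots> \<le> (\<Sum>k\<in>K. card (F k))" by (rule card_UN_le[OF finK])
  also have "\<dots> \<le> card K * (R div a1 + 1)" using sum_bounded_above[of K, OF cardF] by simp
  also have "\<dots> \<le> ((a1 + b1) * R div P + 1) * (R div a1 + 1)"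
    using cardK by (intro mult_right_mono) auto
  finally show ?thesis unfolding S_def J_def a1_def b1_def .
qed

section \<open>Correlation of two linear forms\<close>

text \<open>Up to normalisation this is the correlation, at scale \<open>1 / N\<close>, of the uniform distributions on the two sets of
points where \<open>q\<close>, respectively \<open>u\<close>, takes a value in the window.\<close>

definition joint_hits :: "nat \<Rightarrow> nat \<Rightarrow> nat \<Rightarrow> ('m::finite \<Rightarrow> nat) \<Rightarrow> ('m \<Rightarrow> nat) \<Rightarrow> nat" where
  "joint_hits P N R q u = card {(x, x') \<in> grid P \<times> grid P.
      cell P N x = cell P N x' \<and> dot q x mod P < R \<and> dot u x' mod P < R}"

definition hit_cells :: "nat \<Rightarrow> nat \<Rightarrow> nat \<Rightarrow> ('m::finite \<Rightarrow> nat) \<Rightarrow> ('m \<Rightarrow> nat) set" where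
  "hit_cells P N R q = {Y. \<exists>x\<in>grid P. cell P N x = Y \<and> dot q x mod P < R}"

lemma hit_cells_subset: "N > 0 \<Longrightarrow> hit_cells P N R q \<subseteq> grid N"
  by (auto simp: hit_cells_def cell_in_grid)

text \<open>Only cells in which both forms hit the window contribute.\<close>

lemma joint_hits_le_cells:
  fixes q u :: "'m::finite \<Rightarrow> nat"
  assumes "N > 0"
    and "\<And>Y. card {x \<in> grid P. cell P N x = Y \<and> dot q x mod P < R} \<le> Mq"
    and "\<And>Y. card {x \<in> grid P. cell P N x = Y \<and> dot u x mod P < R} \<le> Mu"
  shows "joint_hits P N R q u \<le> card (hit_cells P N R q \<inter> hit_cells P N R u) * (Mq * Mu)"
proof -
  define A where "A v Y = {x \<in> grid P. cell P N x = Y \<and> dot v x mod P < R}" for v :: "'m \<Rightarrow> nat" and Y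
  define H where "H = hit_cells P N R q \<inter> hit_cells P N R u"
  have finH: "finite H"
    unfolding H_def by (rule finite_subset[OF _ finite_grid]) (use hit_cells_subset[OF assms(1)] in blast)
  have finA: "finite (A v Y)" for v Y unfolding A_def by (rule finite_subset[OF _ finite_grid]) auto
  have "joint_hits P N R q u \<le> card (\<Union>Y\<in>H. A q Y \<times> A u Y)"
    unfolding joint_hits_def using finH finA
    by (intro card_mono finite_UN_I finite_cartesian_product) (auto simp: H_def A_def hit_cells_def)
  also have "\<dots> \<le> (\<Sum>Y\<in>H. card (A q Y \<times> A u Y))" by (rule card_UN_le[OF finH])
  also have "\<dots> \<le> (\<Sum>Y\<in>H. Mq * Mu)"
    unfolding card_cartesian_product A_def using assms(2,3) by (intro sum_mono mult_mono) auto
  finally show ?thesis by (simp add: H_def)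
qed

text \<open>If a form hits the window somewhere in a cell, then at every point of the cell its value is in a slightly
larger window, since within a cell it varies by at most \<open>D\<close>.\<close>

lemma hit_cell_near:
  fixes q :: "'m::finite \<Rightarrow> nat"
  assumes "N > 0" "P > 0" "\<And>i. q i \<le> B" "cell P N x \<in> hit_cells P N R q"
  defines "D \<equiv> B * CARD('m) * P div N"
  shows "near P {- int D..<- int D + int (R + 2 * D)} (dot q x)"
proof -
  obtain x' where x': "cell P N x' = cell P N x" "dot q x' mod P < R"
    using assms(4) by (auto simp: hit_cells_def)
  define \<delta> where "\<delta> = int (dot q x) - int (dot q x')"
  have "int N * \<bar>\<delta>\<bar> \<le> int (B * CARD('m) * P)"
    unfolding \<delta>_def using cell_eq_dot_close[of P N x x' q B] x' assms by simp
  then have "(int N * \<bar>\<delta>\<bar>) div int N \<le> int (B * CARD('m) * P) div int N"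
    using assms(1) by (intro zdiv_mono1) auto
  then have "\<bar>\<delta>\<bar> \<le> int (B * CARD('m) * P) div int N" using assms(1) by simp
  then have \<delta>: "\<bar>\<delta>\<bar> \<le> int D" by (simp add: D_def zdiv_int)
  define c where "c = int (dot q x' mod P) + \<delta>"
  have "c \<in> {- int D..<- int D + int (R + 2 * D)}" using \<delta> x'(2) by (auto simp: c_def)
  moreover have "int (dot q x) - c = int (dot q x') - int (dot q x' mod P)" by (simp add: c_def \<delta>_def)
  then have "int P dvd int (dot q x) - c" by (simp add: zmod_int dvd_minus_mod)
  ultimately show ?thesis by (auto simp: near_def)
qed

text \<open>Every cell contains at least \<open>(P div N)^m\<close> grid points, which reduces counting cells to counting points, where
equidistribution modulo \<open>P\<close> is available.\<close>

lemma card_hit_cells_le: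
  fixes q u :: "'m::finite \<Rightarrow> nat" and R :: nat
  assumes "N > 0" "P > 0" "\<And>i. q i \<le> B" "\<And>i. u i \<le> B"
  defines "D \<equiv> B * CARD('m) * P div N"
  defines "J \<equiv> {- int D..<- int D + int (R + 2 * D)}"
  shows "card (hit_cells P N R q \<inter> hit_cells P N R u) * (P div N) ^ CARD('m)
    \<le> card {x \<in> grid P. near P J (dot q x) \<and> near P J (dot u x)}"
proof -
  define H where "H = hit_cells P N R q \<inter> hit_cells P N R u"
  have Hsub: "H \<subseteq> grid N" unfolding H_def using hit_cells_subset[OF assms(1)] by blast
  have finH: "finite H" by (rule finite_subset[OF Hsub]) simp
  have "card H * (P div N) ^ CARD('m) = (\<Sum>Y\<in>H. (P div N) ^ CARD('m))" by simp
  also have "\<dots> \<le> (\<Sum>Y\<in>H. card {x \<in> grid P. cell P N x = Y})"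
    using Hsub by (intro sum_mono card_cell_ge assms(1,2)) auto
  also have "\<dots> = card (\<Union>Y\<in>H. {x \<in> grid P. cell P N x = Y})"
    by (subst card_UN_disjoint[OF finH]) (auto intro: finite_subset[OF _ finite_grid])
  also have "\<dots> \<le> card {x \<in> grid P. near P J (dot q x) \<and> near P J (dot u x)}"
  proof (intro card_mono)
    show "finite {x \<in> grid P. near P J (dot q x) \<and> near P J (dot u x)}"
      by (rule finite_subset[OF _ finite_grid]) auto
    show "(\<Union>Y\<in>H. {x \<in> grid P. cell P N x = Y}) \<subseteq> {x \<in> grid P. near P J (dot q x) \<and> near P J (dot u x)}"
      using hit_cell_near[OF assms(1,2), of q B _ R] hit_cell_near[OF assms(1,2), of u B _ R] assms(3,4)
      unfolding J_def D_def H_def by blast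
  qed
  finally show ?thesis by (simp add: H_def)
qed

definition parallel :: "'m \<Rightarrow> ('m \<Rightarrow> nat) \<Rightarrow> ('m \<Rightarrow> nat) \<Rightarrow> bool" where
  "parallel i0 q u \<longleftrightarrow> (\<forall>i. q i0 * u i = u i0 * q i)"

lemma real_div_le: "real (a div b) \<le> real a / real b"
  by (rule of_nat_div_le_of_nat)

lemma card_hits_in_cell_real:
  fixes q :: "'m::finite \<Rightarrow> nat"
  assumes "0 < N" "N \<le> P" "0 < Q" "Q \<le> q i0" "q i0 < 2 * Q" "Q \<le> R"
  shows "real (card {x \<in> grid P. cell P N x = Y \<and> dot q x mod P < R})
    \<le> real P ^ (CARD('m) - 1) * real R * ((2 / real N) ^ (CARD('m) - 1) * (4 * (1 / real N + 1 / real Q)))"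
proof -
  let ?m = "CARD('m) - 1"
  have "real (card {x \<in> grid P. cell P N x = Y \<and> dot q x mod P < R})
      \<le> real ((P div N + 1) ^ ?m * ((q i0 div N + 2) * (R div q i0 + 1)))"
    using card_hits_in_cell_le[of N P q i0 Y R] assms by (intro of_nat_mono) auto
  also have "\<dots> = (real (P div N) + 1) ^ ?m * ((real (q i0 div N) + 2) * (real (R div q i0) + 1))"
    by (simp only: of_nat_mult of_nat_add of_nat_power of_nat_numeral of_nat_1)
  also have "\<dots> \<le> (2 * real P / real N) ^ ?m * ((2 * real Q / real N + 2) * (2 * real R / real Q))"
  proof (intro mult_mono power_mono)
    have "1 \<le> real P / real N" using assms by simp
    then show "real (P div N) + 1 \<le> 2 * real P / real N" using real_div_le[of P N] by simp
    have "real (q i0) / real N \<le> 2 * real Q / real N" using assms by (intro divide_right_mono) auto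
    then show "real (q i0 div N) + 2 \<le> 2 * real Q / real N + 2" using real_div_le[of "q i0" N] by simp
    have "real R / real (q i0) \<le> real R / real Q" using assms by (intro divide_left_mono) auto
    moreover have "1 \<le> real R / real Q" using assms by simp
    ultimately show "real (R div q i0) + 1 \<le> 2 * real R / real Q" using real_div_le[of R "q i0"] by simp
  qed auto
  also have "\<dots> = real P ^ ?m * real R * ((2 / real N) ^ ?m * (4 * (1 / real N + 1 / real Q)))"
    using assms by (simp add: power_mult_distrib power_divide field_simps)
  finally show ?thesis .
qed

text \<open>Here \<open>\<rho>\<close> is the relative length of the window. Nonparallel forms give the independent value \<open>\<rho>^2\<close>, up to a
constant. Parallel forms may have the larger value \<open>\<rho> g / Q\<close>, which is \<open>\<rho>\<close> itself when the forms coincide.\<close>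

lemma card_window_pairs_real:
  fixes q u :: "'m::finite \<Rightarrow> nat"
  assumes P: "prime P" "4 * Q * Q \<le> P" and Q: "0 < Q" "2 * Q \<le> R"
    and q: "Q \<le> q i0" "q i0 < 2 * Q" "\<And>i. q i < 2 * Q"
    and u: "Q \<le> u i0" "u i0 < 2 * Q" "\<And>i. u i < 2 * Q"
    and \<rho>: "real R / real P \<le> \<rho>"
  shows "real (card {x \<in> grid P. near P {lo..<lo + int R} (dot q x) \<and> near P {lo..<lo + int R} (dot u x)})
    \<le> real P ^ CARD('m) * (8 * \<rho>\<^sup>2
        + (if parallel i0 q u then 2 * \<rho> * real (gcd (q i0) (u i0)) / real Q else 0))"
proof -
  define J where "J = {lo..<lo + int R}"
  have cardJ: "card J = R" by (simp add: J_def)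
  have P0: "real P > 0" using P prime_gt_0_nat by auto
  have \<rho>0: "\<rho> \<ge> 0" using \<rho> by (meson divide_nonneg_nonneg of_nat_0_le_iff order_trans)
  have "2 * Q < 4 * Q * Q" using Q by simp
  then have qP: "q i0 < P" using q P by linarith
  define X where "X = card {x \<in> grid P. near P J (dot q x) \<and> near P J (dot u x)}"
  show ?thesis
  proof (cases "parallel i0 q u")
    case False
    then obtain i1 where i1: "q i0 * u i1 \<noteq> u i0 * q i1" by (auto simp: parallel_def)
    then have "i0 \<noteq> i1" by auto
    have b: "q i0 * u i1 < P" "q i1 * u i0 < P"
    proof -
      define B where "B = 2 * Q"
      have B: "q i0 < B" "u i1 < B" "q i1 < B" "u i0 < B" "0 < B" using q u Q by (simp_all add: B_def)
      have "q i0 * u i1 < B * B" "q i1 * u i0 < B * B"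
        using B by (intro mult_strict_mono; simp)+
      then show "q i0 * u i1 < P" "q i1 * u i0 < P" using P(2) by (simp_all add: B_def)
    qed
    have "X \<le> P ^ (CARD('m) - 2) * (card J)\<^sup>2"
      unfolding X_def
    proof (rule card_two_windows_independent[OF P(1) \<open>i0 \<noteq> i1\<close>])
      have "int (q i0 * u i1) \<noteq> int (q i1 * u i0)"
        using i1 by (simp only: of_nat_eq_iff) (simp add: mult.commute)
      then show "int (q i0) * int (u i1) - int (q i1) * int (u i0) \<noteq> 0" by simp
      have "\<bar>int (q i0 * u i1) - int (q i1 * u i0)\<bar> < int P" using b by linarith
      then show "\<bar>int (q i0) * int (u i1) - int (q i1) * int (u i0)\<bar> < int P" by simp
    qed (simp add: J_def)
    then have "real X \<le> real (P ^ (CARD('m) - 2) * R\<^sup>2)" unfolding cardJ by (rule of_nat_mono)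
    also have "\<dots> = real P ^ (CARD('m) - 2) * (real P)\<^sup>2 * (real R / real P)\<^sup>2"
      using P0 by (simp add: power_divide)
    also have "\<dots> = real P ^ CARD('m) * (real R / real P)\<^sup>2"
    proof -
      have "card {i0, i1} \<le> CARD('m)" by (intro card_mono) auto
      then have "CARD('m) - 2 + 2 = CARD('m)" using \<open>i0 \<noteq> i1\<close> by simp
      then show ?thesis by (metis power_add)
    qed
    also have "\<dots> \<le> real P ^ CARD('m) * (8 * \<rho>\<^sup>2)"
    proof (intro mult_left_mono)
      have "(real R / real P)\<^sup>2 \<le> \<rho>\<^sup>2" using \<rho> by (intro power_mono) auto
      then show "(real R / real P)\<^sup>2 \<le> 8 * \<rho>\<^sup>2" by (smt (verit) zero_le_power2)
    qed simp
    finally show ?thesis using False by (simp add: X_def J_def)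
  next
    case True
    define g where "g = gcd (q i0) (u i0)"
    define a where "a = q i0 div g"
    define b where "b = u i0 div g"
    have g: "g > 0" using q Q by (simp add: g_def)
    have qa: "q i0 = g * a" and ub: "u i0 = g * b" by (simp_all add: a_def b_def g_def)
    have a0: "a > 0" using q Q qa by (cases a) auto
    have "X \<le> P ^ (CARD('m) - 1) * card {c \<in> J. \<exists>c'\<in>J. int P dvd int (q i0) * c' - int (u i0) * c}"
      unfolding X_def using True q Q qP
      by (intro card_two_windows_parallel P) (auto simp: J_def parallel_def)
    also have "card {c \<in> J. \<exists>c'\<in>J. int P dvd int (q i0) * c' - int (u i0) * c}
        \<le> ((a + b) * R div P + 1) * (R div a + 1)"
      unfolding J_def a_def b_def g_def using q u Q qP by (intro card_proportional_residues P) auto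
    finally have "X \<le> P ^ (CARD('m) - 1) * (((a + b) * R div P + 1) * (R div a + 1))" by simp
    then have "real X \<le> real (P ^ (CARD('m) - 1) * (((a + b) * R div P + 1) * (R div a + 1)))"
      by (rule of_nat_mono)
    also have "\<dots> = real P ^ (CARD('m) - 1) * ((real ((a + b) * R div P) + 1) * (real (R div a) + 1))"
      by (simp only: of_nat_mult of_nat_add of_nat_power of_nat_1)
    also have "\<dots> \<le> real P ^ (CARD('m) - 1) *
        ((4 * real Q / real g * (real R / real P) + 1) * (2 * real R * real g / real Q))"
    proof (intro mult_left_mono mult_mono)
      have ab: "real g * real a < 2 * real Q" "real g * real b < 2 * real Q" "real Q \<le> real g * real a"
        using q u unfolding qa ub by (simp_all flip: of_nat_mult)
      have "real (a + b) \<le> 4 * real Q / real g" using ab g by (simp add: field_simps)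
      then have "real (a + b) * (real R / real P) \<le> 4 * real Q / real g * (real R / real P)"
        by (intro mult_right_mono) auto
      then show "real ((a + b) * R div P) + 1 \<le> 4 * real Q / real g * (real R / real P) + 1"
        using real_div_le[of "(a + b) * R" P] by simp
      have "1 / real a \<le> real g / real Q" using ab g a0 Q by (simp add: field_simps)
      then have "real R * (1 / real a) \<le> real R * (real g / real Q)" by (intro mult_left_mono) auto
      moreover have "1 \<le> real R * (real g / real Q)"
      proof -
        have "Q * 1 \<le> R * g" using Q g by (intro mult_le_mono) auto
        then have "real Q \<le> real R * real g" by (simp flip: of_nat_mult)
        then show ?thesis using Q by simp
      qed
      ultimately show "real (R div a) + 1 \<le> 2 * real R * real g / real Q"
        using real_div_le[of R a] by simp
    qed auto
    also have "\<dots> = real P ^ (CARD('m) - 1) * real P *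
        (8 * (real R / real P)\<^sup>2 + 2 * (real R / real P) * real g / real Q)"
      using P0 g Q by (simp add: field_simps power2_eq_square)
    also have "\<dots> \<le> real P ^ (CARD('m) - 1) * real P * (8 * \<rho>\<^sup>2 + 2 * \<rho> * real g / real Q)"
      using \<rho> \<rho>0 by (intro mult_left_mono add_mono divide_right_mono mult_right_mono power_mono) auto
    also have "real P ^ (CARD('m) - 1) * real P = real P ^ CARD('m)"
      by (metis One_nat_def Suc_pred zero_less_card_finite power_Suc2)
    finally show ?thesis using True by (simp add: X_def J_def g_def)
  qed
qed

text \<open>The factor in front of the bracket corresponds to the uniform distribution, where all \<open>N^m\<close> cells have the
same mass. For \<open>N \<le> Q\<close> the form wraps around many times within a cell, and a bound on the mass of each cell
suffices. For \<open>N > Q\<close> the mass of a cell is bounded by \<open>card_hits_in_cell_real\<close> and the number of cells hit by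
both forms by \<open>card_window_pairs_real\<close> with \<open>\<rho> = O(Q / N)\<close>; the assumption \<open>N \<le> Q E\<close> makes the variation of
the forms in a cell, and not the window itself, decisive for the length of the enlarged window.\<close>

lemma joint_hits_le:
  fixes q u :: "'m::finite \<Rightarrow> nat"
  assumes P: "prime P" "4 * Q * Q \<le> P" and Q: "0 < Q" "2 * Q \<le> R"
    and q: "Q \<le> q i0" "\<And>i. q i < 2 * Q"
    and u: "Q \<le> u i0" "\<And>i. u i < 2 * Q"
    and N: "0 < N" "N \<le> P" "N \<le> Q * E" "R * E \<le> P"
  shows "real (joint_hits P N R q u) \<le> (real P ^ (CARD('m) - 1) * real R)\<^sup>2 *
    (3200 * 8 ^ CARD('m) * (real CARD('m))\<^sup>2 / real N ^ CARD('m) *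
      (1 + (if parallel i0 q u then real (gcd (q i0) (u i0)) * real N / (real Q)\<^sup>2 else 0)))"
proof -
  define m where "m = CARD('m)"
  define k where "k = m - 1"
  have mk: "m = Suc k" by (simp add: m_def k_def)
  define \<gamma> where "\<gamma> = (2 / real N) ^ k * (4 * (1 / real N + 1 / real Q))"
  define M where "M = real P ^ k * real R * \<gamma>"
  define H where "H = hit_cells P N R q \<inter> hit_cells P N R u"
  define G where "G = (if parallel i0 q u then real (gcd (q i0) (u i0)) * real N / (real Q)\<^sup>2 else 0)"
  have G0: "G \<ge> 0" by (simp add: G_def)
  have \<gamma>0: "\<gamma> \<ge> 0" by (simp add: \<gamma>_def)
  have R0: "R > 0" using Q by simp
  have P0: "real P > 0" using N by simp
  have cq: "real (card {x \<in> grid P. cell P N x = Y \<and> dot q x mod P < R}) \<le> M"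
    and cu: "real (card {x \<in> grid P. cell P N x = Y \<and> dot u x mod P < R}) \<le> M" for Y
    unfolding M_def \<gamma>_def k_def m_def
    using card_hits_in_cell_real[of N P Q q i0 R Y] card_hits_in_cell_real[of N P Q u i0 R Y] N Q q u by simp_all
  have M0: "M \<ge> 0" using \<gamma>0 by (simp add: M_def)
  have "joint_hits P N R q u \<le> card H * (nat \<lfloor>M\<rfloor> * nat \<lfloor>M\<rfloor>)"
    unfolding H_def
    by (rule joint_hits_le_cells[OF N(1)]) (use cq cu in \<open>auto simp: le_nat_floor\<close>)
  then have "real (joint_hits P N R q u) \<le> real (card H * (nat \<lfloor>M\<rfloor> * nat \<lfloor>M\<rfloor>))" by (rule of_nat_mono)
  also have "\<dots> = real (card H) * (real (nat \<lfloor>M\<rfloor>) * real (nat \<lfloor>M\<rfloor>))" by simp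
  also have "\<dots> \<le> real (card H) * (M * M)"
    using M0 by (intro mult_left_mono mult_mono of_nat_floor) auto
  also have "\<dots> = (real P ^ k * real R)\<^sup>2 * (real (card H) * \<gamma>\<^sup>2)"
    by (simp add: M_def power2_eq_square mult_ac)
  also have "\<dots> \<le> (real P ^ k * real R)\<^sup>2 * (3200 * 8 ^ m * (real m)\<^sup>2 / real N ^ m * (1 + G))"
  proof (intro mult_left_mono)
    have m1: "(1::real) \<le> (real m)\<^sup>2" by (simp add: mk)
    show "real (card H) * \<gamma>\<^sup>2 \<le> 3200 * 8 ^ m * (real m)\<^sup>2 / real N ^ m * (1 + G)"
    proof (cases "N \<le> Q")
      case True
      have "card H \<le> card (grid N :: ('m \<Rightarrow> nat) set)"
        unfolding H_def using hit_cells_subset[OF N(1)] by (intro card_mono) auto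
      then have "card H \<le> N ^ m" by (simp add: card_grid m_def)
      then have H: "real (card H) \<le> real N ^ m" by (metis of_nat_le_iff of_nat_power)
      have "1 / real Q \<le> 1 / real N" using True N by (intro divide_left_mono) auto
      then have "\<gamma> \<le> (2 / real N) ^ k * (8 / real N)" unfolding \<gamma>_def by (intro mult_left_mono) auto
      also have "\<dots> = 4 * 2 ^ m / real N ^ m" by (simp add: mk power_divide mult.commute)
      finally have "\<gamma>\<^sup>2 \<le> (4 * 2 ^ m / real N ^ m)\<^sup>2" using \<gamma>0 by (intro power_mono) auto
      then have "real (card H) * \<gamma>\<^sup>2 \<le> real N ^ m * (4 * 2 ^ m / real N ^ m)\<^sup>2"
        using H by (intro mult_mono) auto
      also have "\<dots> = 16 * 4 ^ m / real N ^ m * 1 * 1"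
      proof -
        have "(2::real) ^ m * 2 ^ m = 4 ^ m" by (simp flip: power_mult_distrib)
        then show ?thesis using N(1) by (simp add: power2_eq_square field_simps)
      qed
      also have "\<dots> \<le> 3200 * 8 ^ m / real N ^ m * (real m)\<^sup>2 * (1 + G)"
        using m1 G0 by (intro mult_mono divide_right_mono power_mono) auto
      finally show ?thesis by simp
    next
      case False
      define D where "D = 2 * Q * CARD('m) * P div N"
      define R' where "R' = R + 2 * D"
      define \<rho> where "\<rho> = 5 * real m * real Q / real N"
      define \<Phi> where "\<Phi> = 8 * \<rho>\<^sup>2 + (if parallel i0 q u then 2 * \<rho> * real (gcd (q i0) (u i0)) / real Q else 0)"
      have "real D \<le> real (2 * Q * CARD('m) * P) / real N" unfolding D_def by (rule real_div_le)
      then have D: "real D / real P \<le> 2 * real m * real Q / real N"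
        using P0 by (simp add: field_simps m_def)
      have "real R / real P \<le> real Q / real N"
      proof -
        have "R * N \<le> R * (Q * E)" using N by simp
        also have "\<dots> = (R * E) * Q" by simp
        also have "\<dots> \<le> P * Q" using N by (intro mult_right_mono) auto
        finally have "real R * real N \<le> real P * real Q" by (simp flip: of_nat_mult)
        then show ?thesis using P0 N by (simp add: field_simps)
      qed
      also have "\<dots> \<le> real m * real Q / real N"
        using mult_right_mono[of 1 "real m" "real Q"] by (intro divide_right_mono) (auto simp: mk)
      finally have "real R / real P \<le> real m * real Q / real N" .
      moreover have "real R' / real P = real R / real P + 2 * (real D / real P)"
        by (simp add: R'_def add_divide_distrib)
      moreover have "\<rho> = real m * real Q / real N + 2 * (2 * real m * real Q / real N)"
        by (simp add: \<rho>_def)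
      ultimately have "real R' / real P \<le> \<rho>" using D by linarith
      then have X: "real (card {x \<in> grid P. near P {- int D..<- int D + int R'} (dot q x)
          \<and> near P {- int D..<- int D + int R'} (dot u x)}) \<le> real P ^ m * \<Phi>"
        unfolding \<Phi>_def m_def using P Q q u
        by (intro card_window_pairs_real) (auto simp: R'_def)
      have "card H * (P div N) ^ CARD('m) \<le> card {x \<in> grid P. near P {- int D..<- int D + int R'} (dot q x)
          \<and> near P {- int D..<- int D + int R'} (dot u x)}"
        unfolding H_def D_def R'_def
        by (rule card_hit_cells_le) (use N q u in \<open>auto intro: less_imp_le\<close>)
      then have "real (card H * (P div N) ^ m) \<le> real P ^ m * \<Phi>"
        using X unfolding m_def by (meson of_nat_mono order_trans)
      then have "real (card H) * real (P div N) ^ m \<le> real P ^ m * \<Phi>" by simp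
      moreover have "real P / (2 * real N) \<le> real (P div N)"
      proof -
        have "P div N \<ge> 1" using N by (simp add: Suc_le_eq div_greater_zero_iff)
        moreover have "real P / real N < real (P div N) + 1"
          using nat_div_bounds(2)[OF N(1), of P] N(1)
          by (simp add: divide_less_eq distrib_right flip: of_nat_mult of_nat_add)
        ultimately show ?thesis by (simp add: field_simps)
      qed
      then have "real (card H) * (real P / (2 * real N)) ^ m \<le> real (card H) * real (P div N) ^ m"
        by (intro mult_left_mono power_mono) auto
      ultimately have "real (card H) * (real P / (2 * real N)) ^ m \<le> real P ^ m * \<Phi>" by simp
      then have H: "real (card H) \<le> (2 * real N) ^ m * \<Phi>"
        using P0 N by (simp add: power_divide field_simps)
      have "1 / real N \<le> 1 / real Q" using False Q by (intro divide_left_mono) auto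
      then have "\<gamma> \<le> (2 / real N) ^ k * (8 / real Q)" unfolding \<gamma>_def by (intro mult_left_mono) auto
      also have "\<dots> = 4 * 2 ^ m * real N / (real N ^ m * real Q)" using N by (simp add: mk power_divide)
      finally have "\<gamma>\<^sup>2 \<le> (4 * 2 ^ m * real N / (real N ^ m * real Q))\<^sup>2"
        using \<gamma>0 by (intro power_mono) auto
      then have "real (card H) * \<gamma>\<^sup>2 \<le> ((2 * real N) ^ m * \<Phi>) * (4 * 2 ^ m * real N / (real N ^ m * real Q))\<^sup>2"
        using H by (intro mult_mono) auto
      also have "\<dots> = 16 * (2 ^ m * (2 ^ m * 2 ^ m)) / real N ^ m * ((real N)\<^sup>2 / (real Q)\<^sup>2 * \<Phi>)"
        using N(1) by (simp add: power2_eq_square power_mult_distrib field_simps)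
      also have "(2::real) ^ m * (2 ^ m * 2 ^ m) = 8 ^ m" by (simp flip: power_mult_distrib)
      also have "(real N)\<^sup>2 / (real Q)\<^sup>2 * \<Phi> = 200 * (real m)\<^sup>2 + 10 * real m * G"
        using N(1) Q(1) unfolding \<Phi>_def \<rho>_def G_def by (auto simp: power2_eq_square field_simps)
      also have "16 * 8 ^ m / real N ^ m * (200 * (real m)\<^sup>2 + 10 * real m * G)
          \<le> 16 * 8 ^ m / real N ^ m * (200 * (real m)\<^sup>2 * (1 + G))"
      proof (intro mult_left_mono)
        have "real m \<le> (real m)\<^sup>2" by (simp add: mk power2_eq_square)
        then have "10 * real m \<le> 200 * (real m)\<^sup>2" using zero_le_power2[of "real m"] by linarith
        then have "10 * real m * G \<le> 200 * (real m)\<^sup>2 * G" using G0 by (intro mult_right_mono) auto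
        then show "200 * (real m)\<^sup>2 + 10 * real m * G \<le> 200 * (real m)\<^sup>2 * (1 + G)"
          by (simp add: distrib_left)
      qed simp
      finally show ?thesis by simp
    qed
  qed simp
  finally show ?thesis by (simp add: m_def k_def G_def)
qed

lemma card_multiples_atMost: "d > 0 \<Longrightarrow> card {a \<in> {1..M}. d dvd a} \<le> M div d" for d M :: nat
proof -
  assume d: "d > 0"
  have "{a \<in> {1..M}. d dvd a} \<subseteq> (\<lambda>k. d * k) ` {1..M div d}"
  proof
    fix a assume "a \<in> {a \<in> {1..M}. d dvd a}"
    then obtain k where k: "a = d * k" "1 \<le> a" "a \<le> M" by auto
    then have "1 \<le> k" by (cases k) auto
    moreover have "k \<le> M div d" using k d by (simp add: less_eq_div_iff_mult_less_eq mult.commute)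
    ultimately show "a \<in> (\<lambda>k. d * k) ` {1..M div d}" using k by auto
  qed
  then have "card {a \<in> {1..M}. d dvd a} \<le> card ((\<lambda>k. d * k) ` {1..M div d})" by (intro card_mono) auto
  also have "\<dots> \<le> M div d" using card_image_le[of "{1..M div d}" "\<lambda>k. d * k"] by simp
  finally show ?thesis .
qed

text \<open>A greatest common divisor is at most the sum of all common divisors, and a divisor \<open>d\<close> is shared by at most
\<open>(M / d)^2\<close> pairs.\<close>

lemma sum_gcd_le:
  "real (\<Sum>a\<in>{1..M}. \<Sum>b\<in>{1..M}. gcd a b) \<le> (real M)\<^sup>2 * harm M" for M :: nat
proof -
  have g: "gcd a b \<le> (\<Sum>d\<in>{1..M}. if d dvd a \<and> d dvd b then d else 0)" if "a \<in> {1..M}" "b \<in> {1..M}" for a b :: nat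
  proof -
    have "gcd a b \<le> a" using that by (intro gcd_le1_nat) auto
    then have "gcd a b \<le> M" using that by (meson atLeastAtMost_iff order_trans)
    then have "gcd a b \<in> {1..M}" using that by (auto simp: Suc_le_eq)
    from member_le_sum[OF this, of "\<lambda>d. if d dvd a \<and> d dvd b then d else 0"] show ?thesis by simp
  qed
  have "(\<Sum>a\<in>{1..M}. \<Sum>b\<in>{1..M}. gcd a b)
      \<le> (\<Sum>a\<in>{1..M}. \<Sum>b\<in>{1..M}. \<Sum>d\<in>{1..M}. if d dvd a \<and> d dvd b then d else 0)"
    by (intro sum_mono g)
  also have "\<dots> = (\<Sum>d\<in>{1..M}. \<Sum>a\<in>{1..M}. \<Sum>b\<in>{1..M}. if d dvd a \<and> d dvd b then d else 0)"
    by (subst (2) sum.swap) (subst sum.swap, rule refl)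
  also have "\<dots> = (\<Sum>d\<in>{1..M}. d * (card {a \<in> {1..M}. d dvd a})\<^sup>2)"
  proof (rule sum.cong[OF refl])
    fix d
    have "(\<Sum>a\<in>{1..M}. \<Sum>b\<in>{1..M}. if d dvd a \<and> d dvd b then d else 0)
      = (\<Sum>a\<in>{1..M}. if d dvd a then (\<Sum>b\<in>{1..M}. if d dvd b then d else 0) else 0)"
      by (intro sum.cong refl) auto
    also have "\<dots> = card {a \<in> {1..M}. d dvd a} * (card {a \<in> {1..M}. d dvd a} * d)"
      by (simp flip: sum.inter_filter)
    finally show "(\<Sum>a\<in>{1..M}. \<Sum>b\<in>{1..M}. if d dvd a \<and> d dvd b then d else 0)
      = d * (card {a \<in> {1..M}. d dvd a})\<^sup>2" by (simp add: power2_eq_square)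
  qed
  finally have "real (\<Sum>a\<in>{1..M}. \<Sum>b\<in>{1..M}. gcd a b)
      \<le> real (\<Sum>d\<in>{1..M}. d * (card {a \<in> {1..M}. d dvd a})\<^sup>2)" by (rule of_nat_mono)
  also have "\<dots> = (\<Sum>d\<in>{1..M}. real d * (real (card {a \<in> {1..M}. d dvd a}))\<^sup>2)" by simp
  also have "\<dots> \<le> (\<Sum>d\<in>{1..M}. real d * (real M / real d)\<^sup>2)"
  proof (intro sum_mono mult_left_mono power_mono)
    fix d assume "d \<in> {1..M}"
    then have "card {a \<in> {1..M}. d dvd a} \<le> M div d" by (intro card_multiples_atMost) auto
    then have "real (card {a \<in> {1..M}. d dvd a}) \<le> real (M div d)" by (rule of_nat_mono)
    then show "real (card {a \<in> {1..M}. d dvd a}) \<le> real M / real d"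
      using real_div_le[of M d] by linarith
  qed auto
  also have "\<dots> = (real M)\<^sup>2 * harm M"
    unfolding harm_def sum_distrib_left by (intro sum.cong) (auto simp: power2_eq_square field_simps)
  finally show ?thesis .
qed

text \<open>Each dyadic block of the harmonic series has a sum of at most 1.\<close>

lemma harm_power2_le: "harm (2 ^ a) \<le> real a + 1"
proof (induction a)
  case (Suc a)
  have "harm (2 ^ a + k) \<le> harm (2 ^ a) + real k / 2 ^ a" for k
  proof (induction k)
    case (Suc k)
    have "inverse (real (Suc (2 ^ a + k))) \<le> inverse (2 ^ a)"
      by (rule le_imp_inverse_le) auto
    then have "inverse (real (Suc (2 ^ a + k))) \<le> 1 / 2 ^ a" by (simp only: inverse_eq_divide)
    with Suc show ?case by (simp add: harm_Suc add_divide_distrib)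
  qed simp
  from this[of "2 ^ a"] Suc show ?case by (simp flip: mult_2)
qed (simp add: harm_def)

section \<open>The second moment over a family of forms\<close>

text \<open>The entry at \<open>i0\<close> is at least \<open>Q\<close>, so that it dominates the other entries and is nonzero modulo a large prime;
the entries outside \<open>T\<close> vanish.\<close>

definition forms :: "nat \<Rightarrow> 'm set \<Rightarrow> 'm \<Rightarrow> ('m::finite \<Rightarrow> nat) set" where
  "forms Q T i0 = (\<Pi>\<^sub>E i\<in>UNIV. if i = i0 then {Q..<2 * Q} else if i \<in> T then {..<Q} else {0})"

lemma formsD:
  assumes "q \<in> forms Q T i0"
  shows "Q \<le> q i0" "q i0 < 2 * Q" "i \<in> T \<Longrightarrow> i \<noteq> i0 \<Longrightarrow> q i < Q" "i \<notin> T \<Longrightarrow> i \<noteq> i0 \<Longrightarrow> q i = 0"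
    "q i < 2 * Q"
proof -
  have *: "q i \<in> (if i = i0 then {Q..<2 * Q} else if i \<in> T then {..<Q} else {0})" for i
    using assms by (auto simp: forms_def PiE_def Pi_def)
  show A: "Q \<le> q i0" "q i0 < 2 * Q" using *[of i0] by auto
  show "i \<in> T \<Longrightarrow> i \<noteq> i0 \<Longrightarrow> q i < Q" "i \<notin> T \<Longrightarrow> i \<noteq> i0 \<Longrightarrow> q i = 0" using *[of i] by auto
  show "q i < 2 * Q" using *[of i] A by (auto split: if_splits)
qed

lemma finite_forms [simp]: "finite (forms Q T i0)"
  unfolding forms_def by (intro finite_PiE) auto

lemma card_forms:
  assumes "i0 \<in> T"
  shows "card (forms Q T i0) = Q ^ card T"
proof -
  have "card (forms Q T i0) = (\<Prod>i\<in>UNIV. card (if i = i0 then {Q..<2 * Q} else if i \<in> T then {..<Q} else {0}))"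
    unfolding forms_def by (simp add: card_PiE)
  also have "\<dots> = (\<Prod>i\<in>UNIV. if i \<in> T then Q else 1)" using assms by (intro prod.cong) auto
  finally show ?thesis by (simp add: prod.If_cases)
qed

lemma card_small_multiples: "d > 0 \<Longrightarrow> card {k::nat. k < Q \<and> d dvd k} \<le> Q div d + 1" for d Q :: nat
proof -
  assume d: "d > 0"
  have "{k::nat. k < Q \<and> d dvd k} \<subseteq> (\<lambda>j. d * j) ` {..Q div d}"
  proof
    fix k assume "k \<in> {k::nat. k < Q \<and> d dvd k}"
    then obtain j where "k = d * j" "d * j < Q" by auto
    moreover from this have "j \<le> Q div d" using d by (simp add: less_eq_div_iff_mult_less_eq mult.commute)
    ultimately show "k \<in> (\<lambda>j. d * j) ` {..Q div d}" by auto
  qed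
  then have "card {k::nat. k < Q \<and> d dvd k} \<le> card ((\<lambda>j. d * j) ` {..Q div d})" by (intro card_mono) auto
  also have "\<dots> \<le> Q div d + 1" using card_image_le[of "{..Q div d}" "\<lambda>j. d * j"] by simp
  finally show ?thesis .
qed

text \<open>Given the entries \<open>a = g a1\<close> and \<open>b = g b1\<close> at \<open>i0\<close>, the second form is determined by the first one, whose
entries must all be multiples of \<open>a1\<close>. As \<open>a1 \<ge> Q / g\<close>, there are at most \<open>2 g\<close> such multiples below \<open>Q\<close>.\<close>

lemma card_parallel_pairs_le:
  fixes T :: "'m::finite set"
  assumes "i0 \<in> T" "0 < Q" "Q \<le> a"
  shows "card {(q, u) \<in> forms Q T i0 \<times> forms Q T i0. q i0 = a \<and> u i0 = b \<and> parallel i0 q u}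
    \<le> (2 * gcd a b) ^ (card T - 1)"
proof -
  define g where "g = gcd a b"
  define a1 b1 where "a1 = a div g" and "b1 = b div g"
  have a0: "a > 0" using assms by simp
  have g: "g > 0" using a0 by (simp add: g_def)
  have a: "a = g * a1" and b: "b = g * b1" by (simp_all add: a1_def b1_def g_def)
  have a1: "a1 > 0" using a0 a by (cases a1) auto
  have cop: "coprime a1 b1" using a0 unfolding a1_def b1_def g_def by (intro div_gcd_coprime) auto
  define S where "S = {(q, u) \<in> forms Q T i0 \<times> forms Q T i0. q i0 = a \<and> u i0 = b \<and> parallel i0 q u}"
  define W where "W = (\<Pi>\<^sub>E i\<in>UNIV. if i = i0 then {a} else if i \<in> T then {k. k < Q \<and> a1 dvd k} else {0})"
  have finW: "finite W" unfolding W_def by (intro finite_PiE) auto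
  have "inj_on fst S"
  proof
    fix s s' assume s: "s \<in> S" "s' \<in> S" "fst s = fst s'"
    obtain q u where su: "s = (q, u)" by (cases s)
    obtain u' where su': "s' = (q, u')" using s(3) su by (cases s') auto
    have "a * u i = b * q i" "a * u' i = b * q i" for i
      using s su su' by (auto simp: S_def parallel_def)
    then have "u i = u' i" for i using a0 by (metis mult_cancel1 not_gr_zero)
    then show "s = s'" using su su' by auto
  qed
  then have "card S = card (fst ` S)" by (simp add: card_image)
  also have "\<dots> \<le> card W"
  proof (intro card_mono finW, rule)
    fix q assume "q \<in> fst ` S"
    then obtain u where u: "q \<in> forms Q T i0" "q i0 = a" "u i0 = b" "parallel i0 q u"
      by (auto simp: S_def)
    have "a1 dvd q i" for i
    proof -
      have "q i0 * u i = u i0 * q i" using u(4) unfolding parallel_def by blast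
      then have "g * (a1 * u i) = g * (b1 * q i)" unfolding u(2,3) a b by (simp only: mult.assoc)
      then have "a1 * u i = b1 * q i" using g by simp
      then have "a1 dvd b1 * q i" by (metis dvd_triv_left)
      then show ?thesis using cop by (simp add: coprime_dvd_mult_right_iff)
    qed
    then show "q \<in> W" unfolding W_def
      using formsD(3,4)[OF u(1)] u(2) by (auto simp: PiE_UNIV_domain Pi_def)
  qed
  also have "\<dots> = (\<Prod>i\<in>UNIV. card (if i = i0 then {a} else if i \<in> T then {k. k < Q \<and> a1 dvd k} else {0}))"
    unfolding W_def by (simp add: card_PiE)
  also have "\<dots> \<le> (\<Prod>i\<in>UNIV. if i \<in> T - {i0} then 2 * g else 1)"
  proof (intro prod_mono conjI)
    have "Q \<le> g * a1" using assms a by simp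
    then have "Q div a1 \<le> g" using a1 by (metis div_le_mono div_mult_self_is_m)
    then have "card {k. k < Q \<and> a1 dvd k} \<le> 2 * g" using card_small_multiples[OF a1, of Q] g by linarith
    then show "card (if i = i0 then {a} else if i \<in> T then {k. k < Q \<and> a1 dvd k} else {0})
        \<le> (if i \<in> T - {i0} then 2 * g else 1)" for i by auto
  qed auto
  also have "\<dots> = (2 * g) ^ card (T - {i0})"
    by (subst prod.If_cases) (simp_all only: finite_code Collect_mem_eq Int_UNIV_left prod_constant prod.neutral_const power_one mult_1_right)
  finally show ?thesis using assms(1) by (simp add: S_def g_def)
qed

text \<open>Grouping by the entries at \<open>i0\<close> leaves a sum of \<open>gcd(a, b)^(card T - 1 + n)\<close>. All factors but one are estimated
by \<open>2 Q\<close>, and the remaining one is summed by \<open>sum_gcd_le\<close>. The harmonic sum only costs a logarithm.\<close>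

lemma sum_parallel_gcd_le:
  fixes T :: "'m::finite set"
  assumes "i0 \<in> T" "0 < Q" "0 < n"
  shows "(\<Sum>q\<in>forms Q T i0. \<Sum>u\<in>forms Q T i0. if parallel i0 q u then real (gcd (q i0) (u i0)) ^ n else 0)
    \<le> 2 ^ card T * (2 * real Q) ^ (card T + n) * harm (2 * Q)"
proof -
  define p where "p = card T"
  have p: "p \<ge> 1" using assms(1) by (auto simp: p_def Suc_le_eq card_gt_0_iff)
  let ?F = "forms Q T i0"
  define S where "S = {(q, u) \<in> ?F \<times> ?F. parallel i0 q u}"
  define \<phi> :: "('m \<Rightarrow> nat) \<times> ('m \<Rightarrow> nat) \<Rightarrow> nat \<times> nat" where "\<phi> = (\<lambda>(q, u). (q i0, u i0))"
  define I where "I = {Q..<2 * Q}"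
  have finS: "finite S" unfolding S_def by (rule finite_subset[of _ "?F \<times> ?F"]) auto
  have "(\<Sum>q\<in>?F. \<Sum>u\<in>?F. if parallel i0 q u then real (gcd (q i0) (u i0)) ^ n else 0)
      = (\<Sum>(q, u)\<in>S. real (gcd (q i0) (u i0)) ^ n)"
    unfolding sum.cartesian_product S_def
    by (rule sum.mono_neutral_cong_right) (auto split: if_splits)
  also have "\<dots> = (\<Sum>s\<in>S. (\<lambda>(a, b). real (gcd a b) ^ n) (\<phi> s))"
    by (intro sum.cong) (auto simp: \<phi>_def)
  also have "\<dots> = (\<Sum>c\<in>I \<times> I. \<Sum>s\<in>{s\<in>S. \<phi> s = c}. (\<lambda>(a, b). real (gcd a b) ^ n) (\<phi> s))"
    by (rule sum.group[OF finS, symmetric]) (auto simp: I_def \<phi>_def S_def dest: formsD)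
  also have "\<dots> = (\<Sum>(a, b)\<in>I \<times> I. real (card {s\<in>S. \<phi> s = (a, b)}) * real (gcd a b) ^ n)"
    by (rule sum.cong) auto
  also have "\<dots> \<le> (\<Sum>(a, b)\<in>I \<times> I. 2 ^ p * (2 * real Q) ^ (p + n - 2) * real (gcd a b))"
  proof (rule sum_mono, clarify)
    fix a b assume ab: "a \<in> I" "b \<in> I"
    define g where "g = gcd a b"
    have "{s\<in>S. \<phi> s = (a, b)} = {(q, u) \<in> ?F \<times> ?F. q i0 = a \<and> u i0 = b \<and> parallel i0 q u}"
      by (auto simp: S_def \<phi>_def)
    then have "card {s\<in>S. \<phi> s = (a, b)} \<le> (2 * g) ^ (p - 1)"
      using card_parallel_pairs_le[OF assms(1,2), of a b] ab by (simp add: I_def g_def p_def)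
    then have "real (card {s\<in>S. \<phi> s = (a, b)}) \<le> real ((2 * g) ^ (p - 1))" by (rule of_nat_mono)
    then have "real (card {s\<in>S. \<phi> s = (a, b)}) * real g ^ n \<le> real ((2 * g) ^ (p - 1)) * real g ^ n"
      by (intro mult_right_mono) auto
    also have "\<dots> = 2 ^ (p - 1) * real g ^ (p + n - 2) * real g"
    proof -
      have e: "p - 1 + n = Suc (p + n - 2)" using p assms(3) by simp
      have "real g ^ (p - 1) * real g ^ n = real g ^ (p + n - 2) * real g"
        unfolding power_add[symmetric] e by simp
      then show ?thesis by (simp add: power_mult_distrib)
    qed
    also have "\<dots> \<le> 2 ^ p * (2 * real Q) ^ (p + n - 2) * real g"
    proof (intro mult_right_mono mult_mono power_mono)
      have "g \<le> a" unfolding g_def using ab assms(2) by (intro gcd_le1_nat) (auto simp: I_def)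
      then show "real g \<le> 2 * real Q" using ab by (auto simp: I_def)
      show "(2::real) ^ (p - 1) \<le> 2 ^ p" by (intro power_increasing) auto
    qed auto
    finally show "real (card {s\<in>S. \<phi> s = (a, b)}) * real (gcd a b) ^ n
      \<le> 2 ^ p * (2 * real Q) ^ (p + n - 2) * real (gcd a b)" by (simp add: g_def)
  qed
  also have "\<dots> = 2 ^ p * (2 * real Q) ^ (p + n - 2) * real (\<Sum>a\<in>I. \<Sum>b\<in>I. gcd a b)"
    by (simp add: sum.cartesian_product[symmetric] sum_distrib_left)
  also have "\<dots> \<le> 2 ^ p * (2 * real Q) ^ (p + n - 2) * real (\<Sum>a\<in>{1..2 * Q}. \<Sum>b\<in>{1..2 * Q}. gcd a b)"
  proof (intro mult_left_mono of_nat_mono)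
    have I: "I \<subseteq> {1..2 * Q}" using assms(2) by (auto simp: I_def)
    have "(\<Sum>a\<in>I. \<Sum>b\<in>I. gcd a b) \<le> (\<Sum>a\<in>I. \<Sum>b\<in>{1..2 * Q}. gcd a b)"
      by (intro sum_mono sum_mono2 I) auto
    also have "\<dots> \<le> (\<Sum>a\<in>{1..2 * Q}. \<Sum>b\<in>{1..2 * Q}. gcd a b)" by (intro sum_mono2 I) auto
    finally show "(\<Sum>a\<in>I. \<Sum>b\<in>I. gcd a b) \<le> (\<Sum>a\<in>{1..2 * Q}. \<Sum>b\<in>{1..2 * Q}. gcd a b)" .
  qed auto
  also have "\<dots> \<le> 2 ^ p * (2 * real Q) ^ (p + n - 2) * ((real (2 * Q))\<^sup>2 * harm (2 * Q))"
    by (intro mult_left_mono sum_gcd_le) auto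
  also have "\<dots> = 2 ^ p * ((2 * real Q) ^ (p + n - 2) * (2 * real Q)\<^sup>2) * harm (2 * Q)" by simp
  also have "(2 * real Q) ^ (p + n - 2) * (2 * real Q)\<^sup>2 = (2 * real Q) ^ (p + n)"
  proof -
    have "p + n = p + n - 2 + 2" using p assms(3) by simp
    then show ?thesis by (metis power_add)
  qed
  finally show ?thesis by (simp add: p_def)
qed

lemma one_plus_power_le:
  fixes x :: real assumes "x \<ge> 0" shows "(1 + x) ^ n \<le> 2 ^ n * (1 + x ^ n)"
proof -
  have "(1 + x) ^ n \<le> (2 * max 1 x) ^ n" using assms by (intro power_mono) auto
  also have "\<dots> = 2 ^ n * (max 1 x) ^ n" by (simp add: power_mult_distrib)
  also have "(max 1 x) ^ n \<le> 1 + x ^ n" using assms by (auto simp: max_def)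
  finally show ?thesis by simp
qed

text \<open>The mean of the \<open>n\<close>-th powers of the correlations. Of the two summands in the bracket the first one comes from
independence and the second one from the parallel pairs.\<close>

lemma mean_joint_hits_power_le:
  fixes T :: "'m::finite set"
  assumes P: "prime P" "4 * Q * Q \<le> P" and Q: "0 < Q" "2 * Q \<le> R"
    and N: "0 < N" "N \<le> P" "N \<le> Q * E" "R * E \<le> P" and T: "i0 \<in> T" and n: "0 < n"
  defines "K \<equiv> 3200 * 8 ^ CARD('m) * (real CARD('m))\<^sup>2"
  shows "(\<Sum>q\<in>forms Q T i0. \<Sum>u\<in>forms Q T i0.
      (real (joint_hits P N R q u) / (real P ^ (CARD('m) - 1) * real R)\<^sup>2) ^ n) / (real (card (forms Q T i0)))\<^sup>2
    \<le> (2 * K) ^ n * 8 ^ (card T + n) / real N ^ (CARD('m) * n) *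
      (1 + real N ^ n / real Q ^ (card T + n) * harm (2 * Q))"
proof -
  define m p where "m = CARD('m)" and "p = card T"
  let ?F = "forms Q T i0"
  define g where "g q u = (if parallel i0 q u then real (gcd (q i0) (u i0)) else 0)" for q u :: "'m \<Rightarrow> nat"
  have K0: "K \<ge> 0" by (simp add: K_def)
  have R0: "real P ^ (m - 1) * real R > 0" using Q N by simp
  have "(real (joint_hits P N R q u) / (real P ^ (m - 1) * real R)\<^sup>2) ^ n
      \<le> (2 * K / real N ^ m) ^ n * (1 + (real N / (real Q)\<^sup>2) ^ n * g q u ^ n)"
    if "q \<in> ?F" "u \<in> ?F" for q u
  proof -
    have "real (joint_hits P N R q u) / (real P ^ (m - 1) * real R)\<^sup>2
        \<le> K / real N ^ m * (1 + g q u * real N / (real Q)\<^sup>2)"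
    proof -
      have "real (joint_hits P N R q u) \<le> (real P ^ (m - 1) * real R)\<^sup>2 * (K / real N ^ m *
        (1 + (if parallel i0 q u then real (gcd (q i0) (u i0)) * real N / (real Q)\<^sup>2 else 0)))"
        unfolding m_def K_def
        by (rule joint_hits_le[OF P Q _ _ _ _ N]) (use formsD[OF that(1)] formsD[OF that(2)] in auto)
      also have "(if parallel i0 q u then real (gcd (q i0) (u i0)) * real N / (real Q)\<^sup>2 else 0)
          = g q u * real N / (real Q)\<^sup>2" by (simp add: g_def)
      finally show ?thesis using pos_divide_le_eq[OF zero_less_power[OF R0, of 2]]
        by (simp only: mult.commute)
    qed
    then have "(real (joint_hits P N R q u) / (real P ^ (m - 1) * real R)\<^sup>2) ^ n
        \<le> (K / real N ^ m * (1 + g q u * real N / (real Q)\<^sup>2)) ^ n" by (intro power_mono) auto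
    also have "\<dots> \<le> (K / real N ^ m) ^ n * (2 ^ n * (1 + (g q u * real N / (real Q)\<^sup>2) ^ n))"
      unfolding power_mult_distrib using K0
      by (intro mult_left_mono one_plus_power_le) (auto simp: g_def)
    also have "\<dots> = (2 * K / real N ^ m) ^ n * (1 + (real N / (real Q)\<^sup>2) ^ n * g q u ^ n)"
      by (simp add: power_mult_distrib power_divide mult_ac)
    finally show ?thesis .
  qed
  then have "(\<Sum>q\<in>?F. \<Sum>u\<in>?F. (real (joint_hits P N R q u) / (real P ^ (m - 1) * real R)\<^sup>2) ^ n)
      \<le> (\<Sum>q\<in>?F. \<Sum>u\<in>?F. (2 * K / real N ^ m) ^ n * (1 + (real N / (real Q)\<^sup>2) ^ n * g q u ^ n))"
    by (intro sum_mono)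
  also have "\<dots> = (2 * K / real N ^ m) ^ n * ((real (card ?F))\<^sup>2
      + (real N / (real Q)\<^sup>2) ^ n * (\<Sum>q\<in>?F. \<Sum>u\<in>?F. g q u ^ n))"
    by (simp add: sum.distrib power2_eq_square flip: sum_distrib_left)
  also have "(\<Sum>q\<in>?F. \<Sum>u\<in>?F. g q u ^ n)
      = (\<Sum>q\<in>?F. \<Sum>u\<in>?F. if parallel i0 q u then real (gcd (q i0) (u i0)) ^ n else 0)"
    using n by (intro sum.cong refl) (simp add: g_def)
  also have "(2 * K / real N ^ m) ^ n * ((real (card ?F))\<^sup>2 + (real N / (real Q)\<^sup>2) ^ n * \<dots>)
      \<le> (2 * K / real N ^ m) ^ n * ((real (card ?F))\<^sup>2 + (real N / (real Q)\<^sup>2) ^ n *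
          (2 ^ p * (2 * real Q) ^ (p + n) * harm (2 * Q)))"
    unfolding p_def using K0 by (intro mult_left_mono add_mono order_refl sum_parallel_gcd_le T Q n) auto
  finally have "(\<Sum>q\<in>?F. \<Sum>u\<in>?F. (real (joint_hits P N R q u) / (real P ^ (m - 1) * real R)\<^sup>2) ^ n) / (real (card ?F))\<^sup>2
      \<le> (2 * K / real N ^ m) ^ n * ((real (card ?F))\<^sup>2 + (real N / (real Q)\<^sup>2) ^ n *
          (2 ^ p * (2 * real Q) ^ (p + n) * harm (2 * Q))) / (real (card ?F))\<^sup>2"
    by (intro divide_right_mono) auto
  also have "\<dots> = (2 * K / real N ^ m) ^ n * (1 + real N ^ n / real Q ^ (p + n) * (2 ^ p * 2 ^ (p + n) * harm (2 * Q)))"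
  proof -
    have c: "real (card ?F) = real Q ^ p" using T by (simp add: card_forms p_def)
    have "(real N / (real Q)\<^sup>2) ^ n * (2 ^ p * (2 * real Q) ^ (p + n) * harm (2 * Q)) / (real Q ^ p)\<^sup>2
      = real N ^ n / real Q ^ (p + n) * (2 ^ p * 2 ^ (p + n) * harm (2 * Q))"
      using Q(1) by (simp add: power_divide power_mult_distrib power_add field_simps power2_eq_square)
    moreover have "(real Q ^ p)\<^sup>2 / (real Q ^ p)\<^sup>2 = 1" using Q(1) by simp
    ultimately show ?thesis
      unfolding c times_divide_eq_right[symmetric] by (simp only: add_divide_distrib times_divide_eq_right)
  qed
  also have "\<dots> \<le> (2 * K / real N ^ m) ^ n * (8 ^ (p + n) * (1 + real N ^ n / real Q ^ (p + n) * harm (2 * Q)))"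
  proof (intro mult_left_mono)
    have h: "harm (2 * Q) \<ge> (0::real)" by (simp add: harm_nonneg)
    have "(2::real) ^ p * 2 ^ (p + n) \<le> 2 ^ (p + n) * 2 ^ (p + n)" by (intro mult_right_mono power_increasing) auto
    also have "\<dots> = 4 ^ (p + n)" by (simp flip: power_mult_distrib)
    also have "\<dots> \<le> (8::real) ^ (p + n)" by (intro power_mono) auto
    finally have le: "(2::real) ^ p * 2 ^ (p + n) \<le> 8 ^ (p + n)" .
    define X where "X = real N ^ n / real Q ^ (p + n) * (harm (2 * Q) :: real)"
    have "X * (2 ^ p * 2 ^ (p + n)) \<le> X * 8 ^ (p + n)"
      using h by (intro mult_left_mono le) (auto simp: X_def)
    moreover have "(1::real) \<le> 8 ^ (p + n)" by simp
    ultimately have "1 + X * (2 ^ p * 2 ^ (p + n)) \<le> 8 ^ (p + n) + X * 8 ^ (p + n)" by linarith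
    moreover have "8 ^ (p + n) * (1 + X) = 8 ^ (p + n) + X * 8 ^ (p + n)" by algebra
    ultimately have "1 + X * (2 ^ p * 2 ^ (p + n)) \<le> 8 ^ (p + n) * (1 + X)" by simp
    moreover have "real N ^ n / real Q ^ (p + n) * (2 ^ p * 2 ^ (p + n) * harm (2 * Q)) = X * (2 ^ p * 2 ^ (p + n))"
      by (simp add: X_def)
    ultimately show "1 + real N ^ n / real Q ^ (p + n) * (2 ^ p * 2 ^ (p + n) * harm (2 * Q))
        \<le> 8 ^ (p + n) * (1 + real N ^ n / real Q ^ (p + n) * harm (2 * Q))"
      by (simp only: X_def)
  qed (use K0 in simp)
  also have "\<dots> = (2 * K) ^ n * 8 ^ (p + n) / real N ^ (m * n) * (1 + real N ^ n / real Q ^ (p + n) * harm (2 * Q))"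
    by (simp add: power_divide power_mult)
  finally show ?thesis unfolding m_def p_def .
qed

section \<open>Patterns near integral values of linear forms\<close>

lemma column_sum_prod:
  fixes f :: "'n::finite \<Rightarrow> ('m::finite \<Rightarrow> nat) \<Rightarrow> real"
  shows "(\<Sum>x\<in>grid P. \<Prod>j\<in>UNIV. f j (\<lambda>i. x (i, j))) = (\<Prod>j\<in>UNIV. \<Sum>c\<in>grid P. f j c)"
proof -
  have "(\<Prod>j\<in>UNIV. \<Sum>c\<in>grid P. f j c) = (\<Sum>g\<in>(\<Pi>\<^sub>E j\<in>UNIV. grid P). \<Prod>j\<in>UNIV. f j (g j))"
    by (rule prod_sum_PiE) auto
  also have "\<dots> = (\<Sum>x\<in>grid P. \<Prod>j\<in>UNIV. f j (\<lambda>i. x (i, j)))"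
    by (rule sum.reindex_bij_witness[where i = "\<lambda>x j i. x (i, j)" and j = "\<lambda>g (i, j). g j i"])
       (auto simp: grid_def PiE_UNIV_domain Pi_def)
  finally show ?thesis ..
qed

text \<open>For \<open>g\<close> the map from points \<open>x / P\<close> to small dyadic cubes and \<open>f\<close> the map from these to larger cubes: the masses
of the points can be moved to the small cubes without changing energies at coarser levels.\<close>

lemma energy_pushforward:
  assumes "finite A" "finite B" "g ` A \<subseteq> B"
  shows "energy B f (\<lambda>y. \<Sum>x\<in>{x\<in>A. g x = y}. w x) = energy A (\<lambda>x. f (g x)) w"
proof -
  have "energy A (\<lambda>x. f (g x)) w
      = (\<Sum>x\<in>A. \<Sum>y'\<in>B. \<Sum>x'\<in>{x\<in>A. g x = y'}. if f (g x) = f (g x') then w x * w x' else 0)"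
    unfolding energy_def by (intro sum.cong refl sum.group[symmetric] assms)
  also have "\<dots> = (\<Sum>y\<in>B. \<Sum>x\<in>{x\<in>A. g x = y}. \<Sum>y'\<in>B. \<Sum>x'\<in>{x\<in>A. g x = y'}.
      if f (g x) = f (g x') then w x * w x' else 0)"
    by (intro sum.group[symmetric] assms)
  also have "\<dots> = (\<Sum>y\<in>B. \<Sum>x\<in>{x\<in>A. g x = y}. \<Sum>y'\<in>B. \<Sum>x'\<in>{x\<in>A. g x = y'}.
      if f y = f y' then w x * w x' else 0)"
    by (intro sum.cong refl) auto
  also have "\<dots> = (\<Sum>y\<in>B. \<Sum>y'\<in>B. \<Sum>x\<in>{x\<in>A. g x = y}. \<Sum>x'\<in>{x\<in>A. g x = y'}.
      if f y = f y' then w x * w x' else 0)"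
    by (rule sum.cong[OF refl], rule sum.swap)
  also have "\<dots> = energy B f (\<lambda>y. \<Sum>x\<in>{x\<in>A. g x = y}. w x)"
    unfolding energy_def sum_product by (intro sum.cong refl) auto
  finally show ?thesis ..
qed

text \<open>The average over \<open>q \<in> F\<close> of the uniform distributions on the integer matrices \<open>x\<close> all of whose columns satisfy
\<open>q x_j mod P < R\<close>. Each of these sets has \<open>(P^(m-1) R)^n\<close> elements by \<open>card_residue_window\<close>.\<close>

definition weight :: "nat \<Rightarrow> nat \<Rightarrow> ('m::finite \<Rightarrow> nat) set \<Rightarrow> ('m \<times> 'n::finite \<Rightarrow> nat) \<Rightarrow> real" where
  "weight P R F x = (\<Sum>q\<in>F. \<Prod>j\<in>UNIV. if dot q (\<lambda>i. x (i, j)) mod P < R then 1 else 0)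
     / (real (card F) * (real P ^ (CARD('m) - 1) * real R) ^ CARD('n))"

lemma weight_nonneg: "weight P R F x \<ge> 0"
  unfolding weight_def by (intro divide_nonneg_nonneg sum_nonneg prod_nonneg) auto

lemma sum_weight:
  fixes F :: "('m::finite \<Rightarrow> nat) set"
  assumes "prime P" "0 < R" "R \<le> P" "finite F" "F \<noteq> {}" "\<And>q. q \<in> F \<Longrightarrow> 0 < q i0 \<and> q i0 < P"
  shows "(\<Sum>x\<in>grid P. weight P R F (x :: 'm \<times> 'n::finite \<Rightarrow> nat)) = 1"
proof -
  define c where "c = real P ^ (CARD('m) - 1) * real R"
  have P: "P > 0" using assms(1) prime_gt_0_nat by blast
  have "(\<Sum>x\<in>(grid P :: ('m \<times> 'n \<Rightarrow> nat) set). \<Sum>q\<in>F. \<Prod>j\<in>UNIV. if dot q (\<lambda>i. x (i, j)) mod P < R then 1 else 0)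
      = (\<Sum>q\<in>F. \<Sum>x\<in>(grid P :: ('m \<times> 'n \<Rightarrow> nat) set). \<Prod>j\<in>UNIV. if dot q (\<lambda>i. x (i, j)) mod P < R then 1 else (0::real))"
    by (rule sum.swap)
  also have "\<dots> = (\<Sum>q\<in>F. c ^ CARD('n))"
  proof (rule sum.cong[OF refl])
    fix q assume "q \<in> F"
    then have q: "0 < q i0" "q i0 < P" using assms by auto
    have "(\<Sum>x\<in>grid P. if dot q x mod P < R then 1 else (0::real)) = real (card {x \<in> grid P. dot q x mod P < R})"
      by (simp add: sum.inter_filter[symmetric])
    also have "\<dots> = c" using card_residue_window[where q = q and ?i0.0 = i0, OF assms(1) q assms(3)] by (simp add: c_def)
    finally have col: "(\<Sum>x\<in>grid P. if dot q x mod P < R then 1 else (0::real)) = c" .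
    show "(\<Sum>x\<in>(grid P :: ('m \<times> 'n \<Rightarrow> nat) set). \<Prod>j\<in>UNIV. if dot q (\<lambda>i. x (i, j)) mod P < R then 1 else (0::real)) = c ^ CARD('n)"
      using column_sum_prod[of "\<lambda>_ x. if dot q x mod P < R then 1 else (0::real)" P] col by simp
  qed
  finally show ?thesis
    using assms P unfolding weight_def c_def[symmetric]
    by (simp add: c_def flip: sum_divide_distrib)
qed

lemma joint_hits_double_sum:
  "real (joint_hits P N R q u) = (\<Sum>x\<in>grid P. \<Sum>x'\<in>grid P.
     if cell P N x = cell P N x' \<and> dot q x mod P < R \<and> dot u x' mod P < R then 1 else 0)"
proof -
  have "real (joint_hits P N R q u) = (\<Sum>p\<in>{p \<in> grid P \<times> grid P.
     cell P N (fst p) = cell P N (snd p) \<and> dot q (fst p) mod P < R \<and> dot u (snd p) mod P < R}. 1)"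
    unfolding joint_hits_def by (simp, intro arg_cong[where f = card]) auto
  also have "\<dots> = (\<Sum>p\<in>grid P \<times> grid P. if cell P N (fst p) = cell P N (snd p)
     \<and> dot q (fst p) mod P < R \<and> dot u (snd p) mod P < R then 1 else 0)"
    by (rule sum.inter_filter) auto
  finally show ?thesis by (simp add: sum.cartesian_product split_def)
qed

lemma prod_if_bool:
  "(\<Prod>j\<in>(UNIV::'n::finite set). if b j then 1 else 0) = (if \<forall>j. b j then 1 else (0::real))"
  by auto

text \<open>For fixed forms \<open>q\<close> and \<open>u\<close> the condition on a pair of matrices is a product of conditions on their columns,
which produces the \<open>n\<close>-th power of the correlation on a single column.\<close>

lemma energy_weight:
  fixes F :: "('m::finite \<Rightarrow> nat) set"
  shows "energy (grid P) (cell P N) (weight P R F :: ('m \<times> 'n::finite \<Rightarrow> nat) \<Rightarrow> real)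
    = (\<Sum>q\<in>F. \<Sum>u\<in>F. (real (joint_hits P N R q u) / (real P ^ (CARD('m) - 1) * real R)\<^sup>2) ^ CARD('n)) / (real (card F))\<^sup>2"
proof -
  define c where "c = real P ^ (CARD('m) - 1) * real R"
  define D where "D = real (card F) * c ^ CARD('n)"
  define v where "v q x = (\<Prod>j\<in>UNIV. if dot q (\<lambda>i. x (i, j)) mod P < R then 1 else (0::real))"
    for q :: "'m \<Rightarrow> nat" and x :: "'m \<times> 'n \<Rightarrow> nat"
  have w: "weight P R F x = (\<Sum>q\<in>F. v q x) / D" for x :: "'m \<times> 'n \<Rightarrow> nat"
    by (simp add: weight_def v_def D_def c_def)
  have "energy (grid P) (cell P N) (weight P R F :: ('m \<times> 'n \<Rightarrow> nat) \<Rightarrow> real)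
      = (\<Sum>x\<in>grid P. \<Sum>x'\<in>grid P. \<Sum>q\<in>F. \<Sum>u\<in>F. (if cell P N x = cell P N x' then v q x * v u x' else 0)) / D\<^sup>2"
    unfolding energy_def w sum_divide_distrib times_divide_times_eq sum_product
    by (intro sum.cong refl) (auto simp: power2_eq_square sum_divide_distrib)
  also have "(\<Sum>x\<in>grid P. \<Sum>x'\<in>grid P. \<Sum>q\<in>F. \<Sum>u\<in>F. (if cell P N x = cell P N x' then v q x * v u x' else 0))
      = (\<Sum>q\<in>F. \<Sum>u\<in>F. \<Sum>x\<in>grid P. \<Sum>x'\<in>grid P. (if cell P N x = cell P N x' then v q x * v u x' else 0))"
  proof -
    have "(\<Sum>x\<in>grid P. \<Sum>x'\<in>grid P. \<Sum>q\<in>F. \<Sum>u\<in>F. (if cell P N x = cell P N x' then v q x * v u x' else 0))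
      = (\<Sum>x\<in>grid P. \<Sum>q\<in>F. \<Sum>x'\<in>grid P. \<Sum>u\<in>F. (if cell P N x = cell P N x' then v q x * v u x' else 0))"
      by (rule sum.cong[OF refl], rule sum.swap)
    also have "\<dots> = (\<Sum>x\<in>grid P. \<Sum>q\<in>F. \<Sum>u\<in>F. \<Sum>x'\<in>grid P. (if cell P N x = cell P N x' then v q x * v u x' else 0))"
      by (rule sum.cong[OF refl], rule sum.cong[OF refl], rule sum.swap)
    also have "\<dots> = (\<Sum>q\<in>F. \<Sum>x\<in>grid P. \<Sum>u\<in>F. \<Sum>x'\<in>grid P. (if cell P N x = cell P N x' then v q x * v u x' else 0))"
      by (rule sum.swap)
    also have "\<dots> = (\<Sum>q\<in>F. \<Sum>u\<in>F. \<Sum>x\<in>grid P. \<Sum>x'\<in>grid P. (if cell P N x = cell P N x' then v q x * v u x' else 0))"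
      by (rule sum.cong[OF refl], rule sum.swap)
    finally show ?thesis .
  qed
  also have "\<dots> = (\<Sum>q\<in>F. \<Sum>u\<in>F. real (joint_hits P N R q u) ^ CARD('n))"
  proof (intro sum.cong refl)
    fix q u
    define f where "f x x' = (if cell P N x = cell P N x' \<and> dot q x mod P < R \<and> dot u x' mod P < R then 1 else (0::real))"
      for x x' :: "'m \<Rightarrow> nat"
    have "(if cell P N x = cell P N x' then v q x * v u x' else 0) = (\<Prod>j\<in>UNIV. f (\<lambda>i. x (i, j)) (\<lambda>i. x' (i, j)))"
      for x x' :: "'m \<times> 'n \<Rightarrow> nat"
      unfolding f_def v_def prod_if_bool by (auto simp: cell_def fun_eq_iff)
    then have "(\<Sum>x\<in>(grid P :: ('m \<times> 'n \<Rightarrow> nat) set). \<Sum>x'\<in>(grid P :: ('m \<times> 'n \<Rightarrow> nat) set).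
          (if cell P N x = cell P N x' then v q x * v u x' else 0))
        = (\<Sum>x\<in>(grid P :: ('m \<times> 'n \<Rightarrow> nat) set). \<Sum>x'\<in>(grid P :: ('m \<times> 'n \<Rightarrow> nat) set).
            \<Prod>j\<in>UNIV. f (\<lambda>i. x (i, j)) (\<lambda>i. x' (i, j)))" by simp
    also have "\<dots> = (\<Sum>x\<in>(grid P :: ('m \<times> 'n \<Rightarrow> nat) set). \<Prod>j\<in>UNIV. \<Sum>c'\<in>grid P. f (\<lambda>i. x (i, j)) c')"
      by (rule sum.cong[OF refl], rule column_sum_prod)
    also have "\<dots> = (\<Prod>j\<in>(UNIV::'n set). \<Sum>c\<in>grid P. \<Sum>c'\<in>grid P. f c c')"
      by (rule column_sum_prod)
    also have "\<dots> = real (joint_hits P N R q u) ^ CARD('n)"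
      unfolding joint_hits_double_sum f_def by simp
    finally show "(\<Sum>x\<in>(grid P :: ('m \<times> 'n \<Rightarrow> nat) set). \<Sum>x'\<in>(grid P :: ('m \<times> 'n \<Rightarrow> nat) set).
          (if cell P N x = cell P N x' then v q x * v u x' else 0)) = real (joint_hits P N R q u) ^ CARD('n)" .
  qed
  finally show ?thesis
    unfolding c_def[symmetric] D_def
    by (simp add: power_divide power_mult_distrib mult.commute flip: sum_divide_distrib power_mult)
qed

lemma cell_power2_coarse:
  assumes "t \<le> M" "P > 0"
  shows "coarse (2 ^ (M - t)) (cell P (2 ^ M) x) = cell P (2 ^ t) x"
proof -
  have "2 ^ M = 2 ^ (M - t) * (2::nat) ^ t" using assms(1) by (simp flip: power_add)
  then show ?thesis
    by (simp add: coarse_def cell_def mult.assoc mult.commute[of P] flip: div_mult2_eq)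
qed

text \<open>At \<open>x_j / P\<close> the form \<open>q\<close> is within \<open>R / P \<le> 1 / E\<close> of an integer, and within a dyadic cube of side
\<open>2^-M \<le> 1 / (Q E)\<close> it varies by at most \<open>2 m / E\<close>.\<close>

lemma dyadic_cube_near_form:
  fixes z :: "real ^ ('m::finite \<times> 'n::finite)"
  assumes z: "z \<in> dyadic_cube M (cell P (2 ^ M) x)" and P: "P > 0"
    and q: "\<And>i. q i \<le> 2 * Q" and R: "dot q (\<lambda>i. x (i, j)) mod P < R" "R * E \<le> P" "E > 0"
    and M: "Q * E \<le> 2 ^ M"
  shows "\<bar>(\<Sum>i\<in>UNIV. real (q i) * z $ (i, j)) - real (dot q (\<lambda>i. x (i, j)) div P)\<bar> \<le> (2 * real CARD('m) + 1) / real E"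
proof -
  define d where "d = dot q (\<lambda>i. x (i, j))"
  have "\<bar>z $ (i, j) - real (x (i, j)) / real P\<bar> \<le> 1 / 2 ^ M" for i
  proof -
    define k where "k = 2 ^ M * x (i, j) div P"
    have "real k / 2 ^ M \<le> z $ (i, j)" "z $ (i, j) \<le> (real k + 1) / 2 ^ M"
      using z by (auto simp: dyadic_cube_def cell_def k_def)
    moreover have "real k / 2 ^ M \<le> real (x (i, j)) / real P" "real (x (i, j)) / real P \<le> (real k + 1) / 2 ^ M"
    proof -
      have "real (k * P) \<le> real (2 ^ M * x (i, j))" "real (2 ^ M * x (i, j)) \<le> real (k * P + P)"
        unfolding k_def using nat_div_bounds[OF P, of "2 ^ M * x (i, j)"]
        by (simp_all only: of_nat_le_iff less_imp_le)
      then show "real k / 2 ^ M \<le> real (x (i, j)) / real P" "real (x (i, j)) / real P \<le> (real k + 1) / 2 ^ M"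
        using P by (simp_all add: field_simps)
    qed
    ultimately show ?thesis by (auto simp: abs_le_iff add_divide_distrib)
  qed
  moreover have "real (q i) \<le> 2 * real Q" for i
    using of_nat_mono[OF q[of i], where 'a = real] by simp
  ultimately have "\<bar>real (q i) * (z $ (i, j) - real (x (i, j)) / real P)\<bar> \<le> (2 * real Q) * (1 / 2 ^ M)" for i
    unfolding abs_mult abs_of_nat by (intro mult_mono) auto
  then have "\<bar>\<Sum>i\<in>UNIV. real (q i) * (z $ (i, j) - real (x (i, j)) / real P)\<bar>
      \<le> (\<Sum>i\<in>(UNIV::'m set). (2 * real Q) * (1 / 2 ^ M))"
    by (intro order_trans[OF sum_abs] sum_mono)
  also have "\<dots> = 2 * real CARD('m) * (real Q / 2 ^ M)" by simp
  also have "\<dots> \<le> 2 * real CARD('m) * (1 / real E)"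
  proof (intro mult_left_mono)
    have "real (Q * E) \<le> real (2 ^ M)" using M by (rule of_nat_mono)
    then show "real Q / 2 ^ M \<le> 1 / real E" using R(3) by (simp add: field_simps)
  qed simp
  finally have 1: "\<bar>(\<Sum>i\<in>UNIV. real (q i) * z $ (i, j)) - real d / real P\<bar> \<le> 2 * real CARD('m) / real E"
    by (simp add: d_def dot_def right_diff_distrib sum_subtractf sum_divide_distrib)
  have "real d = real (d div P) * real P + real (d mod P)"
    by (metis div_mult_mod_eq of_nat_add of_nat_mult)
  then have "real d / real P - real (d div P) = real (d mod P) / real P"
    using P by (simp add: field_simps)
  moreover have "real (d mod P) / real P \<le> 1 / real E"
  proof -
    have "d mod P * E \<le> P" using R by (metis d_def less_imp_le mult_le_mono1 order_trans)
    then have "real (d mod P) * real E \<le> real P" by (metis of_nat_le_iff of_nat_mult)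
    then show ?thesis using P R(3) by (simp add: field_simps)
  qed
  moreover have "0 \<le> real (d mod P) / real P" by simp
  ultimately have "\<bar>real d / real P - real (d div P)\<bar> \<le> 1 / real E" by linarith
  with 1 show ?thesis unfolding d_def[symmetric] add_divide_distrib by linarith
qed

text \<open>All quantities are powers of two: forms of size \<open>Q = 2^a\<close>, windows of relative length \<open>1 / E = 2^-e\<close> and cubes
down to level \<open>a + e\<close>, where the variation of a form within a cube is comparable to the window.\<close>

lemma exists_pattern_weight:
  fixes T :: "'m::finite set" and i0 :: 'm
  assumes T: "i0 \<in> T"
  defines "m \<equiv> CARD('m)" and "n \<equiv> CARD('n::finite)" and "p \<equiv> card T"
  defines "K \<equiv> (2 * (3200 * 8 ^ m * (real m)\<^sup>2)) ^ n * (8::real) ^ (p + n)"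
  shows "\<exists>h :: ('m \<times> 'n \<Rightarrow> nat) \<Rightarrow> real. (\<forall>y. h y \<ge> 0) \<and> (\<Sum>y\<in>grid (2 ^ (a + e)). h y) = 1 \<and>
    (\<forall>t\<le>a + e. energy (grid (2 ^ (a + e))) (coarse (2 ^ (a + e - t))) h
        \<le> K / 2 ^ (t * (m * n)) * (1 + 2 ^ (t * n) / 2 ^ (a * (p + n)) * (real a + 2))) \<and>
    (\<forall>y\<in>grid (2 ^ (a + e)). h y \<noteq> 0 \<longrightarrow> (\<forall>z\<in>dyadic_cube (a + e) y.
        \<exists>q\<in>forms (2 ^ a) T i0. \<forall>j. \<exists>c::nat. \<bar>(\<Sum>i\<in>UNIV. real (q i) * z $ (i, j)) - real c\<bar> \<le> (2 * real m + 1) / 2 ^ e))"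
proof -
  define Q E :: nat where "Q = 2 ^ a" and "E = 2 ^ e"
  define M where "M = a + e"
  have QE: "Q * E = 2 ^ M" by (simp add: Q_def E_def M_def power_add)
  (* 4 Q^2 bounds the determinants of pairs of forms, and 2 Q E \<le> P makes the window longer than the entries. *)
  obtain P where P: "prime P" "4 * Q * Q + 2 * Q * E < P" using bigger_prime by blast
  have P0: "P > 0" using P by simp
  define R where "R = P div E"
  have E0: "E > 0" and Q0: "Q > 0" by (simp_all add: E_def Q_def)
  have RE: "R * E \<le> P" by (simp add: R_def)
  have "2 * Q * E \<le> P" using P by simp
  then have RQ: "2 * Q \<le> R" using E0 by (simp add: R_def less_eq_div_iff_mult_less_eq)
  have RP: "R \<le> P" by (simp add: R_def)
  define F where "F = (forms Q T i0 :: ('m \<Rightarrow> nat) set)"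
  define w where "w = (weight P R F :: ('m \<times> 'n \<Rightarrow> nat) \<Rightarrow> real)"
  define h where "h y = (\<Sum>x\<in>{x\<in>grid P. cell P (2 ^ M) x = y}. w x)" for y
  have w0: "w x \<ge> 0" for x by (simp add: w_def weight_nonneg)
  have cell: "cell P (2 ^ M) ` grid P \<subseteq> (grid (2 ^ M) :: ('m \<times> 'n \<Rightarrow> nat) set)"
    by (auto intro: cell_in_grid)
  have "2 * Q \<le> 4 * Q * Q" using Q0 by simp
  then have qP: "0 < q i0 \<and> q i0 < P" if "q \<in> F" for q
  proof -
    have "Q \<le> q i0" "q i0 < 2 * Q" using formsD(1,2)[of q Q T i0] that by (simp_all add: F_def)
    then show ?thesis using \<open>2 * Q \<le> 4 * Q * Q\<close> Q0 P(2) by linarith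
  qed
  have "card F > 0" using Q0 T by (simp add: F_def card_forms)
  then have Fne: "F \<noteq> {}" by auto
  have total: "(\<Sum>y\<in>grid (2 ^ M). h y) = 1"
  proof -
    have "(\<Sum>y\<in>grid (2 ^ M). h y) = (\<Sum>x\<in>grid P. w x)"
      unfolding h_def by (rule sum.group[OF _ _ cell]) auto
    also have "\<dots> = 1"
      unfolding w_def using P RQ Q0 RP Fne qP by (intro sum_weight[where ?i0.0 = i0]) (auto simp: F_def)
    finally show ?thesis .
  qed
  have en: "energy (grid (2 ^ M)) (coarse (2 ^ (M - t))) h
      \<le> K / 2 ^ (t * (m * n)) * (1 + 2 ^ (t * n) / 2 ^ (a * (p + n)) * (real a + 2))" if t: "t \<le> M" for t
  proof -
    define N :: nat where "N = 2 ^ t"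
    have N: "0 < N" "N \<le> P" "N \<le> Q * E"
    proof -
      show "0 < N" by (simp add: N_def)
      show "N \<le> Q * E" unfolding QE N_def using t by (intro power_increasing) auto
      with P(2) show "N \<le> P" by simp
    qed
    have "energy (grid (2 ^ M)) (coarse (2 ^ (M - t))) h = energy (grid P) (cell P N) w"
      unfolding h_def using energy_pushforward[OF _ _ cell, where w = w and f = "coarse (2 ^ (M - t))"]
      by (simp add: cell_power2_coarse[OF t P0] N_def)
    also have "\<dots> = (\<Sum>q\<in>F. \<Sum>u\<in>F. (real (joint_hits P N R q u) / (real P ^ (m - 1) * real R)\<^sup>2) ^ n) / (real (card F))\<^sup>2"
      unfolding w_def m_def n_def by (rule energy_weight)
    also have "\<dots> \<le> K / real N ^ (m * n) * (1 + real N ^ n / real Q ^ (p + n) * harm (2 * Q))"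
      unfolding F_def m_def p_def K_def
      by (rule mean_joint_hits_power_le[OF P(1) _ Q0 RQ N RE T]) (use P in \<open>auto simp: n_def\<close>)
    also have "\<dots> \<le> K / real N ^ (m * n) * (1 + real N ^ n / real Q ^ (p + n) * (real a + 2))"
    proof -
      have "harm (2 * Q) \<le> real a + 2" using harm_power2_le[of "Suc a"] by (simp add: Q_def)
      then show ?thesis by (intro mult_left_mono add_mono order_refl) (auto simp: K_def)
    qed
    finally show ?thesis by (simp add: N_def Q_def power_mult)
  qed
  have supp: "\<exists>q\<in>forms (2 ^ a) T i0. \<forall>j. \<exists>c::nat. \<bar>(\<Sum>i\<in>UNIV. real (q i) * z $ (i, j)) - real c\<bar> \<le> (2 * real m + 1) / 2 ^ e"
    if y: "h y \<noteq> 0" "z \<in> dyadic_cube M y" for y z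
  proof -
    obtain x where x: "cell P (2 ^ M) x = y" "w x \<noteq> 0"
      using y(1) unfolding h_def by (metis (mono_tags, lifting) mem_Collect_eq sum.neutral)
    then have "(\<Sum>q\<in>F. \<Prod>j\<in>(UNIV::'n set). if dot q (\<lambda>i. x (i, j)) mod P < R then 1 else (0::real)) \<noteq> 0"
      by (auto simp: w_def weight_def)
    then obtain q where q: "q \<in> F" "(\<Prod>j\<in>(UNIV::'n set). if dot q (\<lambda>i. x (i, j)) mod P < R then 1 else (0::real)) \<noteq> 0"
      by (meson sum.neutral)
    have q2: "q i \<le> 2 * Q" for i using formsD(5)[of q Q T i0 i] q(1) by (simp add: F_def)
    have "dot q (\<lambda>i. x (i, j)) mod P < R" for j using q(2) unfolding prod_if_bool by presburger
    then have "\<bar>(\<Sum>i\<in>UNIV. real (q i) * z $ (i, j)) - real (dot q (\<lambda>i. x (i, j)) div P)\<bar>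
        \<le> (2 * real CARD('m) + 1) / real E" for j
      using y(2) x(1) QE by (intro dyadic_cube_near_form[where M = M and R = R and Q = Q] P0 q2 RE E0) auto
    then show ?thesis using q(1) unfolding F_def Q_def E_def m_def by (intro bexI[of _ q] allI exI) auto
  qed
  show ?thesis
    by (intro exI[of _ h] conjI allI impI ballI)
       (use total en supp in \<open>auto simp: h_def w0 sum_nonneg M_def\<close>)
qed

text \<open>The right-hand side is \<open>\<kappa> B^(-\<tau>)\<close>, where \<open>B = 2^L 2^(a+1)\<close> bounds the entries of \<open>2^L q\<close>, the form that is
near an integer at the original point when \<open>z\<close> is the fractional part of \<open>2^L\<close> times that point.\<close>

definition near_form :: "real \<Rightarrow> real \<Rightarrow> 'm::finite set \<Rightarrow> 'm \<Rightarrow> nat \<Rightarrow> (real ^ ('m \<times> 'n::finite)) set" where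
  "near_form \<tau> \<kappa> T i0 L = {z. \<exists>a. \<exists>q\<in>forms (2 ^ a) T i0. \<forall>j. \<exists>c::nat.
     \<bar>(\<Sum>i\<in>UNIV. real (q i) * z $ (i, j)) - real c\<bar> \<le> \<kappa> * (2 ^ (L + a + 1)) powr (- \<tau>)}"

lemma eventually_linear_times_decay_le:
  fixes \<delta> :: real
  assumes "\<delta> > 0"
  shows "eventually (\<lambda>a::nat. (real a + 2) * 2 powr (- real a * \<delta>) \<le> 1) sequentially"
proof -
  define x where "x = 2 powr (- \<delta>)"
  have x: "0 < x" "norm x < 1"
    using powr_less_mono[of "- \<delta>" 0 2] assms by (simp_all add: x_def)
  have "(\<lambda>a. real a * x ^ a + 2 * x ^ a) \<longlonglongrightarrow> 0 + 2 * 0"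
    by (intro tendsto_intros powser_times_n_limit_0 x LIMSEQ_power_zero)
  then have "eventually (\<lambda>a. real a * x ^ a + 2 * x ^ a < 1) sequentially"
    by (intro order_tendstoD(2)[of _ 0]) auto
  then show ?thesis
  proof eventually_elim
    case (elim a)
    have "x ^ a = 2 powr (- real a * \<delta>)"
      using x by (simp add: x_def powr_powr mult.commute flip: powr_realpow)
    with elim show ?case by (simp add: distrib_right)
  qed
qed

lemma eventually_decay_le:
  fixes \<delta> B :: real
  assumes "\<delta> > 0" "B > 0"
  shows "eventually (\<lambda>a::nat. 2 powr (- real a * \<delta>) \<le> B) sequentially"
proof -
  define x where "x = 2 powr (- \<delta>)"
  have x: "0 < x" "norm x < 1"
    using powr_less_mono[of "- \<delta>" 0 2] assms by (simp_all add: x_def)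
  have "(\<lambda>a. x ^ a) \<longlonglongrightarrow> 0" by (intro LIMSEQ_power_zero x)
  then have "eventually (\<lambda>a. x ^ a < B) sequentially"
    using assms by (intro order_tendstoD(2)[of _ 0]) auto
  then show ?thesis
  proof eventually_elim
    case (elim a)
    have "x ^ a = 2 powr (- real a * \<delta>)"
      using x by (simp add: x_def powr_powr mult.commute flip: powr_realpow)
    with elim show ?case by simp
  qed
qed

text \<open>Up to constants, the energy at level \<open>t\<close> is \<open>2^(-t m n) (1 + 2^(t n - a (p + n)) (a + 2))\<close> with \<open>p = card T\<close>. This is
\<open>O(2^(-t s1))\<close> for all \<open>t \<le> a + e\<close> provided \<open>s1 \<le> m n\<close> and \<open>(a + e) (s1 - (m - 1) n)\<close> is below \<open>a (p + n)\<close> by a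
multiple of \<open>a\<close>. With \<open>e\<close> about \<open>\<sigma> a\<close> the latter means \<open>(1 + \<sigma>) (s1 - (m - 1) n) < p + n\<close>, which can be achieved
with some \<open>\<sigma> > \<tau>\<close>. The excess of \<open>\<sigma>\<close> over \<open>\<tau>\<close> compensates, for large \<open>a\<close>, the factor \<open>2^L\<close> and all constants
in the required distance to the integers; the constant in the energy bound does not depend on \<open>L\<close>.\<close>

lemma exists_pattern_near_form:
  fixes T :: "'m::finite set" and i0 :: 'm and \<tau> \<kappa> s :: real
  assumes T: "i0 \<in> T" and \<tau>: "\<tau> > 0" and \<kappa>: "\<kappa> > 0" and s: "s > 0"
    "s < (real CARD('m) - 1) * real CARD('n::finite) + real (card T + CARD('n)) / (\<tau> + 1)"
    "s < real CARD('m) * real CARD('n)"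
  shows "\<exists>C\<ge>1. \<forall>L. \<exists>\<Delta> h. \<Delta> > 0 \<and> pattern s C \<Delta> h \<and>
    (\<forall>y\<in>grid (2 ^ \<Delta>). h y \<noteq> 0 \<longrightarrow> dyadic_cube \<Delta> y \<subseteq> (near_form \<tau> \<kappa> T i0 L :: (real ^ ('m \<times> 'n)) set))"
proof -
  define m n p where "m = CARD('m)" and "n = CARD('n)" and "p = card T"
  define w where "w = real (p + n)"
  define b where "b = (real m - 1) * real n"
  have w0: "w > 0" by (simp add: w_def n_def add_nonneg_pos)
  have b0: "b \<ge> 0" by (simp add: b_def m_def Suc_le_eq)
  (* An exponent above s, to absorb the constant in the final energy, and above b, so that lam > 0. *)
  define s1 where "s1 = (max s b + min (b + real n) (b + w / (\<tau> + 1))) / 2"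
  have bn: "b + real n = real m * real n" by (simp add: b_def left_diff_distrib)
  have "max s b < min (b + real n) (b + w / (\<tau> + 1))"
    unfolding bn using s w0 \<tau> by (auto simp: b_def w_def m_def n_def p_def left_diff_distrib)
  then have "max s b < s1 \<and> s1 < min (b + real n) (b + w / (\<tau> + 1))"
    unfolding s1_def by argo
  then have s1: "s < s1" "b < s1" "s1 < real m * real n" "s1 < b + w / (\<tau> + 1)"
    unfolding bn[symmetric] max_less_iff_conj min_less_iff_conj by simp_all
  define lam where "lam = s1 - b"
  have lam: "lam > 0" "lam * (\<tau> + 1) < w" using s1 \<tau> by (auto simp: lam_def field_simps)
  (* The interval between \<tau> and w / lam - 1 is nonempty because lam * (\<tau> + 1) < w. *)
  define \<sigma> where "\<sigma> = (\<tau> + (w / lam - 1)) / 2"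
  have "\<tau> < w / lam - 1" using lam by (simp add: field_simps)
  then have "\<tau> < \<sigma> \<and> \<sigma> < w / lam - 1" unfolding \<sigma>_def by argo
  then have \<sigma>: "\<tau> < \<sigma>" "lam * (1 + \<sigma>) < w" using lam by (auto simp: field_simps)
  define \<delta> where "\<delta> = w - lam * (1 + \<sigma>)"
  have \<delta>: "\<delta> > 0" using \<sigma> by (simp add: \<delta>_def)
  define K where "K = (2 * (3200 * 8 ^ m * (real m)\<^sup>2)) ^ n * (8::real) ^ (p + n)"
  have K0: "K > 0" by (simp add: K_def m_def)
  define C1 where "C1 = K * (1 + 2 powr lam)"
  have C10: "C1 > 0" using K0 by (simp add: C1_def add_pos_nonneg)
  show ?thesis
  proof (intro exI[of _ "max 1 C1"] conjI allI)
    fix L :: nat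
    have "eventually (\<lambda>a. 2 powr (- real a * (s1 - s)) \<le> 1 / C1) sequentially"
      by (rule eventually_decay_le) (use s1 C10 in auto)
    moreover define \<beta> where "\<beta> = \<kappa> * 2 powr (- \<tau> * real (L + 1)) / (2 * real m + 1)"
    have "\<beta> > 0" unfolding \<beta>_def using \<kappa> by (intro divide_pos_pos mult_pos_pos) auto
    then have "eventually (\<lambda>a. 2 powr (- real a * (\<sigma> - \<tau>)) \<le> \<beta>) sequentially"
      by (intro eventually_decay_le) (use \<sigma> in auto)
    moreover note eventually_linear_times_decay_le[OF \<delta>] eventually_gt_at_top[of "0::nat"]
    ultimately have "eventually (\<lambda>a. a > 0 \<and> 2 powr (- real a * (s1 - s)) \<le> 1 / C1 \<and>
       2 powr (- real a * (\<sigma> - \<tau>)) \<le> \<beta> \<and> (real a + 2) * 2 powr (- real a * \<delta>) \<le> 1) sequentially"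
      by eventually_elim auto
    then obtain a :: nat where a: "a > 0" "2 powr (- real a * (s1 - s)) \<le> 1 / C1"
       "2 powr (- real a * (\<sigma> - \<tau>)) \<le> \<beta>" "(real a + 2) * 2 powr (- real a * \<delta>) \<le> 1"
      using eventually_happens trivial_limit_sequentially by blast
    define e where "e = nat \<lceil>\<sigma> * real a\<rceil>"
    have \<sigma>a: "\<sigma> * real a \<ge> 0" using \<sigma> \<tau> by simp
    have e: "\<sigma> * real a \<le> real e" "real e \<le> \<sigma> * real a + 1"
      using \<sigma>a unfolding e_def by linarith+
    define M where "M = a + e"
    obtain h :: "('m \<times> 'n \<Rightarrow> nat) \<Rightarrow> real" where h: "\<And>y. h y \<ge> 0" "(\<Sum>y\<in>grid (2 ^ M). h y) = 1"
      "\<And>t. t \<le> M \<Longrightarrow> energy (grid (2 ^ M)) (coarse (2 ^ (M - t))) h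
        \<le> K / 2 ^ (t * (m * n)) * (1 + 2 ^ (t * n) / 2 ^ (a * (p + n)) * (real a + 2))"
      "\<And>y z. y \<in> grid (2 ^ M) \<Longrightarrow> h y \<noteq> 0 \<Longrightarrow> z \<in> dyadic_cube M y \<Longrightarrow>
        \<exists>q\<in>forms (2 ^ a) T i0. \<forall>j. \<exists>c::nat. \<bar>(\<Sum>i\<in>UNIV. real (q i) * z $ (i, j)) - real c\<bar> \<le> (2 * real m + 1) / 2 ^ e"
      using exists_pattern_weight[OF T, where 'n = 'n and a = a and e = e]
      unfolding m_def n_def p_def M_def K_def by blast
    have en: "energy (grid (2 ^ M)) (coarse (2 ^ (M - t))) h \<le> C1 * 2 powr (- real t * s1)" if t: "t \<le> M" for t
    proof -
      have 1: "1 / 2 ^ (t * (m * n)) \<le> 2 powr (- real t * s1)"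
      proof -
        have "1 / 2 ^ (t * (m * n)) = 2 powr (- (real t * (real m * real n)))"
          by (simp add: powr_minus_divide powr_realpow flip: of_nat_mult)
        also have "\<dots> \<le> 2 powr (- real t * s1)"
        proof (intro powr_mono)
          have "real t * s1 \<le> real t * (real m * real n)" using s1 by (intro mult_left_mono) auto
          then show "- (real t * (real m * real n)) \<le> - real t * s1" by simp
        qed simp
        finally show ?thesis .
      qed
      have 2: "1 / 2 ^ (t * (m * n)) * (2 ^ (t * n) / 2 ^ (a * (p + n)) * (real a + 2))
          \<le> 2 powr (- real t * s1) * 2 powr lam"
      proof -
        have "1 / 2 ^ (t * (m * n)) * (2 ^ (t * n) / 2 ^ (a * (p + n)))
            = 2 powr (- (real t * (real m * real n)) + (real t * real n - real a * w))"
          by (simp add: powr_add powr_diff powr_minus_divide powr_realpow w_def flip: of_nat_mult of_nat_add)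
        also have "- (real t * (real m * real n)) + (real t * real n - real a * w)
            = - real t * s1 + (real t * lam - real a * w)"
          by (simp add: lam_def b_def algebra_simps)
        also have "2 powr \<dots> \<le> 2 powr (- real t * s1 + (lam - real a * \<delta>))"
        proof (intro powr_mono add_left_mono)
          have "real t \<le> real a * (1 + \<sigma>) + 1" using t e by (simp add: M_def algebra_simps)
          then have "real t * lam \<le> (real a * (1 + \<sigma>) + 1) * lam" using lam by (intro mult_right_mono) auto
          then show "real t * lam - real a * w \<le> lam - real a * \<delta>" by (simp add: \<delta>_def algebra_simps)
        qed simp
        also have "\<dots> = 2 powr (- real t * s1) * 2 powr lam * 2 powr (- real a * \<delta>)"
          by (simp add: powr_add powr_diff powr_minus_divide)
        finally have "1 / 2 ^ (t * (m * n)) * (2 ^ (t * n) / 2 ^ (a * (p + n))) * (real a + 2)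
            \<le> 2 powr (- real t * s1) * 2 powr lam * 2 powr (- real a * \<delta>) * (real a + 2)"
          by (intro mult_right_mono) auto
        also have "\<dots> = 2 powr (- real t * s1) * 2 powr lam * ((real a + 2) * 2 powr (- real a * \<delta>))"
          by (simp only: mult_ac)
        also have "\<dots> \<le> 2 powr (- real t * s1) * 2 powr lam * 1"
          using a(4) by (intro mult_left_mono) auto
        finally show ?thesis by simp
      qed
      have "energy (grid (2 ^ M)) (coarse (2 ^ (M - t))) h
          \<le> K * (1 / 2 ^ (t * (m * n)) + 1 / 2 ^ (t * (m * n)) * (2 ^ (t * n) / 2 ^ (a * (p + n)) * (real a + 2)))"
        using h(3)[OF t] by (simp add: distrib_left)
      also have "\<dots> \<le> K * (2 powr (- real t * s1) + 2 powr (- real t * s1) * 2 powr lam)"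
        using K0 1 2 by (intro mult_left_mono add_mono) auto
      also have "\<dots> = C1 * 2 powr (- real t * s1)" by (simp add: C1_def algebra_simps)
      finally show ?thesis .
    qed
    have "pattern s (max 1 C1) M h"
      unfolding pattern_def
    proof (intro conjI allI impI)
      fix t assume t: "t \<le> M"
      have "real t * s \<le> real t * s1" using s1 by (intro mult_left_mono) auto
      then have "2 powr (- real t * s1) \<le> 2 powr (- real t * s)" by (intro powr_mono) auto
      then have "C1 * 2 powr (- real t * s1) \<le> max 1 C1 * 2 powr (- real t * s)"
        using C10 by (intro mult_mono) auto
      then show "energy (grid (2 ^ M)) (coarse (2 ^ (M - t))) h \<le> max 1 C1 * 2 powr (- real t * s)"
        using en[OF t] by linarith
    next
      have "energy (grid (2 ^ M)) id h \<le> C1 * 2 powr (- real M * s1)" using en[of M] by simp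
      also have "2 powr (- real M * s1) = 2 powr (- real M * s) * 2 powr (- real M * (s1 - s))"
        by (simp add: algebra_simps flip: powr_add)
      also have "C1 * (2 powr (- real M * s) * 2 powr (- real M * (s1 - s)))
          \<le> C1 * (2 powr (- real M * s) * (1 / C1))"
      proof (intro mult_left_mono)
        have "real a * (s1 - s) \<le> real M * (s1 - s)" using s1 by (intro mult_right_mono) (auto simp: M_def)
        then have "2 powr (- real M * (s1 - s)) \<le> 2 powr (- real a * (s1 - s))" by (intro powr_mono) auto
        with a(2) show "2 powr (- real M * (s1 - s)) \<le> 1 / C1" by linarith
      qed (use C10 in auto)
      also have "\<dots> = 2 powr (- real M * s)" using C10 by simp
      finally show "energy (grid (2 ^ M)) id h \<le> 2 powr (- real M * s)" .
    qed (use h in auto)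
    moreover have "dyadic_cube M y \<subseteq> near_form \<tau> \<kappa> T i0 L" if y: "y \<in> grid (2 ^ M)" "h y \<noteq> 0" for y
    proof
      fix z assume "z \<in> dyadic_cube M y"
      then obtain q where q: "q \<in> forms (2 ^ a) T i0"
        "\<forall>j. \<exists>c::nat. \<bar>(\<Sum>i\<in>UNIV. real (q i) * z $ (i, j)) - real c\<bar> \<le> (2 * real m + 1) / 2 ^ e"
        using h(4)[OF y] by blast
      have "(2 * real m + 1) / 2 ^ e = (2 * real m + 1) * 2 powr (- real e)"
        by (simp add: powr_minus_divide powr_realpow)
      also have "\<dots> \<le> (2 * real m + 1) * 2 powr (- real a * (\<sigma> - \<tau>) + (- real a * \<tau>))"
        using e by (intro mult_left_mono powr_mono) (auto simp: algebra_simps)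
      also have "\<dots> = (2 * real m + 1) * 2 powr (- real a * (\<sigma> - \<tau>)) * 2 powr (- real a * \<tau>)"
        by (simp only: powr_add mult.assoc)
      also have "\<dots> \<le> (2 * real m + 1) * \<beta> * 2 powr (- real a * \<tau>)"
        using a(3) by (intro mult_right_mono mult_left_mono) auto
      also have "\<dots> = \<kappa> * (2 powr (- \<tau> * real (L + 1)) * 2 powr (- real a * \<tau>))"
        by (simp add: \<beta>_def)
      also have "2 powr (- \<tau> * real (L + 1)) * 2 powr (- real a * \<tau>) = (2 powr real (L + a + 1)) powr (- \<tau>)"
        by (simp add: powr_powr algebra_simps flip: powr_add)
      also have "2 powr real (L + a + 1) = 2 ^ (L + a + 1)" by (rule powr_realpow) simp
      finally show "z \<in> near_form \<tau> \<kappa> T i0 L"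
        unfolding near_form_def mem_Collect_eq
        using q by (intro exI[of _ a] bexI[of _ q]) (meson order_trans)+
    qed
    ultimately show "\<exists>\<Delta> h. \<Delta> > 0 \<and> pattern s (max 1 C1) \<Delta> h \<and>
        (\<forall>y\<in>grid (2 ^ \<Delta>). h y \<noteq> 0 \<longrightarrow> dyadic_cube \<Delta> y \<subseteq> (near_form \<tau> \<kappa> T i0 L :: (real ^ ('m \<times> 'n)) set))"
      using a(1) by (intro exI[of _ M] exI[of _ h]) (auto simp: M_def)
  qed simp
qed

section \<open>A chart of matrices and the lower bound\<close>

text \<open>The invertible block: a small perturbation of a multiple of the identity, chosen such that every matrix
\<open>block_chart \<iota> z\<close> for \<open>z\<close> in the unit cube has entries of at most \<open>1/2\<close>.\<close>

definition square_block :: "('n \<Rightarrow> 'm) \<Rightarrow> real ^ ('m::finite \<times> 'n::finite) \<Rightarrow> 'n \<Rightarrow> 'n \<Rightarrow> real" where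
  "square_block \<iota> z j l = (if l = j then 1/4 else 0) + z $ (\<iota> j, l) / (16 * real CARD('n))"

text \<open>The rows in the range of \<open>\<iota>\<close> form the block \<open>A\<close>, and the other rows are those of \<open>Y A\<close>, where \<open>Y\<close> consists of the
rows of \<open>z\<close> outside the range of \<open>\<iota>\<close>.\<close>

definition block_chart :: "('n \<Rightarrow> 'm) \<Rightarrow> real ^ ('m::finite \<times> 'n::finite) \<Rightarrow> real ^ 'n ^ 'm" where
  "block_chart \<iota> z = (\<chi> i l. if i \<in> range \<iota> then square_block \<iota> z (inv \<iota> i) l
     else (\<Sum>j\<in>UNIV. z $ (i, j) * square_block \<iota> z j l))"

lemma square_block_bounds:
  fixes z :: "real ^ ('m::finite \<times> 'n::finite)"
  assumes "\<And>p. 0 \<le> z $ p \<and> z $ p \<le> 1"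
  shows "0 \<le> square_block \<iota> z j l" "square_block \<iota> z j l \<le> 1/2"
    "square_block \<iota> z j l \<le> (if l = j then 1/4 else 0) + 1 / (16 * real CARD('n))"
proof -
  have n: "real CARD('n) \<ge> 1" by (simp add: Suc_le_eq)
  have z: "0 \<le> z $ (\<iota> j, l)" "z $ (\<iota> j, l) \<le> 1" using assms by auto
  have 1: "0 \<le> z $ (\<iota> j, l) / (16 * real CARD('n))" using z by simp
  have 2: "z $ (\<iota> j, l) / (16 * real CARD('n)) \<le> 1 / (16 * real CARD('n))"
    using z by (intro divide_right_mono) auto
  have 3: "1 / (16 * real CARD('n)) \<le> 1/16" using n by (simp add: field_simps)
  define t where "t = z $ (\<iota> j, l) / (16 * real CARD('n))"
  have sb: "square_block \<iota> z j l = (if l = j then 1/4 else 0) + t" by (simp add: square_block_def t_def)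
  have t: "0 \<le> t" "t \<le> 1 / (16 * real CARD('n))" "t \<le> 1/16"
    using 1 2 3 unfolding t_def by linarith+
  show "0 \<le> square_block \<iota> z j l" "square_block \<iota> z j l \<le> 1/2"
    "square_block \<iota> z j l \<le> (if l = j then 1/4 else 0) + 1 / (16 * real CARD('n))"
    unfolding sb using t by simp_all
qed

lemma block_chart_in_cube:
  fixes z :: "real ^ ('m::finite \<times> 'n::finite)"
  assumes z: "\<And>p. 0 \<le> z $ p \<and> z $ p \<le> 1"
  shows "block_chart \<iota> z \<in> centered_cube"
  unfolding centered_cube_def mem_Collect_eq
proof (intro allI)
  fix i l
  have "0 \<le> block_chart \<iota> z $ i $ l \<and> block_chart \<iota> z $ i $ l \<le> 1/2"
  proof (cases "i \<in> range \<iota>")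
    case True
    then show ?thesis using square_block_bounds[OF z] by (simp add: block_chart_def)
  next
    case False
    have "(\<Sum>j\<in>UNIV. z $ (i, j) * square_block \<iota> z j l)
        \<le> (\<Sum>j\<in>UNIV. 1 * ((if l = j then 1/4 else 0) + 1 / (16 * real CARD('n))))"
      using z square_block_bounds[OF z] by (intro sum_mono mult_mono) auto
    also have "\<dots> \<le> 1/2" by (simp add: sum.distrib)
    finally have "(\<Sum>j\<in>UNIV. z $ (i, j) * square_block \<iota> z j l) \<le> 1/2" .
    moreover have "0 \<le> (\<Sum>j\<in>UNIV. z $ (i, j) * square_block \<iota> z j l)"
      using z square_block_bounds[OF z] by (intro sum_nonneg mult_nonneg_nonneg) auto
    ultimately show ?thesis using False by (simp add: block_chart_def)
  qed
  then show "- (1/2) \<le> block_chart \<iota> z $ i $ l \<and> block_chart \<iota> z $ i $ l \<le> 1/2" by linarith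
qed

text \<open>Consider an entry of \<open>z - z'\<close> of maximal modulus \<open>M\<close>. In a row of the block it appears multiplied by
\<open>1 / (16 n)\<close>. In another row it appears multiplied by \<open>1/4\<close>, and the perturbation of the block changes
this by at most \<open>n * 2 M / (16 n) = M / 8\<close>.\<close>

lemma block_chart_expanding:
  fixes z z' :: "real ^ ('m::finite \<times> 'n::finite)"
  assumes \<iota>: "inj \<iota>" and z: "\<And>p. 0 \<le> z $ p \<and> z $ p \<le> 1" and z': "\<And>p. 0 \<le> z' $ p \<and> z' $ p \<le> 1"
  shows "1 / (16 * real CARD('n) * real CARD('m \<times> 'n)) * dist z z' \<le> dist (block_chart \<iota> z) (block_chart \<iota> z')"
proof -
  define \<Delta> where "\<Delta> = z - z'"
  define D where "D = block_chart \<iota> z - block_chart \<iota> z'"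
  define b where "b = 1 / (16 * real CARD('n))"
  have n: "real CARD('n) \<ge> 1" by (simp add: Suc_le_eq)
  have b: "b > 0" "b \<le> 1/16" using n by (simp_all add: b_def field_simps)
  obtain p where p: "infnorm \<Delta> = \<bar>\<Delta> $ p\<bar>" using infnorm_attained by blast
  obtain i l where il: "p = (i, l)" by (cases p)
  define M where "M = infnorm \<Delta>"
  have M: "\<bar>\<Delta> $ p\<bar> \<le> M" for p unfolding M_def by (rule component_le_infnorm_cart)
  have M0: "M \<ge> 0" unfolding M_def by (rule infnorm_pos_le)
  have "b * M \<le> norm D"
  proof (cases "i \<in> range \<iota>")
    case True
    then obtain j where j: "i = \<iota> j" by auto
    have "D $ i $ l = b * \<Delta> $ p"
      using \<iota> by (simp add: D_def block_chart_def square_block_def j il \<Delta>_def b_def diff_divide_distrib)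
    then have "\<bar>D $ i $ l\<bar> = b * M" using b p by (simp add: abs_mult M_def)
    then show ?thesis using abs_entry_le_norm[of D i l] by simp
  next
    case False
    define e where "e j = z $ (i, j) * z $ (\<iota> j, l) - z' $ (i, j) * z' $ (\<iota> j, l)" for j
    have e: "\<bar>e j\<bar> \<le> 2 * M" for j
    proof -
      have "e j = z $ (i, j) * \<Delta> $ (\<iota> j, l) + z' $ (\<iota> j, l) * \<Delta> $ (i, j)"
        by (simp add: e_def \<Delta>_def algebra_simps)
      moreover have "\<bar>z $ (i, j) * \<Delta> $ (\<iota> j, l)\<bar> \<le> 1 * M"
        unfolding abs_mult using z[of "(i, j)"] M by (intro mult_mono) auto
      moreover have "\<bar>z' $ (\<iota> j, l) * \<Delta> $ (i, j)\<bar> \<le> 1 * M"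
        unfolding abs_mult using z'[of "(\<iota> j, l)"] M by (intro mult_mono) auto
      ultimately show ?thesis by linarith
    qed
    have sq: "(\<Sum>j\<in>UNIV. y $ (i, j) * square_block \<iota> y j l) = y $ (i, l) / 4 + b * (\<Sum>j\<in>UNIV. y $ (i, j) * y $ (\<iota> j, l))"
      for y :: "real ^ ('m \<times> 'n)"
    proof -
      have "(\<Sum>j\<in>UNIV. y $ (i, j) * square_block \<iota> y j l)
          = (\<Sum>j\<in>UNIV. (if l = j then y $ (i, j) / 4 else 0) + b * (y $ (i, j) * y $ (\<iota> j, l)))"
        by (intro sum.cong) (auto simp: square_block_def b_def distrib_left)
      then show ?thesis by (simp add: sum.distrib sum_distrib_left)
    qed
    have "block_chart \<iota> y $ i $ l = y $ (i, l) / 4 + b * (\<Sum>j\<in>UNIV. y $ (i, j) * y $ (\<iota> j, l))" for y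
      unfolding sq[symmetric] using False by (simp add: block_chart_def)
    then have "D $ i $ l = \<Delta> $ p / 4 + b * (\<Sum>j\<in>UNIV. e j)"
      by (simp add: D_def il \<Delta>_def e_def sum_subtractf right_diff_distrib diff_divide_distrib)
    moreover have "\<bar>b * (\<Sum>j\<in>UNIV. e j)\<bar> \<le> M / 8"
    proof -
      have "\<bar>\<Sum>j\<in>UNIV. e j\<bar> \<le> (\<Sum>j\<in>(UNIV::'n set). 2 * M)"
        by (intro order_trans[OF sum_abs] sum_mono e)
      then have "b * \<bar>\<Sum>j\<in>UNIV. e j\<bar> \<le> b * (real CARD('n) * (2 * M))" using b by (intro mult_left_mono) auto
      also have "\<dots> = M / 8" using n by (simp add: b_def)
      finally show ?thesis using b by (simp add: abs_mult)
    qed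
    moreover have "\<bar>\<Delta> $ p\<bar> = M" using p by (simp add: M_def)
    ultimately have "\<bar>D $ i $ l\<bar> \<ge> M / 8" by linarith
    moreover have "b * M \<le> 1/16 * M" using b M0 by (intro mult_right_mono) auto
    ultimately show ?thesis using abs_entry_le_norm[of D i l] M0 by linarith
  qed
  moreover have "norm \<Delta> \<le> real CARD('m \<times> 'n) * M"
  proof -
    have "norm \<Delta> \<le> (\<Sum>p\<in>UNIV. \<bar>\<Delta> $ p\<bar>)" by (rule norm_le_l1_cart)
    also have "\<dots> \<le> (\<Sum>p\<in>(UNIV :: ('m \<times> 'n) set). M)" by (intro sum_mono M)
    finally show ?thesis by simp
  qed
  then have "1 / (16 * real CARD('n) * real CARD('m \<times> 'n)) * norm \<Delta> \<le> b * M"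
    unfolding b_def by (simp add: field_simps)
  ultimately show ?thesis by (simp add: dist_norm \<Delta>_def D_def)
qed

text \<open>This is \<open>q X = (q' + q'' Y) A\<close>.\<close>

lemma block_chart_form:
  fixes z :: "real ^ ('m::finite \<times> 'n::finite)" and r :: "int ^ 'm"
  assumes \<iota>: "inj \<iota>"
  shows "(real_vec r v* block_chart \<iota> z) $ l
    = (\<Sum>j\<in>UNIV. ((\<Sum>i\<in>UNIV - range \<iota>. real_of_int (r $ i) * z $ (i, j)) + real_of_int (r $ \<iota> j)) * square_block \<iota> z j l)"
proof -
  have "(real_vec r v* block_chart \<iota> z) $ l = (\<Sum>i\<in>UNIV. real_of_int (r $ i) * block_chart \<iota> z $ i $ l)"
    by (simp add: vector_matrix_component real_vec_def)
  also have "\<dots> = (\<Sum>i\<in>UNIV - range \<iota>. real_of_int (r $ i) * block_chart \<iota> z $ i $ l)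
      + (\<Sum>i\<in>range \<iota>. real_of_int (r $ i) * block_chart \<iota> z $ i $ l)"
    by (rule sum.subset_diff) auto
  also have "(\<Sum>i\<in>range \<iota>. real_of_int (r $ i) * block_chart \<iota> z $ i $ l)
      = (\<Sum>j\<in>UNIV. real_of_int (r $ \<iota> j) * square_block \<iota> z j l)"
    using \<iota> by (subst sum.reindex) (auto simp: block_chart_def)
  also have "(\<Sum>i\<in>UNIV - range \<iota>. real_of_int (r $ i) * block_chart \<iota> z $ i $ l)
      = (\<Sum>j\<in>UNIV. (\<Sum>i\<in>UNIV - range \<iota>. real_of_int (r $ i) * z $ (i, j)) * square_block \<iota> z j l)"
  proof -
    have "(\<Sum>i\<in>UNIV - range \<iota>. real_of_int (r $ i) * block_chart \<iota> z $ i $ l)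
      = (\<Sum>i\<in>UNIV - range \<iota>. \<Sum>j\<in>UNIV. real_of_int (r $ i) * z $ (i, j) * square_block \<iota> z j l)"
      by (intro sum.cong) (auto simp: block_chart_def sum_distrib_left mult.assoc)
    then show ?thesis by (subst (asm) sum.swap) (simp add: sum_distrib_right)
  qed
  finally show ?thesis by (simp add: distrib_right sum.distrib)
qed

text \<open>The form \<open>q\<close> near an integer at the fractional part of \<open>2^L z\<close> gives \<open>2^L q\<close> for the rows outside the block;
the nearest integers, with the integral parts \<open>a\<close> put back, give the entries \<open>-N\<close> for the rows of the block.
The latter are at most \<open>m + 1\<close> times as large as the bound \<open>B\<close> for the former, which is why the factor
\<open>(m + 1)^(-\<tau>)\<close> occurs in the assumption.\<close>

lemma form_of_near_form:
  fixes z :: "real ^ ('m::finite \<times> 'n::finite)" and \<iota> :: "'n \<Rightarrow> 'm"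
  assumes \<iota>: "inj \<iota>" and i0: "i0 \<notin> range \<iota>" and \<tau>: "\<tau> > 0"
    and z: "\<And>p. 0 \<le> z $ p \<and> z $ p \<le> 1"
    and near: "(\<chi> i. 2 ^ L * z $ i - real (a i)) \<in> near_form \<tau> ((real CARD('m) + 1) powr (- \<tau>) / real CARD('n)) (UNIV - range \<iota>) i0 L"
  obtains r :: "int ^ 'm" where "r $ i0 \<ge> 2 ^ L"
    "infnorm (real_vec r v* block_chart \<iota> z) < infnorm (real_vec r) powr (- \<tau>)"
proof -
  define T where "T = UNIV - range \<iota>"
  define m n where "m = real CARD('m)" and "n = real CARD('n)"
  have mn: "m \<ge> 1" "n \<ge> 1" by (simp_all add: m_def n_def Suc_le_eq)
  define \<kappa> where "\<kappa> = (m + 1) powr (- \<tau>) / n"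
  obtain k q where q: "q \<in> forms (2 ^ k) T i0"
    "\<And>j. \<exists>c::nat. \<bar>(\<Sum>i\<in>UNIV. real (q i) * (2 ^ L * z $ (i, j) - real (a (i, j)))) - real c\<bar> \<le> \<kappa> * (2 ^ (L + k + 1)) powr (- \<tau>)"
    using near unfolding near_form_def T_def[symmetric] \<kappa>_def m_def n_def by auto
  have "\<exists>c :: 'n \<Rightarrow> nat. \<forall>j. \<bar>(\<Sum>i\<in>UNIV. real (q i) * (2 ^ L * z $ (i, j) - real (a (i, j)))) - real (c j)\<bar>
      \<le> \<kappa> * (2 ^ (L + k + 1)) powr (- \<tau>)"
    by (intro choice allI q(2))
  then obtain c :: "'n \<Rightarrow> nat" where
    c: "\<And>j. \<bar>(\<Sum>i\<in>UNIV. real (q i) * (2 ^ L * z $ (i, j) - real (a (i, j)))) - real (c j)\<bar> \<le> \<kappa> * (2 ^ (L + k + 1)) powr (- \<tau>)"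
    by blast
  define B :: real where "B = 2 ^ (L + k + 1)"
  have B: "B \<ge> 1" unfolding B_def by (rule one_le_power) simp
  define N where "N j = int (c j) + (\<Sum>i\<in>UNIV. int (q i) * int (a (i, j)))" for j
  define r :: "int ^ 'm" where "r = (\<chi> i. if i \<in> range \<iota> then - N (inv \<iota> i) else 2 ^ L * int (q i))"
  have q0: "q i = 0" if "i \<in> range \<iota>" for i
    using formsD(4)[OF q(1), of i] that i0 by (auto simp: T_def)
  have S: "\<bar>(\<Sum>i\<in>UNIV - range \<iota>. real_of_int (r $ i) * z $ (i, j)) + real_of_int (r $ \<iota> j)\<bar> \<le> \<kappa> * B powr (- \<tau>)" for j
  proof -
    have "(\<Sum>i\<in>UNIV - range \<iota>. real_of_int (r $ i) * z $ (i, j)) = (\<Sum>i\<in>UNIV - range \<iota>. real (q i) * (2 ^ L * z $ (i, j)))"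
      by (intro sum.cong) (auto simp: r_def)
    also have "\<dots> = (\<Sum>i\<in>UNIV. real (q i) * (2 ^ L * z $ (i, j)))"
      using q0 by (intro sum.mono_neutral_left) auto
    finally have "(\<Sum>i\<in>UNIV - range \<iota>. real_of_int (r $ i) * z $ (i, j)) + real_of_int (r $ \<iota> j)
      = (\<Sum>i\<in>UNIV. real (q i) * (2 ^ L * z $ (i, j) - real (a (i, j)))) - real (c j)"
      using \<iota> by (simp add: r_def N_def right_diff_distrib sum_subtractf)
    then show ?thesis using c[of j] by (simp add: B_def)
  qed
  have \<kappa>: "\<kappa> > 0" "\<kappa> \<le> 1"
  proof -
    show "\<kappa> > 0" using mn by (simp add: \<kappa>_def)
    have "(m + 1) powr (- \<tau>) \<le> (m + 1) powr 0" using mn \<tau> by (intro powr_mono) auto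
    then have "(m + 1) powr (- \<tau>) \<le> n" using mn by simp
    then show "\<kappa> \<le> 1" using mn by (simp add: \<kappa>_def)
  qed
  have rT: "0 \<le> real_of_int (r $ i) \<and> real_of_int (r $ i) \<le> B" if "i \<notin> range \<iota>" for i
  proof -
    have "q i < 2 * 2 ^ k" using formsD(5)[OF q(1)] by simp
    then have "real (q i) \<le> real (2 * 2 ^ k)" by (intro of_nat_mono less_imp_le)
    then have "2 ^ L * real (q i) \<le> 2 ^ L * (2 * 2 ^ k)" by (intro mult_left_mono) auto
    then show ?thesis using that by (simp add: r_def B_def power_add)
  qed
  have rS: "\<bar>real_of_int (r $ \<iota> j)\<bar> \<le> (m + 1) * B" for j
  proof -
    have "B powr (- \<tau>) \<le> B powr 0" using B \<tau> by (intro powr_mono) auto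
    then have "\<kappa> * B powr (- \<tau>) \<le> 1 * 1" using \<kappa> B by (intro mult_mono) auto
    moreover have "\<bar>\<Sum>i\<in>UNIV - range \<iota>. real_of_int (r $ i) * z $ (i, j)\<bar> \<le> (\<Sum>i\<in>UNIV - range \<iota>. B * 1)"
    proof (intro order_trans[OF sum_abs] sum_mono)
      fix i assume "i \<in> UNIV - range \<iota>"
      then show "\<bar>real_of_int (r $ i) * z $ (i, j)\<bar> \<le> B * 1"
        unfolding abs_mult using rT[of i] z[of "(i, j)"] B by (intro mult_mono) auto
    qed
    moreover have "(\<Sum>i\<in>UNIV - range \<iota>. B * 1) \<le> m * B"
    proof -
      have "card (UNIV - range \<iota>) \<le> CARD('m)" by (intro card_mono) auto
      then show ?thesis using B by (simp add: m_def mult_right_mono)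
    qed
    ultimately have "\<bar>real_of_int (r $ \<iota> j)\<bar> \<le> m * B + 1" using S[of j] by linarith
    then show ?thesis using B by (simp add: distrib_right)
  qed
  have "infnorm (real_vec r) \<le> (m + 1) * B"
  proof -
    obtain i where i: "infnorm (real_vec r) = \<bar>real_vec r $ i\<bar>" using infnorm_attained by blast
    show ?thesis
    proof (cases "i \<in> range \<iota>")
      case True then show ?thesis using rS i by (auto simp: real_vec_def)
    next
      case False
      have "1 * B \<le> (m + 1) * B" using mn B by (intro mult_right_mono) auto
      then show ?thesis using rT[OF False] i by (simp add: real_vec_def)
    qed
  qed
  moreover have r0: "r $ i0 \<ge> 2 ^ L"
  proof -
    have "q i0 \<ge> 1" using formsD(1)[OF q(1)] one_le_power[of "2::nat" k] by linarith
    then have "2 ^ L * int (q i0) \<ge> 2 ^ L * 1" by (intro mult_left_mono) auto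
    then show ?thesis using i0 by (simp add: r_def)
  qed
  moreover have "infnorm (real_vec r) > 0"
  proof -
    have "r $ i0 > 0" using r0 less_le_trans[of 0 "2 ^ L" "r $ i0"] by simp
    then have "r \<noteq> 0" by auto
    then show ?thesis using infnorm_real_vec_ge_1[of r] by linarith
  qed
  ultimately have big: "((m + 1) * B) powr (- \<tau>) \<le> infnorm (real_vec r) powr (- \<tau>)"
    using \<tau> by (intro powr_mono2') auto
  have "infnorm (real_vec r v* block_chart \<iota> z) < ((m + 1) * B) powr (- \<tau>)"
  proof -
    obtain l where l: "infnorm (real_vec r v* block_chart \<iota> z) = \<bar>(real_vec r v* block_chart \<iota> z) $ l\<bar>"
      using infnorm_attained by blast
    have "\<bar>(real_vec r v* block_chart \<iota> z) $ l\<bar> \<le> (\<Sum>j\<in>(UNIV::'n set). (\<kappa> * B powr (- \<tau>)) * (1/2))"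
      unfolding block_chart_form[OF \<iota>]
    proof (intro order_trans[OF sum_abs] sum_mono)
      fix j
      show "\<bar>((\<Sum>i\<in>UNIV - range \<iota>. real_of_int (r $ i) * z $ (i, j)) + real_of_int (r $ \<iota> j)) * square_block \<iota> z j l\<bar>
          \<le> (\<kappa> * B powr (- \<tau>)) * (1/2)"
        unfolding abs_mult using S[of j] square_block_bounds[OF z, of \<iota> j l] \<kappa> by (intro mult_mono) auto
    qed
    also have "\<dots> = n * \<kappa> * B powr (- \<tau>) / 2" by (simp add: n_def)
    also have "n * \<kappa> = (m + 1) powr (- \<tau>)" using mn by (simp add: \<kappa>_def)
    also have "(m + 1) powr (- \<tau>) * B powr (- \<tau>) / 2 = ((m + 1) * B) powr (- \<tau>) / 2"
      by (simp add: powr_mult)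
    also have "\<dots> < ((m + 1) * B) powr (- \<tau>)" using mn B by simp
    finally show ?thesis unfolding l .
  qed
  with big r0 that show thesis by (meson less_le_trans)
qed

text \<open>The solutions belonging to different \<open>L j\<close> have unbounded entries at \<open>i0\<close>, so there are infinitely many.\<close>

lemma block_chart_in_W0:
  fixes z :: "real ^ ('m::finite \<times> 'n::finite)" and \<iota> :: "'n \<Rightarrow> 'm" and L :: "nat \<Rightarrow> nat"
  assumes \<iota>: "inj \<iota>" and i0: "i0 \<notin> range \<iota>" and \<tau>: "\<tau> > 0" and L: "strict_mono L"
    and z: "\<And>p. 0 \<le> z $ p \<and> z $ p \<le> 1"
    and near: "\<And>j. \<exists>a :: 'm \<times> 'n \<Rightarrow> nat. (\<chi> i. 2 ^ L j * z $ i - real (a i))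
      \<in> near_form \<tau> ((real CARD('m) + 1) powr (- \<tau>) / real CARD('n)) (UNIV - range \<iota>) i0 (L j)"
  shows "block_chart \<iota> z \<in> W0 \<tau>"
proof -
  define A where "A = {q :: int ^ 'm. q \<noteq> 0 \<and>
    infnorm (real_vec q v* block_chart \<iota> z) < infnorm (real_vec q) powr (- \<tau>)}"
  have ex: "\<exists>r\<in>A. r $ i0 \<ge> 2 ^ L j" for j
  proof -
    obtain a :: "'m \<times> 'n \<Rightarrow> nat" where a: "(\<chi> i. 2 ^ L j * z $ i - real (a i))
      \<in> near_form \<tau> ((real CARD('m) + 1) powr (- \<tau>) / real CARD('n)) (UNIV - range \<iota>) i0 (L j)"
      using near[of j] by (rule exE)
    obtain r :: "int ^ 'm" where r: "r $ i0 \<ge> 2 ^ L j"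
      "infnorm (real_vec r v* block_chart \<iota> z) < infnorm (real_vec r) powr (- \<tau>)"
      by (rule form_of_near_form[OF \<iota> i0 \<tau> z a])
    have "r $ i0 > 0" using r(1) less_le_trans[of 0 "2 ^ L j" "r $ i0"] by simp
    then have "r \<noteq> 0" by auto
    with r show ?thesis by (auto simp: A_def)
  qed
  have "infinite A"
  proof
    assume fin: "finite A"
    then have "finite ((\<lambda>r. r $ i0) ` A)" by simp
    then obtain M where M: "\<And>r. r \<in> A \<Longrightarrow> r $ i0 \<le> M" by (meson finite_imageI Max_ge imageI)
    define j where "j = nat M + 1"
    obtain r where r: "r \<in> A" "r $ i0 \<ge> 2 ^ L j" using ex by blast
    have "j \<le> L j" using L by (rule strict_mono_imp_increasing)
    moreover have "L j < 2 ^ L j" by (rule less_exp)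
    ultimately have "int j < int (2 ^ L j)" by (simp only: of_nat_less_iff)
    then have "int j < 2 ^ L j" by simp
    moreover have "M < int j" by (simp add: j_def)
    ultimately show False using M[OF r(1)] r(2) by linarith
  qed
  then show ?thesis using block_chart_in_cube[OF z] by (simp add: W0_def A_def)
qed

lemma hausdorff_measure_W0_pos:
  assumes card: "CARD('m::finite) > CARD('n::finite)" and \<tau>: "\<tau> > real CARD('m) / real CARD('n) - 1"
    and s: "0 \<le> s" "s < (real CARD('m) - 1) * real CARD('n) + real CARD('m) / (\<tau> + 1)"
  shows "hausdorff_measure s (W0 \<tau> :: (real ^ 'n ^ 'm) set) \<noteq> 0"
proof
  assume null: "hausdorff_measure s (W0 \<tau> :: (real ^ 'n ^ 'm) set) = 0"
  define s0 where "s0 = (real CARD('m) - 1) * real CARD('n) + real CARD('m) / (\<tau> + 1)"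
  define s1 where "s1 = (s + s0) / 2"
  (* Energies decay with exponent s2, which gives positive measure in dimension s1 > s; moreover s1 > 0. *)
  define s2 where "s2 = (s1 + s0) / 2"
  have "s < s0" using s(2) unfolding s0_def .
  then have s012: "s < s1" "s1 < s2" "s2 < s0" by (simp_all add: s1_def s2_def)
  have \<tau>0: "\<tau> > 0"
  proof -
    have "real CARD('m) / real CARD('n) > 1" using card by simp
    then show ?thesis using \<tau> by linarith
  qed
  obtain \<iota> :: "'n \<Rightarrow> 'm" where \<iota>: "inj \<iota>"
    using card_le_inj[of "UNIV :: 'n set" "UNIV :: 'm set"] card by auto
  define T where "T = UNIV - range \<iota>"
  have cT: "card T + CARD('n) = CARD('m)"
  proof -
    have "card (range \<iota>) = CARD('n)" using \<iota> by (rule card_image)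
    then show ?thesis unfolding T_def using card by (simp add: card_Diff_subset)
  qed
  then have "T \<noteq> {}" using card by auto
  then obtain i0 where i0: "i0 \<in> T" by auto
  define \<kappa> where "\<kappa> = (real CARD('m) + 1) powr (- \<tau>) / real CARD('n)"
  have \<kappa>: "\<kappa> > 0" by (simp add: \<kappa>_def add_nonneg_pos)
  have "real CARD('m) / (\<tau> + 1) < real CARD('n)" using \<tau> \<tau>0 by (simp add: field_simps)
  then have "s0 < real CARD('m) * real CARD('n)" by (simp add: s0_def left_diff_distrib)
  then have "s2 < real CARD('m) * real CARD('n)" using s012 by linarith
  moreover have "s2 < (real CARD('m) - 1) * real CARD('n) + real (card T + CARD('n)) / (\<tau> + 1)"
    unfolding cT using s012 by (simp add: s0_def)
  moreover have "s2 > 0" using s012 s(1) by linarith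
  ultimately obtain C where C: "C \<ge> 1" "\<And>L. \<exists>\<Delta> h. \<Delta> > 0 \<and> pattern s2 C \<Delta> h \<and>
    (\<forall>y\<in>grid (2 ^ \<Delta>). h y \<noteq> 0 \<longrightarrow> dyadic_cube \<Delta> y \<subseteq> (near_form \<tau> \<kappa> T i0 L :: (real ^ ('m \<times> 'n)) set))"
    using exists_pattern_near_form[OF i0 \<tau>0 \<kappa>, where 'n = 'n] by blast
  have "0 < s1" using s012 s(1) by linarith
  obtain K :: "(real ^ ('m \<times> 'n)) set" and L where K: "hausdorff_measure s1 K \<noteq> 0" "strict_mono (L :: nat \<Rightarrow> nat)"
    "\<And>z i. z \<in> K \<Longrightarrow> 0 \<le> z $ i \<and> z $ i \<le> 1"
    "\<And>z j. z \<in> K \<Longrightarrow> \<exists>a :: 'm \<times> 'n \<Rightarrow> nat. (\<chi> i. 2 ^ L j * z $ i - real (a i)) \<in> near_form \<tau> \<kappa> T i0 (L j)"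
    by (rule pattern_concatenation[where G = "near_form \<tau> \<kappa> T i0", OF C(1) \<open>0 < s1\<close> s012(2) C(2)]) (rule that)
  have "block_chart \<iota> ` K \<subseteq> W0 \<tau>"
  proof clarify
    fix z assume z: "z \<in> K"
    show "block_chart \<iota> z \<in> W0 \<tau>"
      using i0 K(3)[OF z] K(4)[OF z] unfolding T_def \<kappa>_def
      by (intro block_chart_in_W0[OF \<iota> _ \<tau>0 K(2)]) auto
  qed
  moreover have "hausdorff_measure s1 (W0 \<tau> :: (real ^ 'n ^ 'm) set) = 0"
    using null_measure_mono_exponent[OF null s(1)] s012 by simp
  ultimately have "hausdorff_measure s1 (block_chart \<iota> ` K) = 0" by (rule hausdorff_measure_subset)
  then have "hausdorff_measure s1 K = 0"
    using \<open>0 < s1\<close> K(3)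
    by (intro null_measure_expanding[where f = "block_chart \<iota>" and c = "1 / (16 * real CARD('n) * real CARD('m \<times> 'n))"]
        block_chart_expanding \<iota>) auto
  with K(1) show False by simp
qed

theorem corollary3:
  fixes \<tau> :: real
  assumes "CARD('m::finite) > CARD('n::finite)"
    and "\<tau> > real CARD('m) / real CARD('n) - 1"
  shows "hausdorff_dim (W0 \<tau> :: (real ^ 'n ^ 'm) set) =
    ereal ((real CARD('m) - 1) * real CARD('n) + real CARD('m) / (\<tau> + 1))"
proof (rule hausdorff_dim_eqI)
  have "real CARD('m) / real CARD('n) > 1" using assms(1) by simp
  then have \<tau>: "\<tau> > 0" using assms(2) by linarith
  have "real CARD('m) \<ge> 1" by (simp add: Suc_le_eq)
  then show "0 \<le> (real CARD('m) - 1) * real CARD('n) + real CARD('m) / (\<tau> + 1)"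
    using \<tau> by (intro add_nonneg_nonneg mult_nonneg_nonneg divide_nonneg_nonneg) auto
  show "hausdorff_measure s (W0 \<tau> :: (real ^ 'n ^ 'm) set) = 0"
    if "s > (real CARD('m) - 1) * real CARD('n) + real CARD('m) / (\<tau> + 1)" for s
    using null_measure_W0[OF \<tau> that] .
  show "hausdorff_measure s (W0 \<tau> :: (real ^ 'n ^ 'm) set) \<noteq> 0"
    if "0 \<le> s" "s < (real CARD('m) - 1) * real CARD('n) + real CARD('m) / (\<tau> + 1)" for s
    using hausdorff_measure_W0_pos[OF assms that] .
qed

end
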